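(* Let $\mathcal X=\{x_1,x_2,\dots\}$ and $\mathcal A=\{A_1,A_2,\dots\}$, together with $\mathrm{vbl},\mathrm{rsp},\mathrm{stc},\Gamma,\prec$, be as in the setting described in the context. Assume: (i) the sets $\mathrm{rsp}(A_i)$, $\mathrm{vbl}(A_i)$, and the finite set of assignments of the variables in $\mathrm{vbl}(A_i)$ that make $A_i$ true are all computably presented; (ii) each $x_i$ has a rational-valued probability distribution that is uniformly computable with respect to $i$, and the set $\{j: x_i\in\mathrm{rsp}(A_j)\}$ is finite and computably presented; (iii) the order $\prec$ is computable; (iv) there are functions $P^*:\mathcal A\to(0,1)$ and $z:\mathcal A\to(0,1)$ and a rational constant $\alpha\in(0,1)$ such that for all $A\in\mathcal A$ $$P^*(A)\ \ge\ \sup_{\mu\in\mathcal E_A}\Pr(A\mid E_\mu)\qquad\text{and}\qquad P^*(A)\ \le\ \alpha\, z(A)\prod_{B\in\Gamma(A)}\bigl(1-z(B)\bigr).$$ Then there is a computable valuation of $\mathcal X$ which makes each $A\in\mathcal A$ false.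
   Context: Setting. $\mathcal X$ is a countable set of mutually independent random variables with finite ranges. $\mathcal A$ is a countable set of events in the sigma-algebra $\sigma(\mathcal X)$; each $A\in\mathcal A$ comes with a finite set $\mathrm{vbl}(A)\subset\mathcal X$ with $A\in\sigma(\mathrm{vbl}(A))$ (so the truth of $A$ is determined by the values of the variables in $\mathrm{vbl}(A)$) and a chosen subset $\mathrm{rsp}(A)\subset\mathrm{vbl}(A)$ (the resample variables). Put $\mathrm{stc}(A)=\mathrm{vbl}(A)\setminus\mathrm{rsp}(A)$, $\Gamma(A)=\{B\in\mathcal A: B\ne A,\ \mathrm{rsp}(A)\cap\mathrm{rsp}(B)\neq\emptyset\}$ and $\Gamma^+(A)=\Gamma(A)\cup\{A\}$. $\prec$ is a linear order on $\mathcal A$ of type $\omega$ such that for all $A,B,C\in\mathcal A$: if $A\in\Gamma^+(B)$ and $A\notin\Gamma^+(C)$, then $C\succ B$ implies $C\succ A$. Write $A\ll B$ (equivalently $B\gg A$) if $A\prec B$ and $A\notin\Gamma(B)$. It is also required that $A\gg B$ implies $\mathrm{rsp}(A)\cap\mathrm{vbl}(B)=\emptyset$. $\mathcal E_A$ is the set of valuations of $\mathrm{stc}(A)$ (assignments to each variable in $\mathrm{stc}(A)$ of a value in its range). For a valuation $\mu$ of a set $S$ of variables, $E_\mu$ is the event that each $x\in S$ takes the value $\mu(x)$. Conditional probabilities $\Pr(A\mid E_\mu)$ are considered only for $\mu$ with $\Pr(E_\mu)>0$. A countable family of finite sets $X_1,X_2,\dots$ (of codes for variables, indices, assignments, etc.)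 is computably presented if the Gödel code of the finite set $X_i$ is uniformly computable with respect to $i$. The order $\prec$ is computable if $\{(i,j):A_i\prec A_j\}$ is computable. A valuation of $\mathcal X$ is computable if $i\mapsto$ (value of $x_i$) is computable. *)

theory Defs
  imports "HOL-Probability.Probability" "HOL-Library.Nat_Bijection"
begin

section \<open>Computability\<close>

text \<open>
  The total recursive functions in one argument. Several arguments are passed through the
  pairing function \<open>prod_encode\<close>, which replaces arities and projections. Minimisation is
  restricted to total (regular) instances, so that only total functions arise.
\<close>

inductive computable :: "(nat \<Rightarrow> nat) \<Rightarrow> bool" where
  zero: "computable (\<lambda>n. 0)"
| succ: "computable Suc"
| left: "computable (\<lambda>n. fst (prod_decode n))"
| right: "computable (\<lambda>n. snd (prod_decode n))"
| pair: "computable (\<lambda>n. prod_encode (f n, g n))" if "computable f" "computable g"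
| comp: "computable (\<lambda>n. f (g n))" if "computable f" "computable g"
| prec: "computable (\<lambda>n. case prod_decode n of
             (a, k) \<Rightarrow> rec_nat (f a) (\<lambda>m r. g (prod_encode (a, prod_encode (m, r)))) k)"
    if "computable f" "computable g"
| mu: "computable (\<lambda>n. LEAST k. f (prod_encode (n, k)) = 0)"
    if "computable f" "\<forall>n. \<exists>k. f (prod_encode (n, k)) = 0"

definition computable_rel :: "(nat \<Rightarrow> nat \<Rightarrow> bool) \<Rightarrow> bool" where
  "computable_rel r \<longleftrightarrow> computable (\<lambda>n. case prod_decode n of (i, j) \<Rightarrow> of_bool (r i j))"

definition rat_code :: "rat \<Rightarrow> nat" where
  "rat_code q = (case quotient_of q of (a, b) \<Rightarrow> prod_encode (int_encode a, int_encode b))"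

text \<open>
  The finiteness requirement matters: the library function \<open>set_encode\<close> maps every infinite
  set to 0, which is also the code of the empty set.
\<close>

definition computably_presented :: "(nat \<Rightarrow> nat set) \<Rightarrow> bool" where
  "computably_presented F \<longleftrightarrow> (\<forall>i. finite (F i)) \<and> computable (\<lambda>i. set_encode (F i))"

text \<open>An assignment on a finite set of variables is coded by its graph. On the functions in
  \<open>PiE S R\<close> the code is injective if \<open>S\<close> is finite.\<close>

definition assignment_code :: "nat set \<Rightarrow> (nat \<Rightarrow> nat) \<Rightarrow> nat" where
  "assignment_code S \<mu> = set_encode ((\<lambda>x. prod_encode (x, \<mu> x)) ` S)"

section \<open>Events, resample variables and the order\<close>

text \<open>
  Variables and events are referred to by their indices, and values of variables are natural
  numbers. The random variable with index \<open>x\<close> is \<open>X x\<close>, and \<open>R x\<close> is its range.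
\<close>

definition stc :: "(nat \<Rightarrow> nat set) \<Rightarrow> (nat \<Rightarrow> nat set) \<Rightarrow> nat \<Rightarrow> nat set" where
  "stc vbl rsp a = vbl a - rsp a"

definition Gam :: "(nat \<Rightarrow> nat set) \<Rightarrow> nat \<Rightarrow> nat set" where
  "Gam rsp a = {b. b \<noteq> a \<and> rsp a \<inter> rsp b \<noteq> {}}"

definition Gam_plus :: "(nat \<Rightarrow> nat set) \<Rightarrow> nat \<Rightarrow> nat set" where
  "Gam_plus rsp a = insert a (Gam rsp a)"

definition much_less :: "(nat \<Rightarrow> nat set) \<Rightarrow> (nat \<Rightarrow> nat \<Rightarrow> bool) \<Rightarrow> nat \<Rightarrow> nat \<Rightarrow> bool" where
  "much_less rsp prc a b \<longleftrightarrow> prc a b \<and> a \<notin> Gam rsp b"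

text \<open>A strict linear order on the natural numbers that is isomorphic to the usual one.\<close>

definition order_type_omega :: "(nat \<Rightarrow> nat \<Rightarrow> bool) \<Rightarrow> bool" where
  "order_type_omega prc \<longleftrightarrow> (\<exists>f :: nat \<Rightarrow> nat. bij f \<and> (\<forall>a b. prc a b \<longleftrightarrow> f a < f b))"

definition sigma_vars :: "'w measure \<Rightarrow> (nat \<Rightarrow> 'w \<Rightarrow> nat) \<Rightarrow> nat set \<Rightarrow> 'w set set" where
  "sigma_vars M X S = sigma_sets (space M) {X x -` B \<inter> space M | x B. x \<in> S}"

definition val_event :: "'w measure \<Rightarrow> (nat \<Rightarrow> 'w \<Rightarrow> nat) \<Rightarrow> nat set \<Rightarrow> (nat \<Rightarrow> nat) \<Rightarrow> 'w set" where
  "val_event M X S \<mu> = {\<omega> \<in> space M. \<forall>x\<in>S. X x \<omega> = \<mu> x}"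

text \<open>
  \<open>tru a\<close> is the set of those assignments to the variables in \<open>vbl a\<close> that make the event \<open>A a\<close>
  true. It represents \<open>A a\<close> through the values of the variables. It is a parameter since not
  every assignment needs to be realised by a point of an arbitrary sample space; it is determined
  by \<open>A a\<close> if every assignment is realised, as in the product space.
\<close>

locale resample_setting = prob_space M
  for M :: "'w measure" +
  fixes X :: "nat \<Rightarrow> 'w \<Rightarrow> nat"
    and R :: "nat \<Rightarrow> nat set"
    and A :: "nat \<Rightarrow> 'w set"
    and vbl rsp :: "nat \<Rightarrow> nat set"
    and tru :: "nat \<Rightarrow> (nat \<Rightarrow> nat) set"
    and prc :: "nat \<Rightarrow> nat \<Rightarrow> bool"  (infix "\<prec>" 50)
  assumes finite_R: "finite (R x)"
    and indep: "indep_vars (\<lambda>x. count_space (R x)) X UNIV"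
    and finite_vbl: "finite (vbl a)"
    and rsp_subset: "rsp a \<subseteq> vbl a"
    and event_sigma: "A a \<in> sigma_vars M X (vbl a)"
    and tru_subset: "tru a \<subseteq> PiE (vbl a) R"
    and event_tru: "A a = {\<omega> \<in> space M. restrict (\<lambda>x. X x \<omega>) (vbl a) \<in> tru a}"
    and omega: "order_type_omega (\<prec>)"
    and order_Gam: "a \<in> Gam_plus rsp b \<Longrightarrow> a \<notin> Gam_plus rsp c \<Longrightarrow> b \<prec> c \<Longrightarrow> a \<prec> c"
    and order_vbl: "much_less rsp (\<prec>) b a \<Longrightarrow> rsp a \<inter> vbl b = {}"

end

theory Submission
  imports Defs
begin

text \<open>
  The valuation is found by derandomizing a resampling process. Start from random values and, as
  long as some event is true, draw new values for the resample variables of the \<open>\<prec>\<close>-least true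
  event. For a finite initial segment of the events this process ends almost surely, and then all
  events of the segment are false. The point is that for each variable the distribution of its
  final value converges as the segment grows, with a computable rate of convergence. A prefix of a
  valuation that keeps a positive probability in the limit can be recognised at a finite stage
  (\<open>certified\<close>), it can always be prolonged by one value (\<open>certified_extend\<close>), and it makes no event
  true that it decides (\<open>certified_sound\<close>). Searching for longer and longer certified prefixes
  computes a valuation that makes all events false.

  The rate of convergence comes from the log of resampled events. Because the least true event is
  always chosen, the next event is either a neighbour of the present one or larger (\<open>pick_next\<close>).
  To a resampling of \<open>b\<close> belongs its past cone: the earlier events that are linked to it by a chain
  of neighbours. The compatibility of \<open>\<prec>\<close> with the neighbour relation implies that all events outside
  the cone which occur before it is completed are smaller than the events of the cone still to come
  and do not look at their resample variables. So a given cone occurs with probability at most the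
  product of the weights \<open>P\<^sup>*\<close> of its elements (\<open>expect_follows\<close>), even though the truth of an event
  depends on variables that are not resampled. The order also restricts the possible cones so
  severely that their weights can be summed by a telescoping product (\<open>words_sum\<close>). With the factor
  \<open>\<alpha>\<close> in the hypothesis, cones of length at least \<open>L\<close> have a total weight that decays exponentially
  in \<open>L\<close> (\<open>expected_count\<close>). If an event near a given variable is resampled after a large initial
  segment was free of true events, then its cone leads out of the segment and is long
  (\<open>late_resampling_long_cone\<close>). This is the content of \<open>stability\<close>.

  The numbers \<open>z\<close> and \<open>P\<^sup>*\<close> cannot enter the computation, for they are only known to exist. Replacing
  \<open>z\<close> by \<open>\<surd>\<alpha> * z\<close> gives bounds that are uniform in the event and depend on fixed integers only. For an
  exact computation of the probabilities, a run of the process is made a function of a single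
  uniformly distributed number (\<open>card_tape_run\<close>), so that probabilities become cardinalities.

  It remains to present finite initial segments computably. Although \<open>\<prec>\<close> is decidable, the number
  of predecessors of an event may not be computable. There are two cases (\<open>ex_staging\<close>). If some
  connected component of the neighbour relation is infinite, then all other events are finitely
  many and precede it, and within it the predecessors of \<open>b\<close> are reached from \<open>b\<close> along neighbours.
  If all components are finite, \<open>\<prec>\<close> is replaced by another order that has the same compatibility
  properties and computable initial segments. The case distinction is not effective, but the
  theorem claims only that a computable valuation exists.
\<close>

section \<open>Closure properties of computable functions\<close>

abbreviation pfst :: "nat \<Rightarrow> nat" where "pfst n \<equiv> fst (prod_decode n)"
abbreviation psnd :: "nat \<Rightarrow> nat" where "psnd n \<equiv> snd (prod_decode n)"

text \<open>
  Predicates with several arguments are treated like functions with several arguments: the closure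
  rules for binders ask for decidability of the body as a predicate of one number, in which the bound
  variable is the second component. Backward application of the rules collected in
  \<open>computable_intros\<close> then settles every expression built from computable pieces.
\<close>

definition decidable :: "(nat \<Rightarrow> bool) \<Rightarrow> bool" where
  "decidable P \<longleftrightarrow> computable (\<lambda>n. of_bool (P n))"

lemma computable_id: "computable (\<lambda>n. n)"
  using computable.pair[OF computable.left computable.right] by simp

lemma computable_const: "computable (\<lambda>n. c)"
proof (induction c)
  case (Suc c)
  show ?case using computable.comp[OF computable.succ Suc] .
qed (rule computable.zero)

lemma computable_pfst: "computable f \<Longrightarrow> computable (\<lambda>n. pfst (f n))"
  using computable.comp[OF computable.left] .

lemma computable_psnd: "computable f \<Longrightarrow> computable (\<lambda>n. psnd (f n))"
  using computable.comp[OF computable.right] .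

lemma computable_Suc: "computable f \<Longrightarrow> computable (\<lambda>n. Suc (f n))"
  using computable.comp[OF computable.succ] .

lemma computable_comp2:
  assumes "computable (\<lambda>m. h (pfst m) (psnd m))" "computable f" "computable g"
  shows "computable (\<lambda>n. h (f n) (g n))"
  using computable.comp[OF assms(1) computable.pair[OF assms(2,3)]] by simp

lemma computable_comp3:
  assumes "computable (\<lambda>m. h (pfst m) (pfst (psnd m)) (psnd (psnd m)))"
    "computable f" "computable g" "computable k"
  shows "computable (\<lambda>n. h (f n) (g n) (k n))"
  using computable.comp[OF assms(1) computable.pair[OF assms(2) computable.pair[OF assms(3,4)]]]
  by simp

lemma computable_rec:
  assumes f: "computable f"
    and g: "computable (\<lambda>m. g (pfst m) (pfst (psnd m)) (psnd (psnd m)))"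
    and h: "computable h"
  shows "computable (\<lambda>n. rec_nat (f n) (\<lambda>m r. g n m r) (h n))"
  using computable.comp[OF computable.prec[OF f g] computable.pair[OF computable_id h]]
  by simp

lemma computable_add:
  assumes "computable f" "computable g" shows "computable (\<lambda>n. f n + g n)"
proof -
  have "rec_nat a (\<lambda>m r. Suc r) b = a + b" for a b :: nat by (induction b) auto
  then show ?thesis
    using computable_rec[OF assms(1) _ assms(2), of "\<lambda>n m r. Suc r"]
    by (simp add: computable_Suc computable_psnd computable_id)
qed

lemma computable_mult:
  assumes "computable f" "computable g" shows "computable (\<lambda>n. f n * g n)"
proof -
  have "rec_nat 0 (\<lambda>m r. r + a) b = a * b" for a b :: nat by (induction b) auto
  moreover have "computable (\<lambda>m. psnd (psnd m) + f (pfst m))"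
    by (intro computable_add computable_psnd computable_id computable.comp[OF assms(1)] computable_pfst)
  ultimately show ?thesis
    using computable_rec[OF computable_const[of 0] _ assms(2), of "\<lambda>n m r. r + f n"] by simp
qed

lemma computable_power:
  assumes "computable f" "computable g" shows "computable (\<lambda>n. f n ^ g n)"
proof -
  have "rec_nat 1 (\<lambda>m r. r * a) b = a ^ b" for a b :: nat by (induction b) auto
  moreover have "computable (\<lambda>m. psnd (psnd m) * f (pfst m))"
    by (intro computable_mult computable_psnd computable_id computable.comp[OF assms(1)] computable_pfst)
  ultimately show ?thesis
    using computable_rec[OF computable_const[of 1] _ assms(2), of "\<lambda>n m r. r * f n"] by simp
qed

lemma computable_minus:
  assumes "computable f" "computable g" shows "computable (\<lambda>n. f n - g n)"
proof -
  have "rec_nat 0 (\<lambda>m r. m) b = b - 1" for b :: nat by (cases b) auto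
  then have pred: "computable (\<lambda>n. h n - 1)" if "computable h" for h
    using computable_rec[OF computable_const[of 0] _ that, of "\<lambda>n m r. m"]
    by (simp add: computable_pfst computable_psnd computable_id)
  have "rec_nat a (\<lambda>m r. r - 1) b = a - b" for a b :: nat by (induction b) auto
  moreover have "computable (\<lambda>m. psnd (psnd m) - 1)"
    by (intro pred computable_psnd computable_id)
  ultimately show ?thesis
    using computable_rec[OF assms(1) _ assms(2), of "\<lambda>n m r. r - 1"] by simp
qed

lemma computable_sum:
  assumes "computable (\<lambda>m. g (pfst m) (psnd m))" "computable h"
  shows "computable (\<lambda>n. \<Sum>x<h n. g n x)"
proof -
  have "rec_nat 0 (\<lambda>m r. r + k m) b = (\<Sum>x<b. k x)" for b :: nat and k :: "nat \<Rightarrow> nat"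
    by (induction b) auto
  moreover have "computable (\<lambda>m. psnd (psnd m) + g (pfst m) (pfst (psnd m)))"
    by (intro computable_add computable_psnd computable_id computable_comp2[OF assms(1)] computable_pfst)
  ultimately show ?thesis
    using computable_rec[OF computable_const[of 0] _ assms(2), of "\<lambda>n m r. r + g n m"] by simp
qed

lemma computable_funpow:
  assumes "computable (\<lambda>m. g (pfst m) (psnd m))" "computable f" "computable h"
  shows "computable (\<lambda>n. (g n ^^ h n) (f n))"
proof -
  have "rec_nat a (\<lambda>m r. k r) b = (k ^^ b) a" for a b :: nat and k :: "nat \<Rightarrow> nat"
    by (induction b) auto
  moreover have "computable (\<lambda>m. g (pfst m) (psnd (psnd m)))"
    by (intro computable_comp2[OF assms(1)] computable_psnd computable_id computable_pfst)
  ultimately show ?thesis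
    using computable_rec[OF assms(2) _ assms(3), of "\<lambda>n m r. g n r"] by simp
qed

lemma decidable_not: "decidable P \<Longrightarrow> decidable (\<lambda>n. \<not> P n)"
proof -
  assume "decidable P"
  moreover have "of_bool (\<not> b) = (1 :: nat) - of_bool b" for b by simp
  ultimately show ?thesis
    unfolding decidable_def by (simp only:) (rule computable_minus[OF computable_const])
qed

lemma decidable_conj: "decidable P \<Longrightarrow> decidable Q \<Longrightarrow> decidable (\<lambda>n. P n \<and> Q n)"
  using computable_mult[of "\<lambda>n. of_bool (P n)" "\<lambda>n. of_bool (Q n)"]
  by (simp add: decidable_def of_bool_conj)

lemma decidable_disj: "decidable P \<Longrightarrow> decidable Q \<Longrightarrow> decidable (\<lambda>n. P n \<or> Q n)"
  using decidable_not[OF decidable_conj[OF decidable_not decidable_not, of P Q]] by simp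

lemma decidable_imp: "decidable P \<Longrightarrow> decidable Q \<Longrightarrow> decidable (\<lambda>n. P n \<longrightarrow> Q n)"
  unfolding imp_conv_disj by (intro decidable_disj decidable_not)

lemma decidable_eq_0:
  assumes "computable f" shows "decidable (\<lambda>n. f n = 0)"
proof -
  have "of_bool (a = 0) = 1 - a" for a :: nat by simp
  then show ?thesis
    using computable_minus[OF computable_const[of 1] assms] by (simp add: decidable_def)
qed

lemma decidable_le:
  "computable f \<Longrightarrow> computable g \<Longrightarrow> decidable (\<lambda>n. f n \<le> g n)"
  using decidable_eq_0[OF computable_minus, of f g] by simp

lemma decidable_less:
  "computable f \<Longrightarrow> computable g \<Longrightarrow> decidable (\<lambda>n. f n < g n)"
  using decidable_not[OF decidable_le, of g f] by (simp add: not_le)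

lemma decidable_eq:
  "computable f \<Longrightarrow> computable g \<Longrightarrow> decidable (\<lambda>n. f n = g n)"
  using decidable_conj[OF decidable_le decidable_le, of f g g f] by (simp add: eq_iff)

lemma computable_of_bool: "decidable P \<Longrightarrow> computable (\<lambda>n. of_bool (P n))"
  by (simp add: decidable_def)

lemma computable_if:
  assumes "decidable P" "computable f" "computable g"
  shows "computable (\<lambda>n. if P n then f n else g n)"
proof -
  have "(if P n then f n else g n) = of_bool (P n) * f n + of_bool (\<not> P n) * g n" for n by simp
  then show ?thesis
    using assms by (simp only:) (intro computable_add computable_mult computable_of_bool decidable_not)
qed

lemma decidable_all:
  assumes "decidable (\<lambda>m. P (pfst m) (psnd m))" "computable h"
  shows "decidable (\<lambda>n. \<forall>x<h n. P n x)"
proof -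
  have "(\<forall>x<h n. P n x) \<longleftrightarrow> (\<Sum>x<h n. of_bool (\<not> P n x) :: nat) = 0" for n by auto
  then show ?thesis
    using decidable_eq_0[OF computable_sum[OF computable_of_bool[OF decidable_not[OF assms(1)]] assms(2)]]
    by simp
qed

lemma computable_Least:
  assumes "decidable (\<lambda>m. P (pfst m) (psnd m))" "\<And>n. \<exists>k. P n k"
  shows "computable (\<lambda>n. LEAST k. P n k)"
  using computable.mu[OF computable_of_bool[OF decidable_not[OF assms(1)]]] assms(2) by simp

lemma computable_div:
  assumes "computable f" "computable g" shows "computable (\<lambda>n. f n div g n)"
proof -
  have "a div b = (LEAST q. b = 0 \<or> a < Suc q * b)" for a b :: nat
  proof (cases "b = 0")
    case False
    show ?thesis
    proof (rule Least_equality[symmetric])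
      show "b = 0 \<or> a < Suc (a div b) * b"
        using False by (simp add: dividend_less_div_times)
      show "a div b \<le> y" if "b = 0 \<or> a < Suc y * b" for y
        using that False by (metis less_Suc_eq_le less_mult_imp_div_less)
    qed
  qed auto
  moreover have "computable (\<lambda>n. LEAST q. g n = 0 \<or> f n < Suc q * g n)"
  proof (rule computable_Least)
    show "decidable (\<lambda>m. g (pfst m) = 0 \<or> f (pfst m) < Suc (psnd m) * g (pfst m))"
      by (intro decidable_disj decidable_eq decidable_less computable_const computable_mult computable_Suc
          computable_psnd computable_id computable.comp[OF assms(1)] computable.comp[OF assms(2)] computable_pfst)
    show "\<exists>k. g n = 0 \<or> f n < Suc k * g n" for n
      by (cases "g n") (auto intro!: exI[of _ "f n"])
  qed
  ultimately show ?thesis by simp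
qed

lemma computable_mod:
  assumes "computable f" "computable g" shows "computable (\<lambda>n. f n mod g n)"
  using computable_minus[OF assms(1) computable_mult[OF computable_div[OF assms] assms(2)]]
  by (simp add: minus_div_mult_eq_mod)

lemma decidable_dvd:
  "computable f \<Longrightarrow> computable g \<Longrightarrow> decidable (\<lambda>n. f n dvd g n)"
  using decidable_eq_0[OF computable_mod, of g f] by (simp add: dvd_eq_mod_eq_0)

lemma decidable_mem:
  "computable f \<Longrightarrow> computable g \<Longrightarrow> decidable (\<lambda>n. f n \<in> set_decode (g n))"
  using decidable_not[OF decidable_dvd[OF computable_const[of 2] computable_div[OF _ computable_power[OF computable_const[of 2]], of g f]]]
  by (simp add: set_decode_def)

lemma mem_set_decode_less: "x \<in> set_decode c \<Longrightarrow> x < c"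
proof (rule ccontr)
  assume x: "x \<in> set_decode c" and "\<not> x < c"
  then have "c < 2 ^ x" using less_exp[of x] by linarith
  then show False using x by (simp add: set_decode_def)
qed

text \<open>
  Quantifiers over a coded finite set are bounded, because an element is smaller than the code.
\<close>

lemma decidable_all_mem:
  assumes "decidable (\<lambda>m. P (pfst m) (psnd m))" "computable h"
  shows "decidable (\<lambda>n. \<forall>x\<in>set_decode (h n). P n x)"
proof -
  have "(\<forall>x\<in>set_decode (h n). P n x) \<longleftrightarrow> (\<forall>x<h n. x \<in> set_decode (h n) \<longrightarrow> P n x)" for n
    using mem_set_decode_less by blast
  then show ?thesis
    by (simp only:) (intro decidable_all decidable_imp decidable_mem computable_psnd
        computable_id computable.comp[OF assms(2)] computable_pfst assms)
qed

lemma decidable_ex_mem: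
  assumes "decidable (\<lambda>m. P (pfst m) (psnd m))" "computable h"
  shows "decidable (\<lambda>n. \<exists>x\<in>set_decode (h n). P n x)"
  using decidable_not[OF decidable_all_mem[OF decidable_not[OF assms(1)] assms(2)]] by simp

lemmas computable_intros =
  computable_id computable_const computable_pfst computable_psnd computable_Suc computable.pair
  computable_add computable_mult computable_power computable_minus computable_sum computable_div
  computable_mod computable_if computable_of_bool
  decidable_not decidable_conj decidable_disj decidable_imp decidable_le
  decidable_less decidable_eq decidable_dvd decidable_mem decidable_all
  decidable_all_mem decidable_ex_mem

text \<open>
  A number codes the valuation whose values are read off by iterated unpairing. Every finite list
  of values is an initial part of such a valuation, so a code with prescribed entries can be found
  by unbounded search instead of being constructed.
\<close>

definition look :: "nat \<Rightarrow> nat \<Rightarrow> nat" where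
  "look c x = pfst ((psnd ^^ x) c)"

lemma computable_look: "computable f \<Longrightarrow> computable g \<Longrightarrow> computable (\<lambda>n. look (f n) (g n))"
  unfolding look_def
  by (intro computable_pfst computable_funpow[where g = "\<lambda>n. psnd"] computable_psnd computable_id)

lemma ex_look: "\<exists>c. \<forall>x<K. look c x = f x"
proof (induction K arbitrary: f)
  case (Suc K)
  obtain c where c: "\<forall>x<K. look c x = f (Suc x)" using Suc[of "\<lambda>x. f (Suc x)"] by blast
  have "look (prod_encode (f 0, c)) x = f x" if "x < Suc K" for x
  proof (cases x)
    case 0
    then show ?thesis by (simp add: look_def)
  next
    case (Suc y)
    then have "look (prod_encode (f 0, c)) x = look c y"
      by (simp only: look_def funpow_Suc_right o_apply prod_encode_inverse snd_conv)
    then show ?thesis using c that Suc by auto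
  qed
  then show ?case by blast
qed auto

section \<open>Averages over independent variables\<close>

definition agree :: "nat set \<Rightarrow> (nat \<Rightarrow> nat) \<Rightarrow> (nat \<Rightarrow> nat) \<Rightarrow> bool" where
  "agree V u v \<longleftrightarrow> (\<forall>x\<in>V. u x = v x)"

definition depends_on :: "nat set \<Rightarrow> ((nat \<Rightarrow> nat) \<Rightarrow> 'b) \<Rightarrow> bool" where
  "depends_on V f \<longleftrightarrow> (\<forall>u v. agree V u v \<longrightarrow> f u = f v)"

lemma agree_refl: "agree V v v" by (simp add: agree_def)
lemma agree_sym: "agree V u v \<Longrightarrow> agree V v u" by (simp add: agree_def)
lemma agree_trans: "agree V u v \<Longrightarrow> agree V v w \<Longrightarrow> agree V u w" by (simp add: agree_def)
lemma agree_mono: "agree V u v \<Longrightarrow> U \<subseteq> V \<Longrightarrow> agree U u v" by (auto simp: agree_def)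
lemma depends_onD: "depends_on V f \<Longrightarrow> agree V u v \<Longrightarrow> f u = f v" by (simp add: depends_on_def)
lemma depends_on_mono: "depends_on U f \<Longrightarrow> U \<subseteq> V \<Longrightarrow> depends_on V f"
  unfolding depends_on_def agree_def by (simp add: subset_eq)

text \<open>
  \<open>Rp i\<close> is the set of values that variable \<open>i\<close> takes with positive probability and \<open>w i\<close> is its
  distribution. Only finitely many variables matter at a time, so expectations are finite sums.
\<close>

locale product_weights =
  fixes Rp :: "nat \<Rightarrow> nat set" and w :: "nat \<Rightarrow> nat \<Rightarrow> real"
  assumes finite_Rp: "finite (Rp x)"
    and w_nonneg: "0 \<le> w x y"
    and w_sum: "(\<Sum>y\<in>Rp x. w x y) = 1"
begin

definition good :: "(nat \<Rightarrow> nat) \<Rightarrow> bool" where "good v \<longleftrightarrow> (\<forall>x. v x \<in> Rp x)"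

definition avg1 :: "nat \<Rightarrow> ((nat \<Rightarrow> nat) \<Rightarrow> real) \<Rightarrow> (nat \<Rightarrow> nat) \<Rightarrow> real" where
  "avg1 x f v = (\<Sum>y\<in>Rp x. w x y * f (v(x := y)))"

text \<open>
  The expected value of \<open>f\<close> after the coordinates in \<open>S\<close> have been drawn afresh. The fold is
  independent of the order and insensitive to repetition: averaging twice over a coordinate is the
  same as averaging once, which gives \<open>avg_union\<close> for overlapping sets as well.
\<close>

definition avg :: "nat set \<Rightarrow> ((nat \<Rightarrow> nat) \<Rightarrow> real) \<Rightarrow> (nat \<Rightarrow> nat) \<Rightarrow> real" where
  "avg S f = Finite_Set.fold avg1 f S"

lemma avg1_commute: "avg1 x (avg1 y f) = avg1 y (avg1 x f)"
proof (cases "x = y")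
  case False
  show ?thesis
  proof
    fix v
    have "avg1 x (avg1 y f) v = (\<Sum>i\<in>Rp x. \<Sum>j\<in>Rp y. w x i * w y j * f (v(x := i, y := j)))"
      by (simp add: avg1_def sum_distrib_left mult.assoc)
    also have "\<dots> = (\<Sum>j\<in>Rp y. \<Sum>i\<in>Rp x. w y j * w x i * f (v(y := j, x := i)))"
      using False by (subst sum.swap) (simp add: mult.commute fun_upd_twist)
    also have "\<dots> = avg1 y (avg1 x f) v"
      by (simp add: avg1_def sum_distrib_left mult.assoc)
    finally show "avg1 x (avg1 y f) v = avg1 y (avg1 x f) v" .
  qed
qed simp

lemma avg1_idem: "avg1 x (avg1 x f) = avg1 x f"
proof
  fix v
  have "avg1 x (avg1 x f) v = (\<Sum>i\<in>Rp x. w x i * avg1 x f v)"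
    by (simp add: avg1_def)
  also have "\<dots> = avg1 x f v"
    by (simp add: sum_distrib_right[symmetric] w_sum)
  finally show "avg1 x (avg1 x f) v = avg1 x f v" .
qed

lemma comp_fun_idem_avg1: "comp_fun_idem avg1"
  by unfold_locales (auto simp: fun_eq_iff avg1_commute avg1_idem)

lemma avg_empty [simp]: "avg {} f = f" by (simp add: avg_def)

lemma avg_insert: "finite S \<Longrightarrow> avg (insert x S) f = avg1 x (avg S f)"
  using comp_fun_idem_on.fold_insert_idem[OF comp_fun_idem_avg1[unfolded comp_fun_idem_def']]
  by (simp add: avg_def)

lemma avg_union: "finite S \<Longrightarrow> finite T \<Longrightarrow> avg (S \<union> T) f = avg S (avg T f)"
  by (induction S rule: finite_induct) (auto simp: avg_insert)

lemma avg_commute: "finite S \<Longrightarrow> finite T \<Longrightarrow> avg S (avg T f) = avg T (avg S f)"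
  by (metis avg_union Un_commute)

lemma avg_mono:
  assumes "finite S" "good v" "\<And>u. good u \<Longrightarrow> agree (- S) u v \<Longrightarrow> f u \<le> g u"
  shows "avg S f v \<le> avg S g v"
  using assms
proof (induction S arbitrary: v rule: finite_induct)
  case empty
  then show ?case using agree_refl by simp
next
  case (insert x S)
  have "avg S f (v(x := y)) \<le> avg S g (v(x := y))" if "y \<in> Rp x" for y
    by (rule insert.IH) (use insert.prems that in \<open>auto simp: good_def agree_def\<close>)
  then show ?case
    by (auto simp: avg_insert[OF insert.hyps(1)] avg1_def intro!: sum_mono mult_left_mono w_nonneg)
qed

lemma avg_cong:
  assumes "finite S" "\<And>u. agree (- S) u v \<Longrightarrow> f u = g u"
  shows "avg S f v = avg S g v"
  using assms
proof (induction S arbitrary: v rule: finite_induct)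
  case empty
  then show ?case using agree_refl by simp
next
  case (insert x S)
  have "avg S f (v(x := y)) = avg S g (v(x := y))" for y
    by (rule insert.IH) (use insert.prems in \<open>auto simp: agree_def\<close>)
  then show ?case by (simp add: avg_insert[OF insert.hyps(1)] avg1_def)
qed

lemma avg_add: "finite S \<Longrightarrow> avg S (\<lambda>v. f v + g v) v = avg S f v + avg S g v"
proof (induction S arbitrary: v rule: finite_induct)
  case (insert x S)
  then have "avg S (\<lambda>v. f v + g v) = (\<lambda>v. avg S f v + avg S g v)" by blast
  then show ?case
    by (simp add: avg_insert[OF insert.hyps(1)] avg1_def sum.distrib algebra_simps)
qed simp

text \<open>
  A factor that does not look at the fresh coordinates is a constant for the average. This is the
  only form in which independence is used.
\<close>

lemma avg_pull:
  assumes "finite S" "depends_on (- S) g"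
  shows "avg S (\<lambda>v. g v * f v) v = g v * avg S f v"
  using assms
proof (induction S arbitrary: v rule: finite_induct)
  case (insert x S)
  have "depends_on (- S) g" using insert.prems by (rule depends_on_mono) auto
  then have "avg S (\<lambda>v. g v * f v) = (\<lambda>v. g v * avg S f v)" using insert.IH by blast
  moreover have "g (v(x := y)) = g v" for y
    by (rule depends_onD[OF insert.prems]) (simp add: agree_def)
  ultimately show ?case
    by (simp add: avg_insert[OF insert.hyps(1)] avg1_def sum_distrib_left algebra_simps)
qed simp

lemma avg_const: "finite S \<Longrightarrow> avg S (\<lambda>_. c) v = c"
proof (induction S arbitrary: v rule: finite_induct)
  case (insert x S)
  then have "avg S (\<lambda>_. c) = (\<lambda>_. c)" by blast
  then show ?case
    by (simp add: avg_insert[OF insert.hyps(1)] avg1_def sum_distrib_right[symmetric] w_sum)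
qed simp

lemma avg_indep: "finite S \<Longrightarrow> depends_on (- S) g \<Longrightarrow> avg S g v = g v"
  using avg_pull[of S g "\<lambda>_. 1" v] avg_const[of S 1 v] by simp

lemma avg_cmult: "finite S \<Longrightarrow> avg S (\<lambda>v. c * f v) v = c * avg S f v"
  by (rule avg_pull) (auto simp: depends_on_def)

lemma depends_on_avg:
  "finite S \<Longrightarrow> depends_on V f \<Longrightarrow> depends_on (V - S) (avg S f)"
proof (induction S rule: finite_induct)
  case (insert x S)
  then have "depends_on (V - S) (avg S f)" by blast
  then have "avg S f (u(x := y)) = avg S f (v(x := y))" if "agree (V - insert x S) u v" for u v y
    by (rule depends_onD) (use that in \<open>auto simp: agree_def\<close>)
  then show ?case
    by (simp add: avg_insert[OF insert.hyps(1)] depends_on_def avg1_def)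
qed simp

lemma depends_on_avg': "finite S \<Longrightarrow> depends_on (- S) (avg S f)"
  using depends_on_avg[of S UNIV f] by (simp add: depends_on_def agree_def Compl_eq_Diff_UNIV fun_eq_iff[symmetric])

lemma avg_nonneg: "finite S \<Longrightarrow> good v \<Longrightarrow> (\<And>u. good u \<Longrightarrow> 0 \<le> f u) \<Longrightarrow> 0 \<le> avg S f v"
  using avg_mono[of S v "\<lambda>_. 0" f] by (simp add: avg_const)

lemma ex_good: "\<exists>v. good v"
proof -
  have "Rp x \<noteq> {}" for x using w_sum[of x] by force
  then show ?thesis unfolding good_def by (intro exI[of _ "\<lambda>x. SOME y. y \<in> Rp x"]) (simp add: some_in_eq)
qed

end

section \<open>Past cones in the log of a resampling process\<close>

text \<open>
  The order is a parameter of its own, because the computability argument may have to replace the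
  given order by another one with the same compatibility properties.
\<close>

locale left_order =
  fixes vbl rsp :: "nat \<Rightarrow> nat set" and lt :: "nat \<Rightarrow> nat \<Rightarrow> bool"
  assumes finite_vbl: "finite (vbl a)"
    and rsp_vbl: "rsp a \<subseteq> vbl a"
    and lt_irrefl: "\<not> lt a a"
    and lt_trans: "lt a b \<Longrightarrow> lt b c \<Longrightarrow> lt a c"
    and lt_total: "a \<noteq> b \<Longrightarrow> lt a b \<or> lt b a"
    and lt_Gam: "a \<in> Gam_plus rsp b \<Longrightarrow> a \<notin> Gam_plus rsp c \<Longrightarrow> lt b c \<Longrightarrow> lt a c"
    and lt_vbl: "much_less rsp lt b a \<Longrightarrow> rsp a \<inter> vbl b = {}"
    and finite_Gam: "finite (Gam_plus rsp a)"
begin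

abbreviation nb :: "nat \<Rightarrow> nat set" where "nb \<equiv> Gam_plus rsp"

lemma nb_sym: "a \<in> nb b \<longleftrightarrow> b \<in> nb a"
  by (auto simp: Gam_plus_def Gam_def)

lemma nb_self: "a \<in> nb a"
  by (simp add: Gam_plus_def)

lemma lt_asym: "lt a b \<Longrightarrow> \<not> lt b a"
  using lt_irrefl lt_trans by blast

lemma finite_rsp: "finite (rsp a)"
  using finite_subset[OF rsp_vbl finite_vbl] .

lemma vbl_rsp_disjoint: "lt b a \<Longrightarrow> b \<notin> nb a \<Longrightarrow> rsp a \<inter> vbl b = {}"
  by (rule lt_vbl) (simp add: much_less_def Gam_plus_def)

text \<open>
  An event in this relation to \<open>U\<close> can be resampled without looking at any resample variable of an
  event in \<open>U\<close> (\<open>vbl_rsp_disjoint\<close>), and without changing one.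
\<close>

definition skips :: "nat \<Rightarrow> nat set \<Rightarrow> bool" where
  "skips a U \<longleftrightarrow> (\<forall>u\<in>U. a \<notin> nb u \<and> lt a u)"

text \<open>
  The skippable events form an initial segment. Hence the question whether the least true event is
  skippable is answered without looking at the resample variables of \<open>U\<close>.
\<close>

lemma skips_downward: "skips a U \<Longrightarrow> lt b a \<Longrightarrow> skips b U"
  unfolding skips_def
proof (intro ballI)
  fix u assume "\<forall>u\<in>U. a \<notin> nb u \<and> lt a u" and "lt b a" and "u \<in> U"
  then have "lt a u" "u \<notin> nb a" using nb_sym by auto
  then show "b \<notin> nb u \<and> lt b u"
    using lt_Gam[of u b a] lt_asym[of a u] lt_trans[of b a u] nb_sym[of b u] \<open>lt b a\<close> by blast
qed

text \<open>
  The log \<open>l\<close> (first event first) runs through the pattern \<open>us\<close>, and all other events before the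
  pattern is complete are skippable with respect to what is left of it. Matching is deterministic,
  since an event of the rest is never skippable.
\<close>

fun follows :: "nat list \<Rightarrow> nat list \<Rightarrow> bool" where
  "follows [] l \<longleftrightarrow> True"
| "follows (u # us) [] \<longleftrightarrow> False"
| "follows (u # us) (a # l) \<longleftrightarrow>
     (if a = u then follows us l else skips a (set (u # us)) \<and> follows (u # us) l)"

text \<open>
  The past cone of a resampling step: reading the log backwards, collect each event that is a
  neighbour of an event collected already. Here, and in \<open>past_cone\<close> and \<open>valid_word\<close>, lists
  start with the latest event.
\<close>

fun cone_from :: "nat set \<Rightarrow> nat list \<Rightarrow> nat list" where
  "cone_from U [] = []"
| "cone_from U (d # s) =
     (if \<exists>u\<in>U. d \<in> nb u then d # cone_from (insert d U) s else cone_from U s)"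

fun past_cone :: "nat list \<Rightarrow> nat list" where
  "past_cone [] = []"
| "past_cone (b # s) = b # cone_from {b} s"

text \<open>
  The constraint that the order puts on past cones. The set \<open>A\<close> holds the events that may come next.
  After the choice of \<open>d\<close> these are the neighbours of \<open>d\<close> and the earlier candidates below \<open>d\<close>;
  a candidate above \<open>d\<close> is discarded, so that two unrelated events can occur in one order only.
  This is what makes the weights of all words sum to a simple product in \<open>words_sum\<close>.
\<close>

fun valid_word :: "nat set \<Rightarrow> nat list \<Rightarrow> bool" where
  "valid_word A [] \<longleftrightarrow> True"
| "valid_word A (d # u) \<longleftrightarrow> d \<in> A \<and> valid_word (nb d \<union> {e \<in> A. lt e d}) u"

text \<open>
  The only property of logs that the combinatorics uses: consecutive events are neighbours or
  increase. The list is read from the latest event to the first.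
\<close>

abbreviation log_rev :: "nat list \<Rightarrow> bool" where
  "log_rev \<equiv> successively (\<lambda>a d. a \<in> nb d \<or> lt d a)"

text \<open>
  An event without a neighbour in \<open>U\<close> is below all of \<open>U\<close> as soon as it is below one element.
  Sets that are connected under the neighbour relation have this property.
\<close>

definition linked :: "nat set \<Rightarrow> bool" where
  "linked U \<longleftrightarrow> (\<forall>d. (\<forall>u\<in>U. d \<notin> nb u) \<longrightarrow> (\<exists>u\<in>U. lt d u) \<longrightarrow> (\<forall>u\<in>U. lt d u))"

lemma linked_insert:
  assumes "linked U" "u0 \<in> U" "d \<in> nb u0"
  shows "linked (insert d U)"
  unfolding linked_def
proof (intro allI impI)
  fix e assume e: "\<forall>u\<in>insert d U. e \<notin> nb u" "\<exists>u\<in>insert d U. lt e u"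
  have iff: "lt e d \<longleftrightarrow> lt e u0"
  proof
    assume "lt e d"
    moreover have "e \<noteq> u0" "d \<notin> nb e" using e(1) assms(2) nb_self nb_sym by auto
    ultimately show "lt e u0"
      using lt_Gam[OF assms(3), of e] lt_asym[of e d] lt_total[of e u0] by blast
  next
    assume "lt e u0"
    moreover have "e \<noteq> d" "u0 \<notin> nb e" "u0 \<in> nb d"
      using e(1) assms(2,3) nb_self nb_sym by auto
    ultimately show "lt e d"
      using lt_Gam[of u0 d e] lt_asym[of e u0] lt_total[of e d] by blast
  qed
  then have "\<exists>u\<in>U. lt e u" using e(2) assms(2) by blast
  then have "\<forall>u\<in>U. lt e u" using assms(1) e(1) unfolding linked_def by blast
  then show "\<forall>u\<in>insert d U. lt e u" using iff assms(2) by blast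
qed

text \<open>
  The step that carries a backward reading of the log over an event \<open>d\<close> outside the cone. The event
  \<open>a\<close> that comes right after \<open>d\<close> is in the cone or was skipped before. In the first case \<open>a\<close>
  is no neighbour of \<open>d\<close>, so \<open>d\<close> is below \<open>a\<close> and, by linkedness, below all of \<open>U\<close>. In the
  second case \<open>a\<close> is below all of \<open>U\<close>, and the compatibility of order and neighbourhood passes
  this on to the neighbour \<open>d\<close>.
\<close>

lemma skipped_before:
  assumes "linked U" "a \<in> U \<or> skips a U" "a \<in> nb d \<or> lt d a" "\<forall>u\<in>U. d \<notin> nb u"
  shows "skips d U"
proof (cases "a \<in> U")
  case True
  then have "lt d a" using assms nb_sym by blast
  then show ?thesis using assms True unfolding linked_def skips_def by blast
next
  case False
  then have a: "\<forall>u\<in>U. a \<notin> nb u \<and> lt a u" using assms(2) unfolding skips_def by blast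
  show ?thesis
    unfolding skips_def
  proof
    fix u assume u: "u \<in> U"
    then have "lt d u" using a assms(3,4) lt_Gam[of d a u] lt_trans[of d a u] nb_sym[of a d] by blast
    then show "d \<notin> nb u \<and> lt d u" using assms(4) u by blast
  qed
qed

lemma cone_from_covers:
  assumes "linked U" "a \<in> U \<or> skips a U" "log_rev (a # s)" "d \<in> set s"
  shows "d \<in> set (cone_from U s) \<or> (\<forall>u\<in>U. lt d u)"
  using assms
proof (induction s arbitrary: U a)
  case (Cons e s)
  have ch: "a \<in> nb e \<or> lt e a" "log_rev (e # s)"
    using Cons.prems(3) by auto
  show ?case
  proof (cases "\<exists>u\<in>U. e \<in> nb u")
    case True
    then have "linked (insert e U)" using linked_insert Cons.prems(1) by blast
    then show ?thesis using Cons.IH[of "insert e U" e] ch True Cons.prems(4) by auto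
  next
    case False
    then have "skips e U" using skipped_before Cons.prems ch by blast
    then show ?thesis
      using Cons.IH[of U e] ch False Cons.prems(1,4) by (auto simp: skips_def)
  qed
qed simp

lemma follows_cone_from:
  assumes "linked (set us)" "us \<noteq> []" "a \<in> set us \<or> skips a (set us)" "log_rev (a # s)"
    "follows us l"
  shows "follows (rev (cone_from (set us) s) @ us) (rev s @ l)"
  using assms
proof (induction s arbitrary: us a l)
  case (Cons e s)
  have ch: "a \<in> nb e \<or> lt e a" "log_rev (e # s)"
    using Cons.prems(4) by auto
  show ?case
  proof (cases "\<exists>u\<in>set us. e \<in> nb u")
    case True
    then have "linked (set (e # us))" using linked_insert Cons.prems(1) by auto
    then show ?thesis
      using Cons.IH[of "e # us" e "e # l"] ch True Cons.prems by auto
  next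
    case False
    then have "skips e (set us)" using skipped_before Cons.prems ch by blast
    moreover obtain u us' where us: "us = u # us'" using Cons.prems(2) by (cases us) auto
    moreover have "e \<noteq> u" using False nb_self us by auto
    ultimately have "follows us (e # l)" using Cons.prems(5) by simp
    then show ?thesis
      using Cons.IH[of us e "e # l"] \<open>skips e (set us)\<close> ch False Cons.prems(1,2) by auto
  qed
qed simp

lemma follows_cone:
  assumes "log_rev (b # s)" shows "follows (rev (past_cone (b # s))) (rev (b # s))"
proof -
  have "linked (set [b])" by (simp add: linked_def)
  then show ?thesis using follows_cone_from[of "[b]" b s "[b]"] assms by simp
qed

text \<open>
  Here \<open>c\<close> is the event collected last and \<open>a\<close> the event read last. The hypothesis on \<open>A\<close> says
  that every neighbour of the cone which could come next is still a candidate; it survives each step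
  because an event below \<open>e\<close> that is no neighbour of \<open>e\<close> was available before \<open>e\<close> as well.
\<close>

lemma valid_cone_from:
  assumes "c \<in> U" "a = c \<or> skips a U" "log_rev (a # s)" "linked U"
    "\<And>e u. u \<in> U \<Longrightarrow> e \<in> nb u \<Longrightarrow> e \<in> nb c \<or> lt e c \<Longrightarrow> e \<in> A"
  shows "valid_word A (cone_from U s)"
  using assms
proof (induction s arbitrary: U a c A)
  case (Cons e s)
  have ch: "a \<in> nb e \<or> lt e a" "log_rev (e # s)"
    using Cons.prems(3) by auto
  show ?case
  proof (cases "\<exists>u\<in>U. e \<in> nb u")
    case True
    have ec: "e \<in> nb c \<or> lt e c"
    proof (cases "a = c")
      case True
      then show ?thesis using ch nb_sym by blast
    next
      case False
      then have "a \<notin> nb c" "lt a c" using Cons.prems(1,2) unfolding skips_def by auto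
      then show ?thesis using ch lt_Gam[of e a c] lt_trans[of e a c] nb_sym by blast
    qed
    have "valid_word (nb e \<union> {d \<in> A. lt d e}) (cone_from (insert e U) s)"
    proof (rule Cons.IH[of e _ e])
      show "linked (insert e U)" using linked_insert Cons.prems(4) True by blast
      fix d u assume d: "u \<in> insert e U" "d \<in> nb u" "d \<in> nb e \<or> lt d e"
      show "d \<in> nb e \<union> {d \<in> A. lt d e}"
      proof (cases "d \<in> nb e")
        case False
        then have u: "u \<in> U" and de: "lt d e" using d by auto
        have "d \<in> nb c \<or> lt d c"
        proof (rule ccontr)
          assume n: "\<not> ?thesis"
          then have "lt c d" using lt_total[of c d] nb_self[of c] by auto
          moreover have "e \<in> nb c" using ec n lt_trans[OF de, of c] by blast
          ultimately have "lt e d" using lt_Gam[of e c d] False nb_sym[of e d] by blast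
          then show False using lt_asym[OF de] by blast
        qed
        then show ?thesis using Cons.prems(5) u d(2) de by blast
      qed simp
    qed (use ch in auto)
    then show ?thesis using True Cons.prems(5) ec by auto
  next
    case False
    then have "skips e U" using skipped_before Cons.prems ch by blast
    then show ?thesis
      using Cons.IH[of c U e A] Cons.prems ch False by auto
  qed
qed simp

lemma valid_cone: "log_rev (b # s) \<Longrightarrow> valid_word {b} (past_cone (b # s))"
  by (auto intro!: valid_cone_from[of b _ b] simp: linked_def)

lemma count_cone_from: "b \<in> U \<Longrightarrow> count_list (cone_from U s) b = count_list s b"
  using nb_self by (induction s arbitrary: U) auto

lemma count_cone: "count_list (past_cone (b # s)) b = count_list (b # s) b"
  by (simp add: count_cone_from)

lemma length_cone_from: "length (cone_from U s) \<le> length s"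
  by (induction s arbitrary: U) (auto simp: le_SucI)

lemma length_cone: "length (past_cone s) \<le> length s"
  by (cases s) (auto simp: length_cone_from)

text \<open>
  Each event of a cone is a neighbour of a later one, so a cone that leads far away from its tip
  (measured by the sets \<open>H\<close>) is long.
\<close>

lemma cone_from_reach:
  assumes "\<And>i. (\<Union>a\<in>H i. nb a) \<subseteq> H (Suc i)" "U \<subseteq> H j" "\<And>i. H i \<subseteq> H (Suc i)"
  shows "set (cone_from U s) \<subseteq> H (j + length (cone_from U s))"
  using assms(2)
proof (induction s arbitrary: U j)
  case (Cons d s)
  show ?case
  proof (cases "\<exists>u\<in>U. d \<in> nb u")
    case True
    then have "d \<in> H (Suc j)" using assms(1)[of j] Cons.prems by blast
    moreover have "H (Suc j) \<subseteq> H (Suc j + k)" for k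
      by (rule lift_Suc_mono_le[where f = H]) (use assms(3) in auto)
    moreover have "insert d U \<subseteq> H (Suc j)" using \<open>d \<in> H (Suc j)\<close> Cons.prems assms(3)[of j] by blast
    ultimately show ?thesis using Cons.IH[of "insert d U" "Suc j"] True by auto
  next
    case False
    then show ?thesis using Cons by auto
  qed
qed simp

lemma ex_lt_max: "finite A \<Longrightarrow> A \<noteq> {} \<Longrightarrow> \<exists>m\<in>A. \<forall>e\<in>A. \<not> lt m e"
proof (induction A rule: finite_ne_induct)
  case (insert x A)
  then obtain m where "m \<in> A" "\<forall>e\<in>A. \<not> lt m e" by blast
  then show ?case
    using lt_irrefl lt_trans by (cases "lt m x") blast+
qed (simp add: lt_irrefl)

lemma ex_lt_min: "finite A \<Longrightarrow> A \<noteq> {} \<Longrightarrow> \<exists>m\<in>A. \<forall>e\<in>A. \<not> lt e m"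
proof (induction A rule: finite_ne_induct)
  case (insert x A)
  then obtain m where "m \<in> A" "\<forall>e\<in>A. \<not> lt e m" by blast
  then show ?case
    using lt_irrefl lt_trans by (cases "lt x m") blast+
qed (simp add: lt_irrefl)

text \<open>
  Expand the product and sort the terms by their largest factor.
\<close>

lemma telescope:
  fixes x :: "nat \<Rightarrow> real"
  assumes "finite A"
  shows "1 + (\<Sum>d\<in>A. x d * (\<Prod>e\<in>{e\<in>A. lt e d}. 1 + x e)) = (\<Prod>e\<in>A. 1 + x e)"
  using assms
proof (induction "card A" arbitrary: A)
  case (Suc n)
  then obtain m where m: "m \<in> A" "\<forall>e\<in>A. \<not> lt m e" using ex_lt_max[of A] by (metis card.empty nat.distinct(1))
  define B where "B = A - {m}"
  have A: "A = insert m B" "m \<notin> B" "finite B" using m(1) Suc.prems by (auto simp: B_def)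
  have "lt e m" if "e \<in> B" for e using A m that lt_total[of e m] by auto
  then have "{e\<in>A. lt e m} = B" using A lt_irrefl by auto
  moreover have "{e\<in>A. lt e d} = {e\<in>B. lt e d}" if "d \<in> B" for d using A m that by auto
  moreover have "1 + (\<Sum>d\<in>B. x d * (\<Prod>e\<in>{e\<in>B. lt e d}. 1 + x e)) = (\<Prod>e\<in>B. 1 + x e)"
    using Suc.hyps(1)[of B] Suc.hyps(2) A by simp
  moreover have "(\<Sum>d\<in>A. x d * (\<Prod>e\<in>{e\<in>A. lt e d}. 1 + x e)) =
      x m * (\<Prod>e\<in>{e\<in>A. lt e m}. 1 + x e) + (\<Sum>d\<in>B. x d * (\<Prod>e\<in>{e\<in>A. lt e d}. 1 + x e))"
    by (subst A(1), rule sum.insert) (use A in auto)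
  moreover have "(\<Prod>e\<in>A. 1 + x e) = (1 + x m) * (\<Prod>e\<in>B. 1 + x e)"
    using A by simp
  ultimately show ?case by (simp add: algebra_simps cong: sum.cong)
qed simp

text \<open>
  By induction on the length. The words that start with \<open>d\<close> contribute at most \<open>P d\<close> times the
  product over the candidates after \<open>d\<close>; the part over the neighbours of \<open>d\<close> is absorbed by the
  local lemma condition on \<open>P\<close>, and what remains is a term of \<open>telescope\<close>.
\<close>

lemma words_sum:
  fixes P x :: "nat \<Rightarrow> real"
  assumes x: "\<And>a. 0 \<le> x a" and P: "\<And>a. 0 \<le> P a" "\<And>a. P a * (\<Prod>b\<in>nb a. 1 + x b) \<le> x a"
    and "finite A"
  shows "finite {u. length u \<le> n \<and> valid_word A u} \<and>
    (\<Sum>u | length u \<le> n \<and> valid_word A u. prod_list (map P u)) \<le> (\<Prod>a\<in>A. 1 + x a)"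
  using assms(4)
proof (induction n arbitrary: A)
  case 0
  have "{u. length u \<le> 0 \<and> valid_word A u} = {[]}" by auto
  moreover have "1 \<le> (\<Prod>a\<in>A. 1 + x a)" using x by (intro prod_ge_1) auto
  ultimately show ?case by simp
next
  case (Suc n)
  define A' where "A' d = nb d \<union> {e \<in> A. lt e d}" for d
  define W where "W d = {u. length u \<le> n \<and> valid_word (A' d) u}" for d
  have fA': "finite (A' d)" for d using Suc.prems finite_Gam by (auto simp: A'_def)
  have fW: "finite (W d)" for d using Suc.IH[OF fA'[of d]] by (simp add: W_def)
  have eq: "{u. length u \<le> Suc n \<and> valid_word A u} = insert [] (\<Union>d\<in>A. (#) d ` W d)"
  proof (intro equalityI subsetI)
    fix u assume "u \<in> {u. length u \<le> Suc n \<and> valid_word A u}"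
    then show "u \<in> insert [] (\<Union>d\<in>A. (#) d ` W d)" by (cases u) (auto simp: W_def A'_def)
  qed (auto simp: W_def A'_def)
  have "(\<Sum>u\<in>(\<Union>d\<in>A. (#) d ` W d). prod_list (map P u)) =
      (\<Sum>d\<in>A. \<Sum>u\<in>(#) d ` W d. prod_list (map P u))"
    by (rule sum.UNION_disjoint) (use Suc.prems fW in auto)
  also have "\<dots> = (\<Sum>d\<in>A. P d * (\<Sum>u\<in>W d. prod_list (map P u)))"
    by (simp add: sum.reindex sum_distrib_left)
  also have "\<dots> \<le> (\<Sum>d\<in>A. x d * (\<Prod>e\<in>{e\<in>A. lt e d}. 1 + x e))"
  proof (rule sum_mono)
    fix d assume "d \<in> A"
    have "(\<Sum>u\<in>W d. prod_list (map P u)) \<le> (\<Prod>a\<in>A' d. 1 + x a)"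
      using Suc.IH[OF fA'[of d]] by (simp add: W_def)
    also have "\<dots> = (\<Prod>a\<in>nb d. 1 + x a) * (\<Prod>a\<in>{e\<in>A. lt e d} - nb d. 1 + x a)"
      unfolding A'_def using finite_Gam Suc.prems
      by (subst Un_Diff_cancel[symmetric], intro prod.union_disjoint) auto
    also have "\<dots> \<le> (\<Prod>a\<in>nb d. 1 + x a) * (\<Prod>a\<in>{e\<in>A. lt e d}. 1 + x a)"
      by (intro mult_left_mono prod_mono2 prod_nonneg) (use Suc.prems x in \<open>auto intro: add_nonneg_nonneg\<close>)
    finally have "P d * (\<Sum>u\<in>W d. prod_list (map P u)) \<le>
        P d * (\<Prod>a\<in>nb d. 1 + x a) * (\<Prod>a\<in>{e\<in>A. lt e d}. 1 + x a)"
      using mult_left_mono[OF _ P(1)] by (simp add: mult.assoc)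
    also have "\<dots> \<le> x d * (\<Prod>a\<in>{e\<in>A. lt e d}. 1 + x a)"
      by (intro mult_right_mono P prod_nonneg) (use x in \<open>auto intro: add_nonneg_nonneg\<close>)
    finally show "P d * (\<Sum>u\<in>W d. prod_list (map P u)) \<le> x d * (\<Prod>e\<in>{e\<in>A. lt e d}. 1 + x e)" .
  qed
  finally have "1 + (\<Sum>u\<in>(\<Union>d\<in>A. (#) d ` W d). prod_list (map P u)) \<le> (\<Prod>a\<in>A. 1 + x a)"
    using telescope[OF Suc.prems, of x] by linarith
  moreover have "finite (\<Union>d\<in>A. (#) d ` W d)" using Suc.prems fW by auto
  moreover have "[] \<notin> (\<Union>d\<in>A. (#) d ` W d)" by auto
  ultimately show ?case unfolding eq by (subst sum.insert) auto
qed

end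

section \<open>The resampling process\<close>

lemma successively_rev_iff: "successively (\<lambda>x y. Q y x) (rev l) \<longleftrightarrow> successively Q l"
  by (simp add: successively_rev)

text \<open>
  The local lemma condition, with the substitution \<open>x = z / (1 - z)\<close>, so that \<open>1 + x = 1 / (1 - z)\<close>.
  The factor \<open>al\<close> gives exponential decay in the length of cones, and \<open>xmax\<close> makes the estimates
  uniform in the event.
\<close>

locale resampling = product_weights Rp w + left_order vbl rsp lt
  for Rp :: "nat \<Rightarrow> nat set" and w :: "nat \<Rightarrow> nat \<Rightarrow> real"
    and vbl rsp :: "nat \<Rightarrow> nat set" and lt :: "nat \<Rightarrow> nat \<Rightarrow> bool" +
  fixes bad :: "nat \<Rightarrow> (nat \<Rightarrow> nat) \<Rightarrow> bool" and P x :: "nat \<Rightarrow> real" and al xmax :: real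
  assumes bad_vbl: "depends_on (vbl a) (bad a)"
    and P_nonneg: "0 \<le> P a"
    and P_bound: "good v \<Longrightarrow> avg (rsp a) (\<lambda>u. of_bool (bad a u)) v \<le> P a"
    and x_nonneg: "0 \<le> x a" and x_le: "x a \<le> xmax"
    and al: "0 < al" "al < 1"
    and P_x: "P a * (\<Prod>b\<in>Gam_plus rsp a. 1 + x b) \<le> al * x a"
begin

definition pick :: "nat set \<Rightarrow> (nat \<Rightarrow> nat) \<Rightarrow> nat option" where
  "pick F v = (if \<exists>a\<in>F. bad a v
     then Some (THE a. a \<in> F \<and> bad a v \<and> (\<forall>b\<in>F. lt b a \<longrightarrow> \<not> bad b v)) else None)"

lemma pick_None: "pick F v = None \<longleftrightarrow> (\<forall>a\<in>F. \<not> bad a v)"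
  by (simp add: pick_def)

lemma pick_Some:
  assumes "finite F"
  shows "pick F v = Some a \<longleftrightarrow> a \<in> F \<and> bad a v \<and> (\<forall>b\<in>F. lt b a \<longrightarrow> \<not> bad b v)"
proof -
  have uniq: "a = b" if "a \<in> F \<and> bad a v \<and> (\<forall>b\<in>F. lt b a \<longrightarrow> \<not> bad b v)"
    "b \<in> F \<and> bad b v \<and> (\<forall>a\<in>F. lt a b \<longrightarrow> \<not> bad a v)" for a b
    using that lt_total[of a b] by blast
  show ?thesis
  proof (cases "\<exists>a\<in>F. bad a v")
    case True
    then obtain m where m: "m \<in> F" "bad m v" "\<forall>b\<in>F. bad b v \<longrightarrow> \<not> lt b m"
      using ex_lt_min[of "{a\<in>F. bad a v}"] assms by auto
    then have "(THE a. a \<in> F \<and> bad a v \<and> (\<forall>b\<in>F. lt b a \<longrightarrow> \<not> bad b v)) = m"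
      using uniq by (intro the_equality) blast+
    then show ?thesis using True m uniq unfolding pick_def by auto
  qed (auto simp: pick_def)
qed

text \<open>
  The expected value of \<open>\<phi>\<close>, applied to the log and the final valuation, after at most \<open>n\<close>
  resampling steps from \<open>v\<close>. Each step resamples the least true event of \<open>F\<close>; the process stops
  when there is none, so a log shorter than \<open>n\<close> belongs to a finished run.
\<close>

primrec expect :: "nat set \<Rightarrow> nat \<Rightarrow> (nat list \<Rightarrow> (nat \<Rightarrow> nat) \<Rightarrow> real) \<Rightarrow> (nat \<Rightarrow> nat) \<Rightarrow> real" where
  "expect F 0 \<phi> v = \<phi> [] v"
| "expect F (Suc n) \<phi> v = (case pick F v of None \<Rightarrow> \<phi> [] v
     | Some a \<Rightarrow> avg (rsp a) (expect F n (\<lambda>l. \<phi> (a # l))) v)"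

text \<open>
  The possible runs, without their probabilities. They serve to prove \<open>\<phi> l v \<le> \<psi> l v\<close> from
  properties of actual logs (\<open>expect_mono\<close>).
\<close>

inductive resamples :: "nat set \<Rightarrow> (nat \<Rightarrow> nat) \<Rightarrow> nat list \<Rightarrow> (nat \<Rightarrow> nat) \<Rightarrow> bool" for F where
  resamples_Nil: "resamples F v [] v"
| resamples_Cons: "pick F v = Some a \<Longrightarrow> good u \<Longrightarrow> agree (- rsp a) u v \<Longrightarrow> resamples F u l v' \<Longrightarrow> resamples F v (a # l) v'"

lemma resamples_set: "finite F \<Longrightarrow> resamples F v l v' \<Longrightarrow> set l \<subseteq> F"
  by (rotate_tac, induction rule: resamples.induct) (auto simp: pick_Some)

lemma resamples_append: "resamples F v l u \<Longrightarrow> resamples F u l' v' \<Longrightarrow> resamples F v (l @ l') v'"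
  by (induction rule: resamples.induct) (auto intro: resamples_Cons)

lemma resamples_unchanged:
  assumes "resamples F v l v'" "\<forall>a\<in>set l. rsp a \<inter> V = {}" shows "agree V v v'"
  using assms
proof (induction rule: resamples.induct)
  case (resamples_Cons v a u l v')
  then have "V \<subseteq> - rsp a" by auto
  then have "agree V v u" using agree_sym[OF agree_mono] resamples_Cons(3) by blast
  then show ?case using agree_trans[of V v u v'] resamples_Cons by auto
qed (simp add: agree_refl)

text \<open>
  If the next event is below \<open>a\<close>, it was false when \<open>a\<close> was chosen as the least true event. So the
  resampling of \<open>a\<close> made it true, and this is possible only for a neighbour.
\<close>

lemma pick_next:
  assumes "finite F" "pick F v = Some a" "agree (- rsp a) u v" "pick F u = Some b"
  shows "b \<in> nb a \<or> lt a b"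
proof (rule ccontr)
  assume n: "\<not> ?thesis"
  then have ba: "lt b a" "b \<notin> nb a" using lt_total[of a b] nb_self[of a] by auto
  then have "\<not> bad b v" "bad b u" using assms by (auto simp: pick_Some)
  moreover have "agree (vbl b) u v" using assms(3) vbl_rsp_disjoint[OF ba] by (auto simp: agree_def)
  ultimately show False using depends_onD[OF bad_vbl, of b u v] by simp
qed

lemma resamples_log: "resamples F v l v' \<Longrightarrow> finite F \<Longrightarrow> successively (\<lambda>a b. b \<in> nb a \<or> lt a b) l"
proof (induction rule: resamples.induct)
  case (resamples_Cons v a u l v')
  show ?case
  proof (cases l)
    case (Cons b l')
    then have "pick F u = Some b" using resamples_Cons(4) by (auto elim: resamples.cases)
    then show ?thesis using pick_next[of F v a u b] resamples_Cons Cons by auto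
  qed auto
qed auto

lemma resamples_log_rev: "resamples F v l v' \<Longrightarrow> finite F \<Longrightarrow> log_rev (rev l)"
  using resamples_log successively_rev_iff[of "\<lambda>a b. b \<in> nb a \<or> lt a b" l] by simp

lemma expect_mono:
  assumes "good v"
    and "\<And>l v'. resamples F v l v' \<Longrightarrow> good v' \<Longrightarrow> length l \<le> n \<Longrightarrow>
      (length l < n \<Longrightarrow> pick F v' = None) \<Longrightarrow> \<phi> l v' \<le> \<psi> l v'"
  shows "expect F n \<phi> v \<le> expect F n \<psi> v"
  using assms
proof (induction n arbitrary: \<phi> \<psi> v)
  case 0
  then show ?case using resamples_Nil[of F v] by simp
next
  case (Suc n)
  show ?case
  proof (cases "pick F v")
    case None
    then show ?thesis using Suc.prems resamples_Nil[of F v] by simp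
  next
    case (Some a)
    have "expect F n (\<lambda>l. \<phi> (a # l)) u \<le> expect F n (\<lambda>l. \<psi> (a # l)) u"
      if "good u" "agree (- rsp a) u v" for u
      by (rule Suc.IH[OF that(1)], rule Suc.prems(2)) (use resamples_Cons[OF Some that] in auto)
    then show ?thesis using Some avg_mono[OF finite_rsp Suc.prems(1)] by simp
  qed
qed

lemma expect_mono': "good v \<Longrightarrow> (\<And>l v'. \<phi> l v' \<le> \<psi> l v') \<Longrightarrow> expect F n \<phi> v \<le> expect F n \<psi> v"
  by (rule expect_mono)

lemma expect_const: "expect F n (\<lambda>_ _. k) v = k"
proof (induction n arbitrary: v)
  case (Suc n)
  then have "expect F n (\<lambda>_ _. k) = (\<lambda>_. k)" by blast
  then show ?case by (auto split: option.split simp: avg_const finite_rsp)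
qed simp

lemma expect_add: "expect F n (\<lambda>l v. \<phi> l v + \<psi> l v) v = expect F n \<phi> v + expect F n \<psi> v"
proof (induction n arbitrary: v \<phi> \<psi>)
  case (Suc n)
  have "expect F n (\<lambda>l v. \<phi> (a # l) v + \<psi> (a # l) v) =
      (\<lambda>v. expect F n (\<lambda>l. \<phi> (a # l)) v + expect F n (\<lambda>l. \<psi> (a # l)) v)" for a
    using Suc.IH[of "\<lambda>l. \<phi> (a # l)" "\<lambda>l. \<psi> (a # l)"] by blast
  then show ?case by (auto split: option.split simp: avg_add finite_rsp)
qed simp

lemma expect_sum:
  "finite I \<Longrightarrow> expect F n (\<lambda>l v. \<Sum>i\<in>I. \<phi> i l v) v = (\<Sum>i\<in>I. expect F n (\<phi> i) v)"
  by (induction I rule: finite_induct) (simp_all add: expect_const expect_add)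

lemma avg_sum: "finite S \<Longrightarrow> finite I \<Longrightarrow> avg S (\<lambda>v. \<Sum>i\<in>I. f i v) v = (\<Sum>i\<in>I. avg S (f i) v)"
  by (rotate_tac, induction I rule: finite_induct) (simp_all add: avg_const avg_add)

lemma expect_cmult: "expect F n (\<lambda>l v. k * \<phi> l v) v = k * expect F n \<phi> v"
proof (induction n arbitrary: v \<phi>)
  case (Suc n)
  have "expect F n (\<lambda>l v. k * \<phi> (a # l) v) = (\<lambda>v. k * expect F n (\<lambda>l. \<phi> (a # l)) v)" for a
    using Suc.IH[of "\<lambda>l. \<phi> (a # l)"] by blast
  then show ?case by (auto split: option.split simp: avg_cmult finite_rsp)
qed simp

text \<open>
  As long as an event of the initial segment \<open>H\<close> is true, the processes for \<open>H\<close> and for \<open>F\<close> do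
  the same. Hence the \<open>F\<close>-process is the \<open>H\<close>-process, continued from its final valuation.
\<close>

lemma expect_append:
  assumes "finite F" "H \<subseteq> F" "\<And>a b. b \<in> H \<Longrightarrow> a \<in> F \<Longrightarrow> lt a b \<Longrightarrow> a \<in> H" "n \<le> m"
  shows "expect F m \<phi> v = expect H n (\<lambda>l. expect F (m - length l) (\<lambda>l'. \<phi> (l @ l'))) v"
  using assms(4)
proof (induction n arbitrary: m \<phi> v)
  case (Suc n)
  then obtain m' where m: "m = Suc m'" "n \<le> m'" by (cases m) auto
  show ?case
  proof (cases "pick H v")
    case (Some a)
    then have "pick F v = Some a"
      using assms(1-3) finite_subset[OF assms(2,1)] by (auto simp: pick_Some)
    moreover have "expect F m' (\<lambda>l'. \<phi> (a # l')) =
        expect H n (\<lambda>l. expect F (m' - length l) (\<lambda>l'. \<phi> (a # l @ l')))"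
      using Suc.IH[OF m(2), of "\<lambda>l'. \<phi> (a # l')"] by auto
    ultimately show ?thesis using Some m by simp
  qed simp
qed simp

lemma expect_depends:
  assumes "\<And>a. a \<in> F \<Longrightarrow> vbl a \<subseteq> V" "finite F" "\<And>l. depends_on V (\<phi> l)"
  shows "depends_on V (expect F n \<phi>)"
  using assms(3)
proof (induction n arbitrary: \<phi>)
  case 0
  then show ?case by (simp add: depends_on_def)
next
  case (Suc n)
  show ?case
    unfolding depends_on_def
  proof (intro allI impI)
    fix u v assume uv: "agree V u v"
    have "bad a u = bad a v" if "a \<in> F" for a
      using depends_onD[OF bad_vbl] agree_mono[OF uv assms(1)[OF that]] by blast
    then have pk: "pick F u = pick F v"
      using pick_None[of F u] pick_None[of F v] pick_Some[OF assms(2), of u] pick_Some[OF assms(2), of v]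
      by (cases "pick F v") auto
    have "avg (rsp a) (expect F n (\<lambda>l. \<phi> (a # l))) u = avg (rsp a) (expect F n (\<lambda>l. \<phi> (a # l))) v" for a
    proof (rule depends_onD[OF depends_on_avg[OF finite_rsp, of V]])
      show "depends_on V (expect F n (\<lambda>l. \<phi> (a # l)))" by (rule Suc.IH) (rule Suc.prems)
      show "agree (V - rsp a) u v" using uv by (auto simp: agree_def)
    qed
    then show "expect F (Suc n) \<phi> u = expect F (Suc n) \<phi> v"
      using pk depends_onD[OF Suc.prems uv] by (auto split: option.split)
  qed
qed

lemma follows_append: "follows us l \<Longrightarrow> follows us (l @ l')"
  by (induction us l rule: follows.induct) (auto split: if_splits)

lemma pick_skips:
  assumes "finite F" "pick F v = Some a" "skips a U" "agree (- (\<Union>u\<in>U. rsp u)) v' v"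
  shows "pick F v' = Some a"
proof -
  have "bad b v' = bad b v" if "skips b U" for b
  proof (rule depends_onD[OF bad_vbl])
    have "rsp u \<inter> vbl b = {}" if "u \<in> U" for u
      using \<open>skips b U\<close> that vbl_rsp_disjoint unfolding skips_def by blast
    then have "vbl b \<subseteq> - (\<Union>u\<in>U. rsp u)" by blast
    then show "agree (vbl b) v' v" by (rule agree_mono[OF assms(4)])
  qed
  then show ?thesis using assms(2,3) skips_downward by (auto simp: pick_Some[OF assms(1)])
qed

text \<open>
  A given pattern occurs with probability at most the product of its weights. At each time the
  resample variables of the rest of the pattern can be taken as fresh, that is, one may average over
  them. A skippable event neither looks at them nor changes them, and whether one is picked does
  not depend on them. When no skippable event is true, the next event has to be the first of the
  pattern: averaging over its resample variables costs the factor \<open>P u\<close>, whatever the values of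
  its other variables are, and resampling makes these variables fresh again.
\<close>

lemma expect_follows:
  assumes "finite F" "good v"
  shows "avg (\<Union>u\<in>set us. rsp u) (expect F n (\<lambda>l _. of_bool (follows us l))) v \<le> prod_list (map P us)"
  using assms(2)
proof (induction n arbitrary: us v)
  case 0
  have "avg (\<Union>u\<in>set us. rsp u) (expect F 0 (\<lambda>l _. of_bool (follows us l))) v \<le> of_bool (us = [])"
    using avg_mono[of "\<Union>u\<in>set us. rsp u" v "expect F 0 (\<lambda>l _. of_bool (follows us l))" "\<lambda>_. of_bool (us = [])"]
      0 finite_rsp by (cases us) (auto simp: avg_const)
  also have "\<dots> \<le> prod_list (map P us)" using P_nonneg by (cases us) (auto intro!: prod_list_nonneg mult_nonneg_nonneg)
  finally show ?case .
next
  case (Suc n)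
  show ?case
  proof (cases us)
    case Nil
    then show ?thesis using expect_const[of F "Suc n" 1 v] by simp
  next
    case (Cons u us')
    define S where "S = (\<Union>u\<in>set us. rsp u)"
    define S' where "S' = (\<Union>u\<in>set us'. rsp u)"
    have fin: "finite S" "finite S'" and S: "S = rsp u \<union> S'"
      using finite_rsp by (auto simp: S_def S'_def Cons)
    define g where "g us = expect F n (\<lambda>l _. of_bool (follows us l) :: real)" for us
    have g0: "0 \<le> g us v" if "good v" for us v
      using expect_mono'[OF that, of "\<lambda>_ _. 0" _ F n] expect_const[of F n 0 v] by (auto simp: g_def)
    have step: "expect F (Suc n) (\<lambda>l _. of_bool (follows us l)) v' =
        (case pick F v' of None \<Rightarrow> 0 | Some a \<Rightarrow>
          if a = u then avg (rsp a) (g us') v'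
          else if skips a (set us) then avg (rsp a) (g us) v' else 0)" for v'
    proof -
      have "expect F n (\<lambda>_ _. 0) = (\<lambda>_. 0)" by (rule ext) (rule expect_const)
      then show ?thesis by (auto split: option.split simp: Cons g_def avg_const finite_rsp)
    qed
    show ?thesis
    (* By pick_skips the answer is the same for all valuations that agree with v outside S. *)
    proof (cases "\<exists>a. pick F v = Some a \<and> skips a (set us)")
      case True
      then obtain a where a: "pick F v = Some a" "skips a (set us)" by blast
      have "a \<noteq> u" using a(2) nb_self Cons by (auto simp: skips_def)
      have "avg S (expect F (Suc n) (\<lambda>l _. of_bool (follows us l))) v = avg S (avg (rsp a) (g us)) v"
      proof (rule avg_cong[OF fin(1)])
        fix v' assume "agree (- S) v' v"
        then have "pick F v' = Some a" using pick_skips[OF assms(1) a] by (simp add: S_def)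
        then show "expect F (Suc n) (\<lambda>l _. of_bool (follows us l)) v' = avg (rsp a) (g us) v'"
          unfolding step using a(2) \<open>a \<noteq> u\<close> by simp
      qed
      also have "\<dots> = avg (rsp a) (avg S (g us)) v"
        by (simp add: avg_commute fin finite_rsp)
      also have "\<dots> \<le> avg (rsp a) (\<lambda>_. prod_list (map P us)) v"
        using Suc.IH[of _ us] by (intro avg_mono Suc.prems finite_rsp) (auto simp: S_def g_def)
      finally show ?thesis by (simp add: S_def[symmetric] avg_const finite_rsp del: expect.simps)
    next
      case False
      have "avg S (expect F (Suc n) (\<lambda>l _. of_bool (follows us l))) v \<le>
          avg S (\<lambda>v. of_bool (bad u v) * avg (rsp u) (g us') v) v"
      proof (rule avg_mono[OF fin(1) Suc.prems])
        fix v' assume v': "good v'" "agree (- S) v' v"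
        have "\<not> skips a (set us)" if "pick F v' = Some a" for a
          using False pick_skips[OF assms(1) that, of "set us" v] agree_sym[OF v'(2)] by (auto simp: S_def)
        moreover have "bad u v'" if "pick F v' = Some u" using that assms(1) by (simp add: pick_Some)
        moreover have "0 \<le> avg (rsp u) (g us') v'" by (intro avg_nonneg finite_rsp v' g0)
        ultimately show "expect F (Suc n) (\<lambda>l _. of_bool (follows us l)) v' \<le>
            of_bool (bad u v') * avg (rsp u) (g us') v'"
          unfolding step by (auto split: option.split)
      qed
      also have "\<dots> = avg S (avg (rsp u) (\<lambda>v. of_bool (bad u v) * avg (rsp u) (g us') v)) v"
        using avg_union[OF fin(1) finite_rsp[of u]] S by (simp add: Un_absorb2)
      also have "avg (rsp u) (\<lambda>v. of_bool (bad u v) * avg (rsp u) (g us') v) =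
          (\<lambda>v. avg (rsp u) (g us') v * avg (rsp u) (\<lambda>v. of_bool (bad u v)) v)"
        using avg_pull[OF finite_rsp[of u] depends_on_avg'[OF finite_rsp[of u]]]
        by (subst mult.commute) (rule ext)
      also have "avg S \<dots> v \<le> avg S (\<lambda>v. P u * avg (rsp u) (g us') v) v"
      proof (rule avg_mono[OF fin(1) Suc.prems])
        fix v' assume v': "good v'"
        have "0 \<le> avg (rsp u) (g us') v'" by (intro avg_nonneg finite_rsp v' g0)
        then show "avg (rsp u) (g us') v' * avg (rsp u) (\<lambda>v. of_bool (bad u v)) v' \<le> P u * avg (rsp u) (g us') v'"
          using P_bound[OF v', of u] by (metis mult.commute mult_right_mono)
      qed
      also have "\<dots> = P u * avg S (avg (rsp u) (g us')) v" by (rule avg_cmult[OF fin(1)])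
      also have "avg S (avg (rsp u) (g us')) v = avg S (avg S' (g us')) v"
        using avg_union[OF fin(1) finite_rsp[of u]] avg_union[OF fin] S by (metis Un_absorb2 Un_upper1 Un_upper2)
      also have "P u * avg S (avg S' (g us')) v \<le> P u * avg S (\<lambda>_. prod_list (map P us')) v"
        using Suc.IH[of _ us'] by (intro mult_left_mono P_nonneg avg_mono Suc.prems fin) (auto simp: S'_def g_def)
      finally show ?thesis
        unfolding S_def[symmetric] using Cons by (simp add: avg_const[OF fin(1)] avg_const[OF fin(2)] del: expect.simps)
    qed
  qed
qed

end

section \<open>Stability under later resampling\<close>

context resampling
begin

lemma expect_nonneg: "good v \<Longrightarrow> (\<And>l v'. 0 \<le> \<phi> l v') \<Longrightarrow> 0 \<le> expect F n \<phi> v"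
  using expect_mono'[of v "\<lambda>_ _. 0" \<phi> F n] expect_const[of F n 0 v] by simp

lemma set_cone: "set (past_cone s) \<subseteq> set s"
proof -
  have "set (cone_from U s) \<subseteq> set s" for U s by (induction s arbitrary: U) auto
  then show ?thesis by (cases s) auto
qed

lemma resampled_cone_inj:
  assumes "i < j" "j < length l" "l ! i = b" "l ! j = b"
  shows "past_cone (rev (take (Suc i) l)) \<noteq> past_cone (rev (take (Suc j) l))"
proof -
  have cnt: "count_list (past_cone (rev (take (Suc k) l))) b = count_list (take (Suc k) l) b"
    if "k < length l" "l ! k = b" for k
    using count_cone[of b "rev (take k l)"] that by (simp add: take_Suc_conv_app_nth)
  have "count_list (take (Suc j) l) b = count_list (take (Suc i) l) b + count_list (drop (Suc i) (take (Suc j) l)) b"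
    using assms(1) by (subst append_take_drop_id[of "Suc i" "take (Suc j) l", symmetric], subst count_list_append) (simp add: min_def)
  moreover have "b \<in> set (drop (Suc i) (take (Suc j) l))"
    using assms by (auto simp: take_Suc_conv_app_nth)
  then have "count_list (drop (Suc i) (take (Suc j) l)) b \<noteq> 0"
    by (simp add: count_list_0_iff)
  ultimately show ?thesis using cnt[of i] cnt[of j] assms by auto
qed

lemma log_rev_take: "log_rev (rev l) \<Longrightarrow> log_rev (rev (take k l))"
proof -
  assume "log_rev (rev l)"
  moreover have "rev l = rev (drop k l) @ rev (take k l)"
    by (simp only: rev_append[symmetric] append_take_drop_id)
  ultimately show ?thesis by (simp only: successively_append_iff)
qed

text \<open>
  Different occurrences of \<open>b\<close> have different cones, because a cone contains all earlier
  occurrences of \<open>b\<close>. So the occurrences can be counted by the patterns that the log follows.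
\<close>

lemma resampled_count_le:
  assumes "finite W" "log_rev (rev l)"
    and W: "\<And>s. log_rev (b # s) \<Longrightarrow> set (b # s) \<subseteq> set l \<Longrightarrow> length (b # s) \<le> length l \<Longrightarrow>
      L \<le> length (past_cone (b # s)) \<Longrightarrow> past_cone (b # s) \<in> W"
  shows "real (card {i. i < length l \<and> l ! i = b \<and> L \<le> length (past_cone (rev (take (Suc i) l)))}) \<le>
    (\<Sum>u\<in>W. of_bool (follows (rev u) l))"
proof -
  define I where "I = {i. i < length l \<and> l ! i = b \<and> L \<le> length (past_cone (rev (take (Suc i) l)))}"
  define f where "f i = past_cone (rev (take (Suc i) l))" for i
  have "card I \<le> card (W \<inter> {u. follows (rev u) l})"
  proof (rule card_inj_on_le)
    show "inj_on f I"
    proof (rule linorder_inj_onI')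
      show "f i \<noteq> f j" if "i \<in> I" "j \<in> I" "i < j" for i j
        using resampled_cone_inj[OF that(3)] that by (auto simp: I_def f_def)
    qed
    show "f ` I \<subseteq> W \<inter> {u. follows (rev u) l}"
    proof
      fix u assume "u \<in> f ` I"
      then obtain i where i: "i < length l" "l ! i = b" "L \<le> length (f i)" "u = f i"
        by (auto simp: I_def f_def)
      define s where "s = rev (take i l)"
      have bs: "rev (take (Suc i) l) = b # s" using i by (simp add: s_def take_Suc_conv_app_nth)
      have lr: "log_rev (b # s)" using log_rev_take[OF assms(2), of "Suc i"] bs by simp
      have "set (b # s) \<subseteq> set l" using set_take_subset[of "Suc i" l] bs by (metis set_rev)
      moreover have "length (b # s) \<le> length l" using bs[symmetric] by simp
      ultimately have "u \<in> W" using W[OF lr] i bs by (simp add: f_def)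
      moreover have "follows (rev u) (take (Suc i) l)"
        using follows_cone[OF lr] bs i(4) by (metis f_def rev_rev_ident)
      then have "follows (rev u) l"
        using follows_append[of "rev u" "take (Suc i) l" "drop (Suc i) l"] by simp
      ultimately show "u \<in> W \<inter> {u. follows (rev u) l}" by simp
    qed
  qed (use assms in auto)
  then show ?thesis unfolding I_def[symmetric] using assms(1) by (simp add: of_nat_le_iff)
qed

text \<open>
  Sum \<open>expect_follows\<close> over the valid words of length at least \<open>L\<close>. The weights \<open>P / al\<close> still
  satisfy the local lemma condition, so the factor \<open>al ^ length u\<close> is a gain. The bound is \<open>x b\<close>
  instead of \<open>1 + x b\<close> since the empty word is not the cone of an occurrence.
\<close>

lemma expected_count:
  assumes "finite F" "good v" "finite V" "\<And>a. a \<in> F \<Longrightarrow> rsp a \<subseteq> V"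
  shows "avg V (expect F n (\<lambda>l _. real (card {i. i < length l \<and> l ! i = b \<and>
    L \<le> length (past_cone (rev (take (Suc i) l)))}))) v \<le> al ^ L * x b"
proof -
  define W0 where "W0 = {u. length u \<le> n \<and> valid_word {b} u}"
  define W where "W = {u \<in> W0. L \<le> length u \<and> u \<noteq> [] \<and> set u \<subseteq> F}"
  define Q where "Q a = P a / al" for a
  have Q: "0 \<le> Q a" "Q a * (\<Prod>b\<in>nb a. 1 + x b) \<le> x a" for a
    using P_nonneg P_x[of a] al by (auto simp: Q_def field_simps)
  have W0: "finite W0" "(\<Sum>u\<in>W0. prod_list (map Q u)) \<le> 1 + x b"
    using words_sum[OF x_nonneg Q, of "{b}" n] by (auto simp: W0_def)
  have fW: "finite W" using W0 by (simp add: W_def)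
  have Q0: "0 \<le> prod_list (map Q u)" for u by (induction u) (auto simp: Q(1))
  have "[] \<in> W0" by (simp add: W0_def)
  then have "(\<Sum>u\<in>W. prod_list (map Q u)) + 1 \<le> (\<Sum>u\<in>W0. prod_list (map Q u))"
    using sum_mono2[of W0 "insert [] W" "\<lambda>u. prod_list (map Q u)"] W0(1) fW Q0 by (auto simp: W_def)
  then have sW: "(\<Sum>u\<in>W. prod_list (map Q u)) \<le> x b" using W0(2) by linarith
  have PQ: "prod_list (map P u) = al ^ length u * prod_list (map Q u)" for u
    using al by (induction u) (auto simp: Q_def)
  have "avg V (expect F n (\<lambda>l _. real (card {i. i < length l \<and> l ! i = b \<and>
      L \<le> length (past_cone (rev (take (Suc i) l)))}))) v
    \<le> avg V (expect F n (\<lambda>l _. \<Sum>u\<in>W. of_bool (follows (rev u) l))) v"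
  proof (intro avg_mono expect_mono assms(3,2))
    fix u l v'
    assume l: "resamples F u l v'" "length l \<le> n"
    show "real (card {i. i < length l \<and> l ! i = b \<and> L \<le> length (past_cone (rev (take (Suc i) l)))})
      \<le> (\<Sum>u\<in>W. of_bool (follows (rev u) l))"
    proof (rule resampled_count_le[OF fW resamples_log_rev[OF l(1) assms(1)]])
      fix s assume s: "log_rev (b # s)" "set (b # s) \<subseteq> set l" "length (b # s) \<le> length l"
        "L \<le> length (past_cone (b # s))"
      then show "past_cone (b # s) \<in> W"
        using valid_cone[OF s(1)] set_cone[of "b # s"] length_cone[of "b # s"] resamples_set[OF assms(1) l(1)] l(2)
        unfolding W_def W0_def by (auto simp del: valid_word.simps)
    qed
  qed
  also have "\<dots> = (\<Sum>u\<in>W. avg V (expect F n (\<lambda>l _. of_bool (follows (rev u) l))) v)"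
  proof -
    have "expect F n (\<lambda>l _. \<Sum>u\<in>W. of_bool (follows (rev u) l)) =
        (\<lambda>v. \<Sum>u\<in>W. expect F n (\<lambda>l _. of_bool (follows (rev u) l)) v)"
      by (rule ext) (rule expect_sum[OF fW])
    then show ?thesis using avg_sum[OF assms(3) fW] by simp
  qed
  also have "\<dots> \<le> (\<Sum>u\<in>W. al ^ L * prod_list (map Q u))"
  proof (rule sum_mono)
    fix u assume u: "u \<in> W"
    define S where "S = (\<Union>a\<in>set (rev u). rsp a)"
    have S: "S \<subseteq> V" "finite S" using u assms(4) finite_rsp by (auto simp: S_def W_def)
    have "avg V (expect F n (\<lambda>l _. of_bool (follows (rev u) l))) v =
        avg V (avg S (expect F n (\<lambda>l _. of_bool (follows (rev u) l)))) v"
      using avg_union[OF assms(3) S(2)] S(1) by (simp add: Un_absorb2)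
    also have "\<dots> \<le> avg V (\<lambda>_. prod_list (map P (rev u))) v"
      using expect_follows[OF assms(1), of _ "rev u"] by (intro avg_mono assms(2,3)) (simp add: S_def)
    also have "\<dots> = al ^ length u * prod_list (map Q u)"
      using PQ[of u] by (simp add: avg_const assms(3) rev_map[symmetric])
    also have "\<dots> \<le> al ^ L * prod_list (map Q u)"
      using u al by (intro mult_right_mono Q0 power_decreasing) (auto simp: W_def)
    finally show "avg V (expect F n (\<lambda>l _. of_bool (follows (rev u) l))) v \<le> al ^ L * prod_list (map Q u)" .
  qed
  also have "\<dots> \<le> al ^ L * x b"
    unfolding sum_distrib_left[symmetric] using sW al by (intro mult_left_mono) auto
  finally show ?thesis .
qed

lemma expect_cmult_avg:
  "finite V \<Longrightarrow> avg V (expect F n (\<lambda>l v. k * \<phi> l v)) v = k * avg V (expect F n \<phi>) v"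
proof -
  assume "finite V"
  moreover have "expect F n (\<lambda>l v. k * \<phi> l v) = (\<lambda>v. k * expect F n \<phi> v)"
    by (rule ext) (rule expect_cmult)
  ultimately show ?thesis by (simp add: avg_cmult)
qed

lemma expect_sum_avg:
  "finite V \<Longrightarrow> finite I \<Longrightarrow>
    avg V (expect F n (\<lambda>l v. \<Sum>i\<in>I. \<phi> i l v)) v = (\<Sum>i\<in>I. avg V (expect F n (\<phi> i)) v)"
proof -
  assume "finite V" "finite I"
  moreover from this have "expect F n (\<lambda>l v. \<Sum>i\<in>I. \<phi> i l v) = (\<lambda>v. \<Sum>i\<in>I. expect F n (\<phi> i) v)"
    by (intro ext expect_sum)
  ultimately show ?thesis by (simp add: avg_sum)
qed

text \<open>
  Markov's inequality for the length of the log, which is the total number of resamplings.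
\<close>

lemma unfinished_bound:
  assumes "finite F" "good v" "finite V" "\<And>a. a \<in> F \<Longrightarrow> rsp a \<subseteq> V"
  shows "real n * avg V (expect F n (\<lambda>l _. of_bool (n \<le> length l))) v \<le> real (card F) * xmax"
proof -
  define N where "N b l = real (card {i. i < length l \<and> l ! i = b \<and> 0 \<le> length (past_cone (rev (take (Suc i) l)))})" for b l
  have N: "(\<Sum>b\<in>F. N b l) = real (length l)" if "set l \<subseteq> F" for l
  proof -
    have "length l = card (\<Union>b\<in>F. {i. i < length l \<and> l ! i = b})"
    proof -
      have "(\<Union>b\<in>F. {i. i < length l \<and> l ! i = b}) = {..<length l}" using that nth_mem by fastforce
      then show ?thesis by simp
    qed
    also have "\<dots> = (\<Sum>b\<in>F. card {i. i < length l \<and> l ! i = b})"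
      by (rule card_UN_disjoint) (use assms(1) in auto)
    finally have "real (length l) = real (\<Sum>b\<in>F. card {i. i < length l \<and> l ! i = b})" by (rule arg_cong)
    then show ?thesis by (simp add: N_def del: of_nat_eq_iff)
  qed
  have "real n * avg V (expect F n (\<lambda>l _. of_bool (n \<le> length l))) v =
      avg V (expect F n (\<lambda>l _. real n * of_bool (n \<le> length l))) v"
    by (simp add: expect_cmult_avg assms(3))
  also have "\<dots> \<le> avg V (expect F n (\<lambda>l _. \<Sum>b\<in>F. N b l)) v"
    by (intro avg_mono expect_mono assms(2,3)) (use N resamples_set[OF assms(1)] in auto)
  also have "\<dots> = (\<Sum>b\<in>F. avg V (expect F n (\<lambda>l _. N b l)) v)"
    by (rule expect_sum_avg[OF assms(3,1)])
  also have "\<dots> \<le> (\<Sum>b\<in>F. xmax)"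
    using order_trans[OF expected_count[OF assms, of n _ 0]] x_le
    by (intro sum_mono) (simp add: N_def)
  finally show ?thesis by simp
qed

lemma long_cone_bound:
  assumes "finite F" "good v" "finite V" "\<And>a. a \<in> F \<Longrightarrow> rsp a \<subseteq> V" "finite B"
  shows "avg V (expect F n (\<lambda>l _. of_bool (\<exists>i<length l. l ! i \<in> B \<and>
    L \<le> length (past_cone (rev (take (Suc i) l)))))) v \<le> real (card B) * (al ^ L * xmax)"
proof -
  define N where "N b l = real (card {i. i < length l \<and> l ! i = b \<and> L \<le> length (past_cone (rev (take (Suc i) l)))})" for b l
  have N0: "0 \<le> N b l" for b l by (simp add: N_def)
  have "of_bool (\<exists>i<length l. l ! i \<in> B \<and> L \<le> length (past_cone (rev (take (Suc i) l)))) \<le> (\<Sum>b\<in>B. N b l)" for l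
  proof (cases "\<exists>i<length l. l ! i \<in> B \<and> L \<le> length (past_cone (rev (take (Suc i) l)))")
    case True
    then obtain i where i: "i < length l" "l ! i \<in> B" "L \<le> length (past_cone (rev (take (Suc i) l)))" by blast
    then have "card {i} \<le> card {j. j < length l \<and> l ! j = l ! i \<and> L \<le> length (past_cone (rev (take (Suc j) l)))}"
      by (intro card_mono) auto
    then have "1 \<le> N (l ! i) l" by (simp add: N_def)
    also have "\<dots> \<le> (\<Sum>b\<in>B. N b l)" by (rule member_le_sum) (use i N0 assms(5) in auto)
    finally show ?thesis using True by simp
  next
    case False
    then show ?thesis using N0 by (auto intro: sum_nonneg)
  qed
  then have "avg V (expect F n (\<lambda>l _. of_bool (\<exists>i<length l. l ! i \<in> B \<and>
      L \<le> length (past_cone (rev (take (Suc i) l)))))) v \<le> avg V (expect F n (\<lambda>l _. \<Sum>b\<in>B. N b l)) v"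
    by (intro avg_mono expect_mono assms(2,3)) auto
  also have "\<dots> = (\<Sum>b\<in>B. avg V (expect F n (\<lambda>l _. N b l)) v)"
    by (rule expect_sum_avg[OF assms(3,5)])
  also have "\<dots> \<le> (\<Sum>b\<in>B. al ^ L * xmax)"
  proof (rule sum_mono)
    fix b
    have "avg V (expect F n (\<lambda>l _. N b l)) v \<le> al ^ L * x b"
      unfolding N_def by (rule expected_count[OF assms(1-4)])
    also have "\<dots> \<le> al ^ L * xmax" using x_le al by (intro mult_left_mono) auto
    finally show "avg V (expect F n (\<lambda>l _. N b l)) v \<le> al ^ L * xmax" .
  qed
  finally show ?thesis by simp
qed

lemma resamples_superset:
  assumes "resamples H v l v'" "finite F" "H \<subseteq> F"
    "\<And>a b. b \<in> H \<Longrightarrow> a \<in> F \<Longrightarrow> lt a b \<Longrightarrow> a \<in> H"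
  shows "resamples F v l v'"
  using assms(1)
proof (induction rule: resamples.induct)
  case (resamples_Cons v a u l v')
  then have "pick F v = Some a"
    using assms(2-4) finite_subset[OF assms(3,2)] by (auto simp: pick_Some)
  then show ?case using resamples_Cons resamples.resamples_Cons by blast
qed (rule resamples_Nil)

text \<open>
  Suppose that \<open>b\<close> is resampled after all of \<open>H\<close> was false. The first event \<open>d\<close> after that moment
  is outside \<open>H\<close>. It belongs to the cone of \<open>b\<close>, since otherwise it would be below \<open>b\<close> and so
  in \<open>H\<close>. The cone thus leads from \<open>b\<close> out of \<open>H\<close>.
\<close>

lemma late_resampling_long_cone:
  assumes H: "finite F" "H \<subseteq> F" "\<And>a b. b \<in> H \<Longrightarrow> a \<in> F \<Longrightarrow> lt a b \<Longrightarrow> a \<in> H"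
    and E: "\<And>i. (\<Union>a\<in>E i. nb a) \<subseteq> E (Suc i)" "\<And>i. E i \<subseteq> E (Suc i)" "E (j + L) \<subseteq> H"
    and l: "resamples H v l v'" "pick H v' = None" "resamples F v' l' v''"
    and b: "b \<in> set l'" "b \<in> E j"
  shows "\<exists>i<length (l @ l'). (l @ l') ! i = b \<and> L \<le> length (past_cone (rev (take (Suc i) (l @ l'))))"
proof -
  have mono: "E i \<subseteq> E k" if "i \<le> k" for i k
    by (rule lift_Suc_mono_le[of E, OF E(2) that])
  have bH: "b \<in> H" using b(2) mono[of j "j + L"] E(3) by auto
  obtain d l1 where l': "l' = d # l1" and d: "pick F v' = Some d"
    using l(3) b(1) by (cases rule: resamples.cases) auto
  have dF: "d \<in> F" "d \<notin> H" using d l(2) H(1) by (auto simp: pick_Some pick_None)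
  then have "b \<in> set l1" using b(1) bH l' by auto
  then obtain l2 l3 where l1: "l1 = l2 @ b # l3" by (auto dest: split_list)
  define s where "s = rev l2 @ d # rev l"
  have "log_rev (rev (l @ l'))"
    by (rule resamples_log_rev[OF resamples_append[OF resamples_superset[OF l(1) H] l(3)] H(1)])
  then have "log_rev (rev l3 @ b # s)" by (simp add: l' l1 s_def)
  then have "log_rev (b # s)" by (simp add: successively_append_iff)
  then have "d \<in> set (cone_from {b} s) \<or> lt d b"
    using cone_from_covers[of "{b}" b s d] by (auto simp: linked_def s_def)
  then have "d \<in> set (cone_from {b} s)" using H(3)[OF bH dF(1)] dF(2) by blast
  then have "d \<in> E (j + length (cone_from {b} s))"
    using cone_from_reach[of E "{b}" j s, OF E(1) _ E(2)] b(2) by auto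
  then have "\<not> length (cone_from {b} s) \<le> L"
    using mono[of "j + length (cone_from {b} s)" "j + L"] E(3) dF(2) by auto
  moreover have "take (Suc (Suc (length l + length l2))) (l @ l') = rev (b # s)"
    by (simp add: l' l1 s_def)
  ultimately have "L \<le> length (past_cone (rev (take (Suc (Suc (length l + length l2))) (l @ l'))))" by simp
  moreover have "Suc (length l + length l2) < length (l @ l')" "(l @ l') ! Suc (length l + length l2) = b"
    by (auto simp: l' l1 nth_append)
  ultimately show ?thesis by blast
qed

text \<open>
  Passing from the events \<open>H\<close> and \<open>n\<close> steps to more events and more steps changes the variables
  in \<open>U\<close> only if the \<open>H\<close>-process is unfinished after \<open>n\<close> steps, or if an event that resamples a
  variable in \<open>U\<close> occurs after all of \<open>H\<close> was false. The latter needs a cone of length \<open>L\<close>.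
\<close>

theorem stability:
  assumes H: "finite F" "H \<subseteq> F" "\<And>a b. b \<in> H \<Longrightarrow> a \<in> F \<Longrightarrow> lt a b \<Longrightarrow> a \<in> H"
    and E: "\<And>i. (\<Union>a\<in>E i. nb a) \<subseteq> E (Suc i)" "\<And>i. E i \<subseteq> E (Suc i)" "E (j + L) \<subseteq> H"
    and U: "\<And>a. rsp a \<inter> U \<noteq> {} \<Longrightarrow> a \<in> B" and B: "finite B" "B \<subseteq> E j"
    and T: "depends_on U T" and "n \<le> m"
    and V: "good v" "finite V" "\<And>a. a \<in> F \<Longrightarrow> rsp a \<subseteq> V"
  shows "avg V (expect H n (\<lambda>_ v. of_bool (T v))) v \<le> avg V (expect F m (\<lambda>_ v. of_bool (T v))) v
    + avg V (expect H n (\<lambda>l _. of_bool (n \<le> length l))) v + real (card B) * (al ^ L * xmax)"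
proof -
  define far where "far l \<longleftrightarrow> (\<exists>i<length l. l ! i \<in> B \<and> L \<le> length (past_cone (rev (take (Suc i) l))))" for l
  have "avg V (expect H n (\<lambda>_ v. of_bool (T v))) v \<le>
     avg V (expect H n (\<lambda>l v'. expect F (m - length l) (\<lambda>l' v''. of_bool (T v'') + of_bool (far (l @ l'))) v'
       + of_bool (n \<le> length l))) v"
  proof (intro avg_mono expect_mono V)
    fix u l v'
    assume "good u" and l: "resamples H u l v'" "good v'" "length l \<le> n" "length l < n \<Longrightarrow> pick H v' = None"
    show "of_bool (T v') \<le> expect F (m - length l) (\<lambda>l' v''. of_bool (T v'') + of_bool (far (l @ l'))) v'
      + of_bool (n \<le> length l)"
    proof (cases "n \<le> length l")
      case True
      have "0 \<le> expect F (m - length l) (\<lambda>l' v''. of_bool (T v'') + of_bool (far (l @ l'))) v'"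
        by (rule expect_nonneg[OF l(2)]) simp
      then show ?thesis using True by simp
    next
      case False
      then have nb: "pick H v' = None" using l(4) by simp
      have "of_bool (T v') = expect F (m - length l) (\<lambda>_ _. of_bool (T v')) v'"
        by (simp add: expect_const)
      also have "\<dots> \<le> expect F (m - length l) (\<lambda>l' v''. of_bool (T v'') + of_bool (far (l @ l'))) v'"
      proof (rule expect_mono[OF l(2)])
        fix l' v'' assume l': "resamples F v' l' v''"
        show "of_bool (T v') \<le> (of_bool (T v'') + of_bool (far (l @ l')) :: real)"
        proof (cases "\<forall>a\<in>set l'. rsp a \<inter> U = {}")
          case True
          then have "T v' = T v''" using depends_onD[OF T resamples_unchanged[OF l']] by blast
          then show ?thesis by simp
        next
          case False
          then obtain b where "b \<in> set l'" "b \<in> B" using U by blast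
          then have "b \<in> E j" using B(2) by blast
          have "\<exists>i<length (l @ l'). (l @ l') ! i = b \<and>
              L \<le> length (past_cone (rev (take (Suc i) (l @ l'))))"
            by (rule late_resampling_long_cone[where F = F and H = H and E = E and j = j and v = u and v' = v' and v'' = v''])
              (fact H E l(1) nb l' \<open>b \<in> set l'\<close> \<open>b \<in> E j\<close>)+
          then obtain i where "i < length (l @ l')" "(l @ l') ! i = b"
            "L \<le> length (past_cone (rev (take (Suc i) (l @ l'))))" by blast
          then have "far (l @ l')" using \<open>b \<in> B\<close> unfolding far_def by (intro exI[of _ i]) simp
          then show ?thesis by simp
        qed
      qed
      finally show ?thesis using False by simp
    qed
  qed
  also have "\<dots> = avg V (expect H n (\<lambda>l v'. expect F (m - length l)
      (\<lambda>l' v''. of_bool (T v'') + of_bool (far (l @ l'))) v')) v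
    + avg V (expect H n (\<lambda>l _. of_bool (n \<le> length l))) v"
  proof -
    have "expect H n (\<lambda>l v'. expect F (m - length l) (\<lambda>l' v''. of_bool (T v'') + of_bool (far (l @ l'))) v'
       + of_bool (n \<le> length l)) =
      (\<lambda>v. expect H n (\<lambda>l v'. expect F (m - length l)
      (\<lambda>l' v''. of_bool (T v'') + of_bool (far (l @ l'))) v') v + expect H n (\<lambda>l _. of_bool (n \<le> length l)) v)"
      by (rule ext) (rule expect_add)
    then show ?thesis by (simp add: avg_add V)
  qed
  also have "(expect H n (\<lambda>l v'. expect F (m - length l)
      (\<lambda>l' v''. of_bool (T v'') + of_bool (far (l @ l'))) v')) =
      expect F m (\<lambda>l v. of_bool (T v) + of_bool (far l))"
    by (rule ext, rule expect_append[symmetric]) (fact H \<open>n \<le> m\<close>)+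
  also have "\<dots> = (\<lambda>v. expect F m (\<lambda>_ v. of_bool (T v)) v + expect F m (\<lambda>l _. of_bool (far l)) v)"
    by (rule ext) (rule expect_add)
  also have "avg V \<dots> v = avg V (expect F m (\<lambda>_ v. of_bool (T v))) v
      + avg V (expect F m (\<lambda>l _. of_bool (far l))) v"
    by (rule avg_add[OF V(2)])
  also have "avg V (expect F m (\<lambda>l _. of_bool (far l))) v \<le> real (card B) * (al ^ L * xmax)"
    unfolding far_def by (rule long_cone_bound[OF H(1) V B(1)])
  finally show ?thesis by simp
qed

end

section \<open>Certified prefixes\<close>

text \<open>
  The events are exhausted by finite initial segments \<open>E k\<close>, each of which contains the neighbours of
  the one before. The numbers \<open>C\<close> and \<open>m\<close> are integer substitutes for \<open>xmax\<close> and \<open>al\<close>, to which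
  the computation would have no access.
\<close>

locale staged_resampling = resampling +
  fixes E :: "nat \<Rightarrow> nat set" and m C :: nat
  assumes finite_E: "finite (E k)"
    and initial_E: "b \<in> E k \<Longrightarrow> lt a b \<Longrightarrow> a \<in> E k"
    and nb_E: "(\<Union>a\<in>E k. Gam_plus rsp a) \<subseteq> E (Suc k)"
    and E_Suc: "E k \<subseteq> E (Suc k)"
    and self_E: "k \<in> E (Suc k)"
    and rsp_E: "y < k \<Longrightarrow> y \<in> rsp a \<Longrightarrow> a \<in> E (Suc k)"
    and C: "xmax \<le> real C" "1 \<le> C"
    and m: "al ^ m \<le> 1 / 2"
begin

lemma E_mono: "i \<le> k \<Longrightarrow> E i \<subseteq> E k"
  by (rule lift_Suc_mono_le[of E, OF E_Suc])

text \<open>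
  The choices make both error terms in \<open>stability\<close> at most \<open>1 / k\<close> for the variables below \<open>k\<close>.
  These variables are resampled by events in \<open>E (Suc k)\<close> only. With \<open>i = k * C * set_encode (E (Suc k))\<close>,
  a cone from there out of \<open>E (level k)\<close> has more than \<open>m * i\<close> elements, so that each event of
  \<open>E (Suc k)\<close> contributes at most \<open>xmax / 2 ^ i \<le> C / i\<close>. The code of a finite set serves as a bound for its cardinality.
\<close>

definition level :: "nat \<Rightarrow> nat" where
  "level k = Suc k + m * (k * C * set_encode (E (Suc k)))"

definition steps :: "nat \<Rightarrow> nat" where
  "steps k = k * C * set_encode (E (level k))"

definition vars :: "nat \<Rightarrow> nat set" where
  "vars k = {..<k} \<union> (\<Union>a\<in>E (level k). vbl a)"

definition outcome :: "nat \<Rightarrow> ((nat \<Rightarrow> nat) \<Rightarrow> bool) \<Rightarrow> real" where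
  "outcome k T = avg (vars k) (expect (E (level k)) (steps k) (\<lambda>_ v. of_bool (T v))) (SOME v. good v)"

definition unfinished :: "nat \<Rightarrow> real" where
  "unfinished k = avg (vars k) (expect (E (level k)) (steps k) (\<lambda>l _. of_bool (steps k \<le> length l))) (SOME v. good v)"

lemma card_le_set_encode: "finite S \<Longrightarrow> card S \<le> set_encode S"
proof -
  assume "finite S"
  have "card S = (\<Sum>i\<in>S. 1)" by simp
  also have "\<dots> \<le> (\<Sum>i\<in>S. 2 ^ i)" by (rule sum_mono) simp
  finally show ?thesis by (simp add: set_encode_def)
qed

lemma set_encode_mono: "finite T \<Longrightarrow> S \<subseteq> T \<Longrightarrow> set_encode S \<le> set_encode T"
  unfolding set_encode_def by (rule sum_mono2) auto

lemma level_ge: "Suc k \<le> level k" by (simp add: level_def)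

lemma level_mono: "k \<le> k' \<Longrightarrow> level k \<le> level k'"
  unfolding level_def by (intro add_mono mult_mono set_encode_mono finite_E E_mono) auto

lemma steps_mono: "k \<le> k' \<Longrightarrow> steps k \<le> steps k'"
  unfolding steps_def by (intro mult_mono set_encode_mono finite_E E_mono level_mono) auto

lemma finite_vars: "finite (vars k)"
  by (simp add: vars_def finite_E finite_vbl)

lemma some_good: "good (SOME v. good v)"
  using someI_ex[OF ex_good] .

text \<open>
  The outcome is a number: neither the variables outside \<open>vars k\<close> nor the initial valuation matter.
\<close>

lemma avg_vars_eq:
  assumes "vars k \<subseteq> V" "finite V" "\<And>l. depends_on (vars k) (\<phi> l)"
  shows "avg V (expect (E (level k)) n \<phi>) v = avg (vars k) (expect (E (level k)) n \<phi>) u"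
proof -
  have d: "depends_on (vars k) (expect (E (level k)) n \<phi>)"
    by (rule expect_depends[OF _ finite_E assms(3)]) (auto simp: vars_def)
  have d': "depends_on {} (avg (vars k) (expect (E (level k)) n \<phi>))"
    using depends_on_avg[OF finite_vars d, of k] by simp
  have "avg V (expect (E (level k)) n \<phi>) v = avg V (avg (vars k) (expect (E (level k)) n \<phi>)) v"
    using avg_union[OF assms(2) finite_vars[of k]] assms(1) by (simp add: Un_absorb2)
  also have "\<dots> = avg (vars k) (expect (E (level k)) n \<phi>) v"
    by (rule avg_indep[OF assms(2)]) (rule depends_on_mono[OF d'], simp)
  also have "\<dots> = avg (vars k) (expect (E (level k)) n \<phi>) u"
    by (rule depends_onD[OF d']) (simp add: agree_def)
  finally show ?thesis .
qed

lemma outcome_eq: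
  assumes "vars k \<subseteq> V" "finite V" "depends_on (vars k) T"
  shows "avg V (expect (E (level k)) (steps k) (\<lambda>_ v. of_bool (T v))) v = outcome k T"
  unfolding outcome_def
  by (rule avg_vars_eq[OF assms(1,2)]) (use assms(3) in \<open>auto simp: depends_on_def\<close>)

lemma set_encode_E_pos: "0 < set_encode (E (Suc k))"
proof -
  have "0 < card (E (Suc k))" using self_E finite_E card_gt_0_iff by blast
  then show ?thesis using card_le_set_encode[OF finite_E[of "Suc k"]] by linarith
qed

lemma xmax_nonneg: "0 \<le> xmax"
  using order_trans[OF x_nonneg x_le] .

lemma unfinished_le: "0 < k \<Longrightarrow> unfinished k \<le> 1 / k"
proof -
  assume k: "0 < k"
  define h where "h = set_encode (E (level k))"
  have h: "0 < h" using set_encode_E_pos[of "level k - 1"] level_ge[of k] by (simp add: h_def)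
  have "real (steps k) * unfinished k \<le> real (card (E (level k))) * xmax"
    unfolding unfinished_def
    by (rule unfinished_bound[OF finite_E some_good finite_vars]) (use rsp_vbl in \<open>auto simp: vars_def\<close>)
  also have "\<dots> \<le> real h * real C"
    using card_le_set_encode[OF finite_E[of "level k"]] C xmax_nonneg by (intro mult_mono) (auto simp: h_def)
  finally have "real h * real C * (real k * unfinished k) \<le> real h * real C * 1"
    by (simp add: steps_def h_def mult_ac)
  then have "real k * unfinished k \<le> 1"
    by (rule mult_left_le_imp_le) (use h C in simp)
  then show ?thesis using k by (simp add: field_simps)
qed

lemma far_term_le:
  assumes "0 < k" "card B \<le> set_encode (E (Suc k))"
  shows "real (card B) * (al ^ (m * (k * C * set_encode (E (Suc k)))) * xmax) \<le> 1 / k"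
proof -
  define h where "h = set_encode (E (Suc k))"
  define i where "i = k * C * h"
  have h: "0 < h" using set_encode_E_pos h_def by simp
  have "al ^ (m * i) = (al ^ m) ^ i" by (rule power_mult)
  also have "\<dots> \<le> (1 / 2) ^ i" using m al by (intro power_mono) auto
  also have "\<dots> = 1 / 2 ^ i" by (simp add: power_one_over)
  also have "\<dots> \<le> 1 / real i"
  proof -
    have "real i \<le> 2 ^ i" by (metis less_exp less_imp_le of_nat_le_iff of_nat_numeral of_nat_power)
    moreover have "0 < i" using h assms C by (simp add: i_def)
    ultimately show ?thesis by (intro divide_left_mono) auto
  qed
  finally have 1: "al ^ (m * i) \<le> 1 / real i" .
  have "real (card B) * (al ^ (m * i) * xmax) \<le> real h * (1 / real i * real C)"
    using 1 assms(2) C xmax_nonneg al by (intro mult_mono) (auto simp: h_def)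
  also have "\<dots> = 1 / k" using h C by (simp add: i_def)
  finally show ?thesis by (simp add: i_def h_def)
qed

lemma outcome_stable:
  assumes "0 < k" "k \<le> k'" "j \<le> k" "depends_on {..<j} T"
  shows "outcome k T \<le> outcome k' T + 2 / k"
proof -
  define V where "V = vars k \<union> vars k'"
  have V: "finite V" "vars k \<subseteq> V" "vars k' \<subseteq> V" by (auto simp: V_def finite_vars)
  have T: "depends_on (vars k) T" "depends_on (vars k') T"
    using assms by (auto intro!: depends_on_mono[OF assms(4)] simp: vars_def)
  define L where "L = m * (k * C * set_encode (E (Suc k)))"
  define B where "B = {a. rsp a \<inter> {..<j} \<noteq> {}}"
  have "B \<subseteq> E (Suc k)"
  proof
    fix a assume "a \<in> B"
    then obtain y where "y < j" "y \<in> rsp a" by (auto simp: B_def)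
    then show "a \<in> E (Suc k)" using rsp_E[of y k a] assms(3) by simp
  qed
  then have B: "finite B" "B \<subseteq> E (Suc k)" "card B \<le> set_encode (E (Suc k))"
    using finite_subset[OF _ finite_E] card_mono[OF finite_E] card_le_set_encode[OF finite_E] order_trans by blast+
  have "avg V (expect (E (level k)) (steps k) (\<lambda>_ v. of_bool (T v))) (SOME v. good v) \<le>
      avg V (expect (E (level k')) (steps k') (\<lambda>_ v. of_bool (T v))) (SOME v. good v)
      + avg V (expect (E (level k)) (steps k) (\<lambda>l _. of_bool (steps k \<le> length l))) (SOME v. good v)
      + real (card B) * (al ^ L * xmax)"
  proof (rule stability[where E = E and j = "Suc k" and U = "{..<j}"])
    show "E (level k) \<subseteq> E (level k')" by (rule E_mono[OF level_mono[OF assms(2)]])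
    show "E (Suc k + L) \<subseteq> E (level k)" by (simp add: L_def level_def)
    show "rsp a \<subseteq> V" if "a \<in> E (level k')" for a
      using that rsp_vbl V(3) unfolding vars_def by blast
    show "\<And>a b. b \<in> E (level k) \<Longrightarrow> a \<in> E (level k') \<Longrightarrow> lt a b \<Longrightarrow> a \<in> E (level k)"
      using initial_E by blast
    show "\<And>a. rsp a \<inter> {..<j} \<noteq> {} \<Longrightarrow> a \<in> B" by (simp add: B_def)
  qed (fact finite_E nb_E E_Suc B assms(4) steps_mono[OF assms(2)] some_good V(1))+
  also have "avg V (expect (E (level k)) (steps k) (\<lambda>l _. of_bool (steps k \<le> length l))) (SOME v. good v) = unfinished k"
    unfolding unfinished_def by (rule avg_vars_eq[OF V(2,1)]) (simp add: depends_on_def)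
  finally show ?thesis
    using far_term_le[OF assms(1) B(3)] unfinished_le[OF assms(1)]
      outcome_eq[OF V(2,1) T(1)] outcome_eq[OF V(3,1) T(2)] by (simp add: L_def)
qed

text \<open>
  The process at stage \<open>k\<close> ends with \<open>s\<close> on the variables below \<open>j\<close> with probability more than
  \<open>4 / k\<close>. Since later stages lose at most \<open>2 / k\<close>, the probability then stays above \<open>2 / k\<close> for
  ever. The condition concerns one finite process only, and so it can be checked.
\<close>

definition certified :: "nat \<Rightarrow> (nat \<Rightarrow> nat) \<Rightarrow> nat \<Rightarrow> bool" where
  "certified j s k \<longleftrightarrow> j \<le> k \<and> 4 < real k * outcome k (agree {..<j} s)"

lemma depends_on_agree: "depends_on V (agree V s)"
  unfolding depends_on_def by (metis agree_sym agree_trans)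

lemma certified_later:
  assumes "certified j s k" "k \<le> k'"
  shows "2 / k < outcome k' (agree {..<j} s)"
proof -
  have k: "0 < k" using assms by (cases k) (auto simp: certified_def)
  then have "4 / k < outcome k (agree {..<j} s)"
    using assms(1) by (simp add: certified_def field_simps)
  then show ?thesis
    using outcome_stable[OF k assms(2) _ depends_on_agree[of "{..<j}" s]] assms(1)
    by (simp add: certified_def)
qed

text \<open>
  The empty prefix has probability \<open>1\<close>, and \<open>5\<close> is the first stage with \<open>4 < k\<close>.
\<close>

lemma certified_start: "certified 0 s 5"
proof -
  have "outcome 5 (agree {..<0} s) = 1"
    unfolding outcome_def agree_def using avg_const[OF finite_vars] expect_const
    by (simp add: expect_const[abs_def] fun_eq_iff)
  then show ?thesis by (simp add: certified_def)
qed

text \<open>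
  At every later stage some value of variable \<open>j\<close> gets at least the fraction \<open>1 / card (Rp j)\<close> of
  the probability \<open>2 / k\<close>; at a late enough stage this is more than \<open>4 / k'\<close>.
\<close>

lemma certified_extend:
  assumes "certified j s k"
  shows "\<exists>y k'. certified (Suc j) (s(j := y)) k'"
proof -
  have k: "0 < k" using assms by (cases k) (auto simp: certified_def)
  define r where "r = card (Rp j)"
  have r: "0 < r" using ex_good finite_Rp by (auto simp: r_def card_gt_0_iff good_def)
  define k' where "k' = 2 * k * r + j + k + 1"
  have "outcome k' (agree {..<j} s) \<le> (\<Sum>y\<in>Rp j. outcome k' (agree {..<Suc j} (s(j := y))))"
  proof -
    have "outcome k' (agree {..<j} s) \<le> avg (vars k') (expect (E (level k')) (steps k')
        (\<lambda>_ v. \<Sum>y\<in>Rp j. of_bool (agree {..<Suc j} (s(j := y)) v))) (SOME v. good v)"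
      unfolding outcome_def
    proof (intro avg_mono expect_mono finite_vars some_good)
      fix v' assume v': "good v'"
      show "of_bool (agree {..<j} s v') \<le> (\<Sum>y\<in>Rp j. of_bool (agree {..<Suc j} (s(j := y)) v') :: real)"
      proof (cases "agree {..<j} s v'")
        case True
        then have "agree {..<Suc j} (s(j := v' j)) v'" by (auto simp: agree_def less_Suc_eq)
        then have "1 \<le> (\<Sum>y\<in>{v' j}. of_bool (agree {..<Suc j} (s(j := y)) v') :: real)" by simp
        also have "\<dots> \<le> (\<Sum>y\<in>Rp j. of_bool (agree {..<Suc j} (s(j := y)) v'))"
          by (rule sum_mono2) (use v' finite_Rp in \<open>auto simp: good_def\<close>)
        finally show ?thesis by (simp add: True)
      qed (simp add: sum_nonneg)
    qed
    then show ?thesis unfolding outcome_def by (subst (asm) expect_sum_avg[OF finite_vars finite_Rp])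
  qed
  then have sum: "2 / k < (\<Sum>y\<in>Rp j. outcome k' (agree {..<Suc j} (s(j := y))))"
    using certified_later[OF assms, of k'] by (simp add: k'_def)
  have "\<exists>y\<in>Rp j. 2 / (k * r) < outcome k' (agree {..<Suc j} (s(j := y)))"
  proof (rule ccontr)
    assume "\<not> ?thesis"
    then have "(\<Sum>y\<in>Rp j. outcome k' (agree {..<Suc j} (s(j := y)))) \<le> (\<Sum>y\<in>Rp j. 2 / (k * r))"
      by (intro sum_mono) (auto simp: not_less)
    also have "\<dots> = 2 / k" using r by (simp add: r_def)
    finally show False using sum by simp
  qed
  then obtain y where "2 / (k * r) < outcome k' (agree {..<Suc j} (s(j := y)))" by blast
  then have "k' * (2 / (k * r)) < k' * outcome k' (agree {..<Suc j} (s(j := y)))"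
    by (rule mult_strict_left_mono) (simp only: of_nat_0_less_iff, simp add: k'_def)
  moreover have "4 \<le> k' * (2 / (k * r))"
  proof -
    have "2 * (real k * real r) \<le> real k'" unfolding k'_def by simp
    then show ?thesis using k r by (simp add: field_simps)
  qed
  ultimately have "certified (Suc j) (s(j := y)) k'" by (simp add: certified_def k'_def)
  then show ?thesis by blast
qed

text \<open>
  At a late stage the process is unfinished with probability less than that of the prefix \<open>s\<close>. So some
  finished run ends with \<open>s\<close>, and in its final valuation all events of the stage are false.
\<close>

lemma certified_sound:
  assumes "certified j s k"
  shows "i < j \<Longrightarrow> s i \<in> Rp i" and "vbl a \<subseteq> {..<j} \<Longrightarrow> \<not> bad a s"
proof -
  define k' where "k' = k + a"
  have k: "0 < k" using assms by (cases k) (auto simp: certified_def)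
  have "unfinished k' < outcome k' (agree {..<j} s)"
  proof -
    have "unfinished k' \<le> 1 / k'" using unfinished_le[of k'] k by (simp add: k'_def)
    also have "\<dots> \<le> 1 / k" using k by (simp add: k'_def field_simps)
    also have "\<dots> \<le> 2 / k" by (simp add: divide_right_mono)
    also have "\<dots> < outcome k' (agree {..<j} s)" by (rule certified_later[OF assms]) (simp add: k'_def)
    finally show ?thesis .
  qed
  have "\<exists>v. good v \<and> pick (E (level k')) v = None \<and> agree {..<j} s v"
  proof (rule ccontr)
    assume no: "\<nexists>v. good v \<and> pick (E (level k')) v = None \<and> agree {..<j} s v"
    have "outcome k' (agree {..<j} s) \<le> unfinished k'"
      unfolding outcome_def unfinished_def
    proof (intro avg_mono expect_mono finite_vars some_good)
      fix l v' assume v': "good v'" "length l < steps k' \<Longrightarrow> pick (E (level k')) v' = None"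
      show "of_bool (agree {..<j} s v') \<le> (of_bool (steps k' \<le> length l) :: real)"
        using no v' by (cases "steps k' \<le> length l") auto
    qed
    then show False using \<open>unfinished k' < _\<close> by simp
  qed
  then obtain v where v: "good v" "pick (E (level k')) v = None" "agree {..<j} s v" by blast
  show "s i \<in> Rp i" if "i < j" using v(1,3) that by (simp add: good_def agree_def)
  have "a \<in> E (level k')" using self_E[of a] E_mono[of "Suc a" "level k'"] level_ge[of k'] by (auto simp: k'_def)
  then have "\<not> bad a v" using v(2) by (simp add: pick_None)
  then show "\<not> bad a s" if "vbl a \<subseteq> {..<j}"
    using depends_onD[OF bad_vbl agree_mono[OF v(3) that]] by simp
qed

end

section \<open>Uniform tapes\<close>

lemma sum_lessThan_mult:
  fixes f :: "nat \<Rightarrow> 'b :: comm_monoid_add"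
  shows "(\<Sum>r<a * b. f r) = (\<Sum>j<b. \<Sum>i<a. f (i + a * j))"
proof (induction b)
  case (Suc b)
  have "{..<a * Suc b} = {..<a * b} \<union> {a * b..<a * b + a}" by auto
  then have "(\<Sum>r<a * Suc b. f r) = (\<Sum>r<a * b. f r) + (\<Sum>r=a * b..<a * b + a. f r)"
    by (simp add: sum.union_disjoint ivl_disj_int)
  also have "(\<Sum>r=a * b..<a * b + a. f r) = (\<Sum>i<a. f (i + a * b))"
    using sum.shift_bounds_nat_ivl[of f 0 "a * b" a] by (simp add: add.commute atLeast0LessThan)
  finally show ?case using Suc by simp
qed simp

text \<open>
  The quantile function of the distribution with multiplicities \<open>N\<close>, for a uniform \<open>j\<close> below their
  sum. The alternative \<open>u \<le> y\<close> makes it total.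
\<close>

definition choose_value :: "(nat \<Rightarrow> nat) \<Rightarrow> nat \<Rightarrow> nat \<Rightarrow> nat" where
  "choose_value N u j = (LEAST y. u \<le> y \<or> j < (\<Sum>i<Suc y. N i))"

lemma choose_value_eq:
  assumes "y < u" "(\<Sum>i<y. N i) \<le> j" "j < (\<Sum>i<y. N i) + N y"
  shows "choose_value N u j = y"
  unfolding choose_value_def
proof (rule Least_equality)
  fix y' assume y': "u \<le> y' \<or> j < (\<Sum>i<Suc y'. N i)"
  show "y \<le> y'"
  proof (rule ccontr)
    assume "\<not> y \<le> y'"
    then have "(\<Sum>i<Suc y'. N i) \<le> (\<Sum>i<y. N i)" by (intro sum_mono2) auto
    then show False using y' assms \<open>\<not> y \<le> y'\<close> by linarith
  qed
qed (use assms in simp)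

lemma sum_choose_value:
  fixes g :: "nat \<Rightarrow> real"
  shows "(\<Sum>j<(\<Sum>y<u. N y). g (choose_value N u j)) = (\<Sum>y<u. real (N y) * g y)"
proof -
  have "t \<le> u \<Longrightarrow> (\<Sum>j<(\<Sum>y<t. N y). g (choose_value N u j)) = (\<Sum>y<t. real (N y) * g y)" for t
  proof (induction t)
    case (Suc t)
    define a where "a = (\<Sum>y<t. N y)"
    have "{..<a + N t} = {..<a} \<union> {a..<a + N t}" by auto
    then have "(\<Sum>j<a + N t. g (choose_value N u j)) =
        (\<Sum>j<a. g (choose_value N u j)) + (\<Sum>j=a..<a + N t. g (choose_value N u j))"
      by (simp add: sum.union_disjoint ivl_disj_int)
    also have "(\<Sum>j=a..<a + N t. g (choose_value N u j)) = (\<Sum>j=a..<a + N t. g t)"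
      by (rule sum.cong) (use Suc.prems choose_value_eq[of t u N] in \<open>auto simp: a_def\<close>)
    finally show ?case using Suc by (simp add: a_def)
  qed simp
  then show ?thesis by blast
qed

text \<open>
  The \<open>i\<close>-th digit of \<open>r\<close> to the base \<open>d\<close> decides the value of variable \<open>i\<close>. A uniform number
  \<open>r < d ^ K\<close> thus yields independent values for the variables below \<open>K\<close>.
\<close>

definition sample :: "(nat \<Rightarrow> nat \<Rightarrow> nat) \<Rightarrow> nat \<Rightarrow> nat \<Rightarrow> nat \<Rightarrow> nat \<Rightarrow> nat" where
  "sample N u d r x = choose_value (N x) u (r div d ^ x mod d)"

lemma sample_low:
  assumes "x < K" "0 < d" shows "sample N u d (i + d ^ K * j) x = sample N u d i x"
proof -
  have "d ^ K = d ^ x * d * d ^ (K - Suc x)"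
    using assms by (metis Suc_leI le_add_diff_inverse mult.commute power_Suc power_add)
  then have eq: "i + d ^ K * j = i + d ^ x * (d * (d ^ (K - Suc x) * j))" by simp
  have "d ^ x \<noteq> 0" using assms(2) by simp
  from div_mult_self2[OF this, of i "d * (d ^ (K - Suc x) * j)"]
  have "(i + d ^ K * j) div d ^ x = i div d ^ x + d * (d ^ (K - Suc x) * j)"
    unfolding eq by (simp only: add.commute)
  then show ?thesis by (simp add: sample_def)
qed

text \<open>
  All weights of the variables below \<open>K\<close> are multiples of \<open>1 / d\<close>, and all their values are below
  \<open>u\<close>.
\<close>

locale uniform_sampling = product_weights +
  fixes N :: "nat \<Rightarrow> nat \<Rightarrow> nat" and u d K :: nat
  assumes d: "0 < d"
    and N_sum: "x < K \<Longrightarrow> (\<Sum>y<u. N x y) = d"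
    and N_w: "x < K \<Longrightarrow> real (N x y) = d * w x y"
    and Rp_u: "x < K \<Longrightarrow> Rp x \<subseteq> {..<u}"
    and w_outside: "y \<notin> Rp x \<Longrightarrow> w x y = 0"
begin

lemma sum_digit:
  fixes g :: "nat \<Rightarrow> real"
  assumes "x < K"
  shows "(\<Sum>j<d. g (choose_value (N x) u j)) = d * (\<Sum>y\<in>Rp x. w x y * g y)"
proof -
  have "(\<Sum>j<d. g (choose_value (N x) u j)) = (\<Sum>y<u. d * (w x y * g y))"
    using sum_choose_value[of g "N x" u] N_sum[OF assms] N_w[OF assms] by (simp add: mult.assoc)
  also have "\<dots> = (\<Sum>y\<in>Rp x. d * (w x y * g y))"
    by (rule sum.mono_neutral_right) (use Rp_u[OF assms] w_outside in auto)
  finally show ?thesis by (simp add: sum_distrib_left)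
qed

lemma sum_sample:
  assumes "k \<le> K"
  shows "(\<Sum>r<d ^ k. f (override_on v (sample N u d r) {..<k})) = d ^ k * avg {..<k} f v"
  using assms
proof (induction k arbitrary: v)
  case 0
  then show ?case by simp
next
  case (Suc k)
  have k: "k < K" using Suc.prems by simp
  have ov: "override_on v (sample N u d (i + d ^ k * j)) {..<Suc k} =
      override_on (v(k := choose_value (N k) u j)) (sample N u d i) {..<k}" if "i < d ^ k" "j < d" for i j
  proof
    fix x
    show "override_on v (sample N u d (i + d ^ k * j)) {..<Suc k} x =
      override_on (v(k := choose_value (N k) u j)) (sample N u d i) {..<k} x"
      using sample_low[of x k d N u i j] d that
      by (auto simp: override_on_def less_Suc_eq sample_def div_mult_self2)
  qed
  have "(\<Sum>r<d ^ Suc k. f (override_on v (sample N u d r) {..<Suc k})) =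
      (\<Sum>j<d. \<Sum>i<d ^ k. f (override_on v (sample N u d (i + d ^ k * j)) {..<Suc k}))"
    using sum_lessThan_mult[of _ "d ^ k" d] by (simp add: mult.commute)
  also have "\<dots> = (\<Sum>j<d. \<Sum>i<d ^ k. f (override_on (v(k := choose_value (N k) u j)) (sample N u d i) {..<k}))"
    by (intro sum.cong refl) (simp add: ov)
  also have "\<dots> = (\<Sum>j<d. d ^ k * avg {..<k} f (v(k := choose_value (N k) u j)))"
    using Suc.IH k by simp
  also have "\<dots> = d * (\<Sum>y\<in>Rp k. w k y * (d ^ k * avg {..<k} f (v(k := y))))"
    using sum_digit[OF k, of "\<lambda>y. d ^ k * avg {..<k} f (v(k := y))"] by simp
  also have "\<dots> = d ^ Suc k * avg {..<Suc k} f v"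
    by (simp add: lessThan_Suc avg_insert avg1_def sum_distrib_left mult_ac)
  finally show ?case .
qed

end

context resampling
begin

lemma expect_halted: "pick F v = None \<Longrightarrow> expect F n \<phi> v = \<phi> [] v"
  by (cases n) auto

definition tape_step :: "nat set \<Rightarrow> (nat \<Rightarrow> nat \<Rightarrow> nat) \<Rightarrow> nat \<Rightarrow> nat \<Rightarrow> (nat \<Rightarrow> nat) \<Rightarrow> nat \<Rightarrow> nat \<Rightarrow> nat" where
  "tape_step F N u d v r = (case pick F v of None \<Rightarrow> v | Some a \<Rightarrow> override_on v (sample N u d r) (rsp a))"

text \<open>
  A step of the process consumes a block of \<open>K\<close> digits, one for each variable, even though only the
  resample variables of the picked event use theirs.
\<close>

primrec tape_run :: "nat set \<Rightarrow> (nat \<Rightarrow> nat \<Rightarrow> nat) \<Rightarrow> nat \<Rightarrow> nat \<Rightarrow> nat \<Rightarrow> nat \<Rightarrow> (nat \<Rightarrow> nat) \<Rightarrow> nat \<Rightarrow> nat \<Rightarrow> nat" where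
  "tape_run F N u d K 0 v r = v"
| "tape_run F N u d K (Suc n) v r = tape_run F N u d K n (tape_step F N u d v r) (r div d ^ K)"

lemma sum_tape_run:
  assumes "uniform_sampling Rp w N u d K" "\<And>a. a \<in> F \<Longrightarrow> rsp a \<subseteq> {..<K}" "finite F"
  shows "(\<Sum>r<(d ^ K) ^ n. g (tape_run F N u d K n v r)) = real ((d ^ K) ^ n) * expect F n (\<lambda>_. g) v"
proof (induction n arbitrary: v)
  case 0
  then show ?case by simp
next
  case (Suc n)
  interpret uniform_sampling Rp w N u d K by fact
  have step: "tape_step F N u d v (i + d ^ K * j) = tape_step F N u d v i" for i j v
  proof (cases "pick F v")
    case (Some a)
    then have "rsp a \<subseteq> {..<K}" using assms(2,3) by (simp add: pick_Some)
    then have "sample N u d (i + d ^ K * j) x = sample N u d i x" if "x \<in> rsp a" for x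
      using that by (intro sample_low d) auto
    then show ?thesis by (simp add: tape_step_def Some override_on_def fun_eq_iff)
  qed (simp add: tape_step_def)
  have "(\<Sum>r<(d ^ K) ^ Suc n. g (tape_run F N u d K (Suc n) v r)) =
      (\<Sum>j<(d ^ K) ^ n. \<Sum>i<d ^ K. g (tape_run F N u d K n (tape_step F N u d v i) j))"
    using sum_lessThan_mult[of "\<lambda>r. g (tape_run F N u d K (Suc n) v r)" "d ^ K" "(d ^ K) ^ n"] d
    by (simp add: step)
  also have "\<dots> = (\<Sum>i<d ^ K. \<Sum>j<(d ^ K) ^ n. g (tape_run F N u d K n (tape_step F N u d v i) j))"
    by (rule sum.swap)
  also have "\<dots> = real ((d ^ K) ^ n) * (\<Sum>i<d ^ K. expect F n (\<lambda>_. g) (tape_step F N u d v i))"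
    by (simp only: Suc sum_distrib_left)
  also have "(\<Sum>i<d ^ K. expect F n (\<lambda>_. g) (tape_step F N u d v i)) = real (d ^ K) * expect F (Suc n) (\<lambda>_. g) v"
  proof (cases "pick F v")
    case None
    then show ?thesis by (simp add: tape_step_def expect_halted)
  next
    case (Some a)
    then have a: "rsp a \<subseteq> {..<K}" using assms(2,3) by (simp add: pick_Some)
    define f where "f = expect F n (\<lambda>_. g)"
    define f' where "f' = (\<lambda>v'. f (override_on v v' (rsp a)))"
    have dep: "depends_on (rsp a) f'"
      unfolding depends_on_def f'_def agree_def
      by (intro allI impI arg_cong[where f = f]) (auto simp: override_on_def fun_eq_iff)
    have "(\<Sum>i<d ^ K. expect F n (\<lambda>_. g) (tape_step F N u d v i)) =
        (\<Sum>i<d ^ K. f' (override_on v (sample N u d i) {..<K}))"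
    proof (rule sum.cong[OF refl])
      fix i
      have "override_on v (sample N u d i) (rsp a) = override_on v (override_on v (sample N u d i) {..<K}) (rsp a)"
        using a by (auto simp: override_on_def fun_eq_iff)
      then show "expect F n (\<lambda>_. g) (tape_step F N u d v i) = f' (override_on v (sample N u d i) {..<K})"
        by (simp add: tape_step_def Some f_def f'_def)
    qed
    also have "\<dots> = d ^ K * avg {..<K} f' v" by (rule sum_sample) simp
    also have "avg {..<K} f' v = avg (rsp a) (avg ({..<K} - rsp a) f') v"
      using avg_union[OF finite_rsp[of a], of "{..<K} - rsp a" f'] a by (simp add: Un_absorb1)
    also have "avg ({..<K} - rsp a) f' = f'"
      by (rule ext, rule avg_indep) (auto intro: depends_on_mono[OF dep])
    also have "avg (rsp a) f' v = avg (rsp a) f v"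
    proof (rule avg_cong[OF finite_rsp])
      fix v' assume "agree (- rsp a) v' v"
      then have "override_on v v' (rsp a) = v'" by (auto simp: override_on_def agree_def fun_eq_iff)
      then show "f' v' = f v'" by (simp add: f'_def)
    qed
    finally show ?thesis by (simp add: Some f_def)
  qed
  finally show ?case by simp
qed

text \<open>
  Probabilities are turned into cardinalities: a tape is a single number, and the one block more than
  there are steps provides the initial valuation.
\<close>

lemma card_tape_run:
  assumes "uniform_sampling Rp w N u d K" "\<And>a. a \<in> F \<Longrightarrow> rsp a \<subseteq> {..<K}" "finite F"
  shows "real (card {r. r < (d ^ K) ^ Suc n \<and>
      T (tape_run F N u d K n (override_on v (sample N u d r) {..<K}) (r div d ^ K))}) =
    real ((d ^ K) ^ Suc n) * avg {..<K} (expect F n (\<lambda>_ v. of_bool (T v))) v"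
proof -
  interpret uniform_sampling Rp w N u d K by fact
  define S where "S r = T (tape_run F N u d K n (override_on v (sample N u d r) {..<K}) (r div d ^ K))" for r
  have "override_on v (sample N u d (i + d ^ K * j)) {..<K} = override_on v (sample N u d i) {..<K}" for i j
    using sample_low[OF _ d] by (auto simp: override_on_def fun_eq_iff)
  then have S: "S (i + d ^ K * j) = T (tape_run F N u d K n (override_on v (sample N u d i) {..<K}) j)"
    if "i < d ^ K" for i j
    using that d by (simp add: S_def)
  have "real (card {r. r < (d ^ K) ^ Suc n \<and> S r}) = (\<Sum>r<(d ^ K) ^ Suc n. of_bool (S r))"
    by (simp add: sum_of_bool_eq Int_def)
  also have "\<dots> = (\<Sum>j<(d ^ K) ^ n. \<Sum>i<d ^ K. of_bool (S (i + d ^ K * j)))"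
    using sum_lessThan_mult[of "\<lambda>r. of_bool (S r) :: real" "d ^ K" "(d ^ K) ^ n"] by simp
  also have "\<dots> = (\<Sum>i<d ^ K. \<Sum>j<(d ^ K) ^ n.
      of_bool (T (tape_run F N u d K n (override_on v (sample N u d i) {..<K}) j)))"
    by (subst sum.swap) (intro sum.cong refl, simp add: S)
  also have "\<dots> = (\<Sum>i<d ^ K. real ((d ^ K) ^ n) *
      expect F n (\<lambda>_ v. of_bool (T v)) (override_on v (sample N u d i) {..<K}))"
    using sum_tape_run[OF assms, of "\<lambda>v. of_bool (T v)"] by simp
  also have "\<dots> = real ((d ^ K) ^ n) * (d ^ K * avg {..<K} (expect F n (\<lambda>_ v. of_bool (T v))) v)"
    by (simp only: sum_distrib_left[symmetric] sum_sample[OF order_refl])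
  finally show ?thesis by (simp add: S_def mult_ac)
qed

end

section \<open>Computing certified prefixes\<close>

lemma decidable_comp2:
  assumes "decidable (\<lambda>m. P (pfst m) (psnd m))" "computable f" "computable g"
  shows "decidable (\<lambda>n. P (f n) (g n))"
  using computable_comp2[of "\<lambda>a b. of_bool (P a b)" f g] assms by (simp add: decidable_def)

lemma decidable_comp3:
  assumes "decidable (\<lambda>m. P (pfst m) (pfst (psnd m)) (psnd (psnd m)))"
    "computable f" "computable g" "computable h"
  shows "decidable (\<lambda>n. P (f n) (g n) (h n))"
  using computable_comp3[of "\<lambda>a b c. of_bool (P a b c)" f g h] assms by (simp add: decidable_def)

text \<open>
  Codes for the data of the process: variable sets, resample sets, true assignments, stages, and
  numerators and denominators of the weights.
\<close>

locale coded_resampling = staged_resampling +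
  fixes vc rc tc e :: "nat \<Rightarrow> nat" and pn pd :: "nat \<Rightarrow> nat \<Rightarrow> nat"
  assumes vc: "vbl a = set_decode (vc a)" "computable vc"
    and rc: "rsp a = set_decode (rc a)" "computable rc"
    and tc: "bad a v \<longleftrightarrow> assignment_code (vbl a) v \<in> set_decode (tc a)" "computable tc"
    and e: "E k = set_decode (e k)" "computable e"
    and lt_decidable: "decidable (\<lambda>n. lt (pfst n) (psnd n))"
    and w_fraction: "w i y = pn i y / pd i y" "0 < pd i y"
    and pn: "computable (\<lambda>n. pn (pfst n) (psnd n))"
    and pd: "computable (\<lambda>n. pd (pfst n) (psnd n))"
    and support: "y \<in> Rp i \<longleftrightarrow> 0 < w i y"
begin

lemmas code_intros =
  computable.comp[OF vc(2)] computable.comp[OF rc(2)] computable.comp[OF tc(2)] computable.comp[OF e(2)]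
  computable_comp2[OF pn] computable_comp2[OF pd] decidable_comp2[OF lt_decidable] computable_look

definition level_code :: "nat \<Rightarrow> nat" where
  "level_code k = e (Suc k + m * (k * C * e (Suc k)))"

definition step_count :: "nat \<Rightarrow> nat" where
  "step_count k = k * C * level_code k"

lemma level_code: "set_decode (level_code k) = E (level k)"
  using e(1) by (simp add: level_code_def level_def)

lemma step_count: "step_count k = steps k"
  using e(1) by (simp add: step_count_def steps_def level_code_def level_def)

lemma computable_level_code: "computable f \<Longrightarrow> computable (\<lambda>n. level_code (f n))"
  unfolding level_code_def by (intro computable_intros code_intros)

lemma computable_step_count: "computable f \<Longrightarrow> computable (\<lambda>n. step_count (f n))"
  unfolding step_count_def by (intro computable_intros computable_level_code)

text \<open>
  The number of digits below \<open>d\<close> that yield the value \<open>y\<close>.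
\<close>

definition mult_of :: "nat \<Rightarrow> nat \<Rightarrow> nat \<Rightarrow> nat" where
  "mult_of d i y = d div pd i y * pn i y"

lemma computable_mult_of:
  "computable f \<Longrightarrow> computable g \<Longrightarrow> computable h \<Longrightarrow> computable (\<lambda>n. mult_of (f n) (g n) (h n))"
  unfolding mult_of_def by (intro computable_intros code_intros)

text \<open>
  Requirements on the number \<open>K\<close> of variables, the base \<open>d\<close> and the bound \<open>u\<close> on values. The
  positive weights are not assumed to be listed; that \<open>u\<close> exceeds all possible values is
  recognised from the multiplicities below \<open>u\<close> adding up to \<open>d\<close>.
\<close>

definition suitable :: "nat \<Rightarrow> nat \<Rightarrow> nat \<Rightarrow> nat \<Rightarrow> bool" where
  "suitable k K d u \<longleftrightarrow> k \<le> K \<and> (\<forall>a\<in>set_decode (level_code k). vc a \<le> K) \<and> 0 < d \<and>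
     (\<forall>i<K. (\<forall>y<u. pd i y dvd d) \<and> (\<Sum>y<u. mult_of d i y) = d)"

definition params :: "nat \<Rightarrow> nat" where
  "params k = (LEAST t. suitable k (pfst t) (pfst (psnd t)) (psnd (psnd t)))"

lemma w_mult_of: "pd i y dvd d \<or> w i y = 0 \<Longrightarrow> real (mult_of d i y) = d * w i y"
  using w_fraction[of i y] by (auto simp: mult_of_def real_of_nat_div)

lemma w_outside: "y \<notin> Rp i \<Longrightarrow> w i y = 0"
  using w_nonneg[of i y] support[of y i] by simp

lemma ex_suitable: "\<exists>K d u. suitable k K d u"
proof -
  define K where "K = k + (\<Sum>a\<in>set_decode (level_code k). vc a)"
  have "finite (\<Union>i<K. Rp i)" by (simp add: finite_Rp)
  then obtain u where u: "(\<Union>i<K. Rp i) \<subseteq> {..<u}" using finite_nat_iff_bounded by blast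
  define d where "d = (\<Prod>i<K. \<Prod>y<u. pd i y)"
  have "pd i y dvd d" if "i < K" "y < u" for i y
  proof -
    have "pd i y dvd (\<Prod>y<u. pd i y)" by (rule dvd_prodI) (use that in auto)
    also have "\<dots> dvd d" unfolding d_def by (rule dvd_prodI) (use that in auto)
    finally show ?thesis .
  qed
  moreover have "(\<Sum>y<u. mult_of d i y) = d" if "i < K" for i
  proof -
    have "real (\<Sum>y<u. mult_of d i y) = (\<Sum>y<u. d * w i y)"
      using calculation[OF that] by (simp add: w_mult_of)
    also have "\<dots> = (\<Sum>y\<in>Rp i. d * w i y)"
      by (rule sum.mono_neutral_right) (use u that w_outside in auto)
    also have "\<dots> = real d" by (simp add: sum_distrib_left[symmetric] w_sum)
    finally show ?thesis by linarith
  qed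
  moreover have "0 < d" using w_fraction by (simp add: d_def prod_pos)
  moreover have "vc a \<le> K" if "a \<in> set_decode (level_code k)" for a
    using member_le_sum[OF that, of vc] by (simp add: K_def)
  moreover have "k \<le> K" by (simp add: K_def)
  ultimately have "suitable k K d u" unfolding suitable_def by blast
  then show ?thesis by blast
qed

definition width :: "nat \<Rightarrow> nat" where "width k = pfst (params k)"
definition denom :: "nat \<Rightarrow> nat" where "denom k = pfst (psnd (params k))"
definition vbound :: "nat \<Rightarrow> nat" where "vbound k = psnd (psnd (params k))"

lemma suitable_params: "suitable k (width k) (denom k) (vbound k)"
proof -
  obtain K d u where "suitable k K d u" using ex_suitable by blast
  then have "\<exists>t. suitable k (pfst t) (pfst (psnd t)) (psnd (psnd t))"
    by (intro exI[of _ "prod_encode (K, prod_encode (d, u))"]) simp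
  then show ?thesis unfolding width_def denom_def vbound_def params_def by (rule LeastI_ex)
qed

lemma computable_params: "computable params"
  unfolding params_def
proof (rule computable_Least)
  show "decidable (\<lambda>m. suitable (pfst m) (pfst (psnd m)) (pfst (psnd (psnd m))) (psnd (psnd (psnd m))))"
    unfolding suitable_def
    by (intro computable_intros code_intros computable_level_code computable_mult_of)
  show "\<exists>t. suitable k (pfst t) (pfst (psnd t)) (psnd (psnd t))" for k
    using suitable_params unfolding width_def denom_def vbound_def by blast
qed

lemma computable_width: "computable f \<Longrightarrow> computable (\<lambda>n. width (f n))"
  and computable_denom: "computable f \<Longrightarrow> computable (\<lambda>n. denom (f n))"
  and computable_vbound: "computable f \<Longrightarrow> computable (\<lambda>n. vbound (f n))"
  unfolding width_def denom_def vbound_def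
  by (intro computable_intros computable.comp[OF computable_params] | assumption)+

abbreviation level_mult :: "nat \<Rightarrow> nat \<Rightarrow> nat \<Rightarrow> nat" where
  "level_mult k \<equiv> mult_of (denom k)"

lemma sampling: "uniform_sampling Rp w (level_mult k) (vbound k) (denom k) (width k)"
proof -
  define d where "d = denom k"
  define u where "u = vbound k"
  have s: "suitable k (width k) d u" using suitable_params by (simp add: d_def u_def)
  then have d: "0 < d" by (simp add: suitable_def)
  have Rp: "Rp i \<subseteq> {..<u}" if "i < width k" for i
  proof -
    have dv: "\<forall>y<u. pd i y dvd d" "(\<Sum>y<u. mult_of d i y) = d" using s that by (auto simp: suitable_def)
    have "real d * (\<Sum>y<u. w i y) = (\<Sum>y<u. real (mult_of d i y))"
      using dv(1) by (simp add: w_mult_of sum_distrib_left)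
    also have "\<dots> = real d" using dv(2) by (metis of_nat_sum)
    finally have "(\<Sum>y<u. w i y) = 1" using d by simp
    moreover have "(\<Sum>y<u. w i y) = (\<Sum>y\<in>Rp i \<inter> {..<u}. w i y)"
      by (rule sum.mono_neutral_right) (use w_outside in auto)
    moreover have "(\<Sum>y\<in>Rp i. w i y) = (\<Sum>y\<in>Rp i \<inter> {..<u}. w i y) + (\<Sum>y\<in>Rp i - {..<u}. w i y)"
      using sum.Int_Diff[OF finite_Rp] by blast
    ultimately have "(\<Sum>y\<in>Rp i - {..<u}. w i y) = 0" using w_sum[of i] by simp
    then have "\<forall>y\<in>Rp i - {..<u}. w i y = 0"
      using sum_nonneg_eq_0_iff[of "Rp i - {..<u}" "w i"] finite_Rp w_nonneg by blast
    then show ?thesis using support by force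
  qed
  have N: "real (mult_of d i y) = d * w i y" if "i < width k" for i y
  proof (cases "y < u")
    case True
    then show ?thesis using s that by (intro w_mult_of) (simp add: suitable_def)
  next
    case False
    then show ?thesis using Rp[OF that] w_outside by (intro w_mult_of) auto
  qed
  show ?thesis
    unfolding d_def[symmetric] u_def[symmetric]
    by unfold_locales (use s d Rp N w_outside in \<open>auto simp: suitable_def\<close>)
qed

text \<open>
  The sum is the code of the graph of \<open>look c\<close> on the variables of the event, in the format of
  \<open>assignment_code\<close>.
\<close>

definition bad_code :: "nat \<Rightarrow> nat \<Rightarrow> bool" where
  "bad_code a c \<longleftrightarrow> (\<Sum>i<vc a. of_bool (i \<in> set_decode (vc a)) * 2 ^ prod_encode (i, look c i)) \<in> set_decode (tc a)"

lemma decidable_bad_code: "computable f \<Longrightarrow> computable g \<Longrightarrow> decidable (\<lambda>n. bad_code (f n) (g n))"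
proof -
  have "decidable (\<lambda>m. bad_code (pfst m) (psnd m))"
    unfolding bad_code_def by (intro computable_intros code_intros)
  then show "computable f \<Longrightarrow> computable g \<Longrightarrow> ?thesis" by (rule decidable_comp2)
qed

lemma bad_code:
  assumes "agree (vbl a) (look c) v"
  shows "bad_code a c \<longleftrightarrow> bad a v"
proof -
  have "assignment_code (vbl a) v = (\<Sum>i\<in>vbl a. 2 ^ prod_encode (i, v i))"
    unfolding assignment_code_def set_encode_def
    by (subst sum.reindex) (auto simp: inj_on_def)
  also have "\<dots> = (\<Sum>i\<in>vbl a. 2 ^ prod_encode (i, look c i))"
    by (rule sum.cong) (use assms in \<open>auto simp: agree_def\<close>)
  also have "\<dots> = (\<Sum>i\<in>vbl a. of_bool (i \<in> set_decode (vc a)) * 2 ^ prod_encode (i, look c i))"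
    by (rule sum.cong) (auto simp: vc(1))
  also have "\<dots> = (\<Sum>i<vc a. of_bool (i \<in> set_decode (vc a)) * 2 ^ prod_encode (i, look c i))"
    by (rule sum.mono_neutral_left) (auto simp: vc(1) dest: mem_set_decode_less)
  finally show ?thesis by (simp add: bad_code_def tc(1))
qed

definition sample_code :: "nat \<Rightarrow> nat \<Rightarrow> nat \<Rightarrow> nat" where
  "sample_code k r i = sample (level_mult k) (vbound k) (denom k) r i"

lemma computable_sample_code:
  "computable f \<Longrightarrow> computable g \<Longrightarrow> computable h \<Longrightarrow> computable (\<lambda>n. sample_code (f n) (g n) (h n))"
proof -
  have "computable (\<lambda>m. sample_code (pfst m) (pfst (psnd m)) (psnd (psnd m)))"
    unfolding sample_code_def sample_def choose_value_def
    by (rule computable_Least)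
      (auto intro!: computable_intros code_intros computable_mult_of computable_denom computable_vbound)
  then show "computable f \<Longrightarrow> computable g \<Longrightarrow> computable h \<Longrightarrow> ?thesis" by (rule computable_comp3)
qed

definition init_code :: "nat \<Rightarrow> nat \<Rightarrow> nat" where
  "init_code k r = (LEAST c. \<forall>i<width k. look c i = sample_code k r i)"

text \<open>
  The successor valuation is specified by its entries below \<open>width k\<close> and found by search.
\<close>

definition step_code :: "nat \<Rightarrow> nat \<Rightarrow> nat \<Rightarrow> nat" where
  "step_code k c r = (LEAST c'. \<forall>i<width k. look c' i =
     (if \<exists>a\<in>set_decode (level_code k). (bad_code a c \<and>
          (\<forall>b\<in>set_decode (level_code k). lt b a \<longrightarrow> \<not> bad_code b c)) \<and> i \<in> set_decode (rc a)
      then sample_code k r i else look c i))"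

lemma computable_init_code:
  "computable f \<Longrightarrow> computable g \<Longrightarrow> computable (\<lambda>n. init_code (f n) (g n))"
proof -
  have "computable (\<lambda>m. init_code (pfst m) (psnd m))"
    unfolding init_code_def
  proof (rule computable_Least)
    show "\<exists>c. \<forall>i<width (pfst n). look c i = sample_code (pfst n) (psnd n) i" for n
      by (rule ex_look)
  qed (intro computable_intros code_intros computable_width computable_sample_code)
  then show "computable f \<Longrightarrow> computable g \<Longrightarrow> ?thesis" by (rule computable_comp2)
qed

lemma computable_step_code:
  "computable f \<Longrightarrow> computable g \<Longrightarrow> computable h \<Longrightarrow> computable (\<lambda>n. step_code (f n) (g n) (h n))"
proof -
  have "computable (\<lambda>m. step_code (pfst m) (pfst (psnd m)) (psnd (psnd m)))"
    unfolding step_code_def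
    by (rule computable_Least[OF _ ex_look])
      (intro computable_intros code_intros computable_width computable_sample_code computable_level_code
        decidable_bad_code)
  then show "computable f \<Longrightarrow> computable g \<Longrightarrow> computable h \<Longrightarrow> ?thesis" by (rule computable_comp3)
qed

lemma init_code: "i < width k \<Longrightarrow> look (init_code k r) i = sample_code k r i"
proof -
  have "\<forall>i<width k. look (init_code k r) i = sample_code k r i"
    unfolding init_code_def by (rule LeastI_ex[OF ex_look])
  then show "i < width k \<Longrightarrow> ?thesis" by blast
qed

lemma vbl_width: "a \<in> E (level k) \<Longrightarrow> vbl a \<subseteq> {..<width k}"
  using suitable_params[of k] unfolding suitable_def level_code vc(1)
  by (auto dest!: mem_set_decode_less)

abbreviation level_step :: "nat \<Rightarrow> (nat \<Rightarrow> nat) \<Rightarrow> nat \<Rightarrow> nat \<Rightarrow> nat" where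
  "level_step k \<equiv> tape_step (E (level k)) (level_mult k) (vbound k) (denom k)"

lemma step_code:
  assumes "agree {..<width k} (look c) v"
  shows "agree {..<width k} (look (step_code k c r)) (level_step k v r)"
proof -
  have bc: "bad_code a c \<longleftrightarrow> bad a v" if "a \<in> E (level k)" for a
    by (rule bad_code[OF agree_mono[OF assms vbl_width[OF that]]])
  have ex: "(\<exists>a\<in>set_decode (level_code k). (bad_code a c \<and>
      (\<forall>b\<in>set_decode (level_code k). lt b a \<longrightarrow> \<not> bad_code b c)) \<and> i \<in> set_decode (rc a)) \<longleftrightarrow>
      (\<exists>a. pick (E (level k)) v = Some a \<and> i \<in> rsp a)" for i
    unfolding pick_Some[OF finite_E] level_code rc(1)[symmetric] using bc by blast
  have "\<forall>i<width k. look (step_code k c r) i =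
     (if \<exists>a\<in>set_decode (level_code k). (bad_code a c \<and>
          (\<forall>b\<in>set_decode (level_code k). lt b a \<longrightarrow> \<not> bad_code b c)) \<and> i \<in> set_decode (rc a)
      then sample_code k r i else look c i)"
    unfolding step_code_def by (rule LeastI_ex[OF ex_look])
  then have "\<forall>i<width k. look (step_code k c r) i =
     (if \<exists>a. pick (E (level k)) v = Some a \<and> i \<in> rsp a then sample_code k r i else look c i)"
    unfolding ex .
  then show ?thesis
    using assms by (auto simp: agree_def tape_step_def override_on_def sample_code_def split: option.split)
qed

definition run_code :: "nat \<Rightarrow> nat \<Rightarrow> nat" where
  "run_code k r = ((\<lambda>s. prod_encode (step_code k (pfst s) (psnd s), psnd s div denom k ^ width k)) ^^ step_count k)
     (prod_encode (init_code k r, r div denom k ^ width k))"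

lemma computable_run_code: "computable f \<Longrightarrow> computable g \<Longrightarrow> computable (\<lambda>n. run_code (f n) (g n))"
proof -
  have "computable (\<lambda>m. run_code (pfst m) (psnd m))"
    unfolding run_code_def
    by (rule computable_funpow)
      (intro computable_intros computable_step_code computable_init_code computable_denom
        computable_width computable_step_count)+
  then show "computable f \<Longrightarrow> computable g \<Longrightarrow> ?thesis" by (rule computable_comp2)
qed

abbreviation level_run :: "nat \<Rightarrow> nat \<Rightarrow> (nat \<Rightarrow> nat) \<Rightarrow> nat \<Rightarrow> nat \<Rightarrow> nat" where
  "level_run k \<equiv> tape_run (E (level k)) (level_mult k) (vbound k) (denom k) (width k)"

lemma run_code:
  "agree {..<width k} (look (pfst (run_code k r)))
    (level_run k (steps k) (override_on v (sample (level_mult k) (vbound k) (denom k) r) {..<width k})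
      (r div denom k ^ width k))"
proof -
  define f where "f = (\<lambda>s. prod_encode (step_code k (pfst s) (psnd s), psnd s div denom k ^ width k))"
  have "agree {..<width k} (look c) v \<Longrightarrow>
      agree {..<width k} (look (pfst ((f ^^ n) (prod_encode (c, r))))) (level_run k n v r)" for n c v r
  proof (induction n arbitrary: c v r)
    case (Suc n)
    have "(f ^^ Suc n) (prod_encode (c, r)) = (f ^^ n) (prod_encode (step_code k c r, r div denom k ^ width k))"
      by (simp only: funpow_Suc_right o_apply) (simp add: f_def)
    then show ?case using Suc.IH[OF step_code[OF Suc.prems]] by simp
  qed simp
  moreover have "agree {..<width k} (look (init_code k r))
      (override_on v (sample (level_mult k) (vbound k) (denom k) r) {..<width k})"
    by (simp add: agree_def init_code sample_code_def override_on_def)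
  ultimately show ?thesis by (simp add: run_code_def f_def step_count)
qed

definition count_code :: "nat \<Rightarrow> nat \<Rightarrow> nat \<Rightarrow> nat" where
  "count_code j s k = (\<Sum>r<(denom k ^ width k) ^ Suc (step_count k).
     of_bool (\<forall>i<j. look s i = look (pfst (run_code k r)) i))"

definition certified_code :: "nat \<Rightarrow> nat \<Rightarrow> nat \<Rightarrow> bool" where
  "certified_code j s k \<longleftrightarrow> j \<le> k \<and> 4 * (denom k ^ width k) ^ Suc (step_count k) < k * count_code j s k"

lemma decidable_certified_code:
  "computable f \<Longrightarrow> computable g \<Longrightarrow> computable h \<Longrightarrow> decidable (\<lambda>n. certified_code (f n) (g n) (h n))"
proof -
  have "decidable (\<lambda>m. certified_code (pfst m) (pfst (psnd m)) (psnd (psnd m)))"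
    unfolding certified_code_def count_code_def
    by (intro computable_intros code_intros computable_denom computable_width computable_step_count
        computable_run_code)
  then show "computable f \<Longrightarrow> computable g \<Longrightarrow> computable h \<Longrightarrow> ?thesis" by (rule decidable_comp3)
qed

lemma certified_code: "certified_code j s k \<longleftrightarrow> certified j (look s) k"
proof (cases "j \<le> k")
  case True
  define D where "D = (denom k ^ width k) ^ Suc (steps k)"
  define v where "v = (SOME v. good v)"
  have kK: "k \<le> width k" "0 < denom k" using suitable_params[of k] by (auto simp: suitable_def)
  have vars: "vars k \<subseteq> {..<width k}" using vbl_width kK by (auto simp: vars_def)
  have dep: "depends_on (vars k) (agree {..<j} (look s))"
    by (rule depends_on_mono[OF depends_on_agree]) (use True in \<open>auto simp: vars_def\<close>)
  have agr: "(\<forall>i<j. look s i = look (pfst (run_code k r)) i) \<longleftrightarrow> agree {..<j} (look s)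
      (level_run k (steps k) (override_on v (sample (level_mult k) (vbound k) (denom k) r) {..<width k})
      (r div denom k ^ width k))" for r
    using run_code[of k r v] True kK by (auto simp: agree_def)
  have "real (count_code j s k) = real (card {r. r < D \<and> agree {..<j} (look s)
      (level_run k (steps k) (override_on v (sample (level_mult k) (vbound k) (denom k) r) {..<width k})
      (r div denom k ^ width k))})"
    unfolding count_code_def agr step_count D_def[symmetric] by (simp add: sum_of_bool_eq Int_def)
  also have "\<dots> = D * avg {..<width k} (expect (E (level k)) (steps k) (\<lambda>_ v. of_bool (agree {..<j} (look s) v))) v"
    unfolding D_def
    by (rule card_tape_run[OF sampling _ finite_E]) (use vbl_width rsp_vbl in blast)
  also have "\<dots> = D * outcome k (agree {..<j} (look s))"
    by (simp only: outcome_eq[OF vars finite_lessThan dep])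
  finally have cnt: "real (count_code j s k) = D * outcome k (agree {..<j} (look s))" .
  have "4 * D < k * count_code j s k \<longleftrightarrow> real (4 * D) < real (k * count_code j s k)"
    by (simp only: of_nat_less_iff)
  also have "\<dots> \<longleftrightarrow> real D * 4 < real D * (k * outcome k (agree {..<j} (look s)))"
    by (simp add: cnt mult_ac)
  also have "\<dots> \<longleftrightarrow> 4 < k * outcome k (agree {..<j} (look s))"
    by (rule mult_less_cancel_left_pos) (simp add: D_def kK)
  finally show ?thesis using True by (simp add: certified_code_def certified_def step_count D_def)
qed (simp add: certified_code_def certified_def)

text \<open>
  Pairs of a coded prefix and a stage that certifies it. The search for the next pair is conditional
  on the present pair being certified: this makes it succeed unconditionally, as totality requires,
  and the condition is always met.
\<close>

primrec prefix_code :: "nat \<Rightarrow> nat" where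
  "prefix_code 0 = prod_encode (0, 5)"
| "prefix_code (Suc j) = (LEAST g.
     certified_code j (pfst (prefix_code j)) (psnd (prefix_code j)) \<longrightarrow>
     certified_code (Suc j) (pfst g) (psnd g) \<and>
     (\<forall>i<j. look (pfst g) i = look (pfst (prefix_code j)) i))"

lemma prefix_code_ex:
  "\<exists>g. certified_code j s k \<longrightarrow> certified_code (Suc j) (pfst g) (psnd g) \<and>
     (\<forall>i<j. look (pfst g) i = look s i)"
proof (cases "certified_code j s k")
  case True
  then obtain y k' where 1: "certified (Suc j) ((look s)(j := y)) k'"
    using certified_extend certified_code by blast
  obtain s' where s': "\<forall>i<Suc j. look s' i = ((look s)(j := y)) i" using ex_look by blast
  have "agree {..<Suc j} (look s') = agree {..<Suc j} ((look s)(j := y))"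
    using s' by (auto simp: agree_def fun_eq_iff)
  then have "certified_code (Suc j) s' k'" using 1 by (simp add: certified_code certified_def)
  then show ?thesis using s' by (intro exI[of _ "prod_encode (s', k')"]) auto
qed simp

lemma prefix_code_Suc:
  "certified_code j (pfst (prefix_code j)) (psnd (prefix_code j)) \<longrightarrow>
     certified_code (Suc j) (pfst (prefix_code (Suc j))) (psnd (prefix_code (Suc j))) \<and>
     (\<forall>i<j. look (pfst (prefix_code (Suc j))) i = look (pfst (prefix_code j)) i)"
  unfolding prefix_code.simps(2) by (rule LeastI_ex[OF prefix_code_ex])

lemma certified_prefix: "certified_code j (pfst (prefix_code j)) (psnd (prefix_code j))"
proof (induction j)
  case 0
  show ?case using certified_start by (simp add: certified_code)
next
  case (Suc j)
  then show ?case using prefix_code_Suc by blast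
qed

lemma computable_prefix_code: "computable prefix_code"
proof -
  define G where "G j r = (LEAST g. certified_code j (pfst r) (psnd r) \<longrightarrow>
     certified_code (Suc j) (pfst g) (psnd g) \<and> (\<forall>i<j. look (pfst g) i = look (pfst r) i))" for j r
  have "computable (\<lambda>m. G (pfst m) (psnd m))"
    unfolding G_def
    by (rule computable_Least[OF _ prefix_code_ex])
      (intro computable_intros code_intros decidable_certified_code)
  then have "computable (\<lambda>m. G (pfst (psnd m)) (psnd (psnd m)))"
    by (rule computable_comp2) (intro computable_intros)+
  then have "computable (\<lambda>n. rec_nat (prod_encode (0, 5)) (\<lambda>j r. G j r) n)"
    using computable_rec[OF computable_const _ computable_id, of "\<lambda>n j r. G j r"] by blast
  moreover have "prefix_code n = rec_nat (prod_encode (0, 5)) (\<lambda>j r. G j r) n" for n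
    by (induction n) (auto simp: G_def)
  then have "prefix_code = (\<lambda>n. rec_nat (prod_encode (0, 5)) (\<lambda>j r. G j r) n)" by (rule ext)
  ultimately show ?thesis by simp
qed

definition solution :: "nat \<Rightarrow> nat" where
  "solution j = look (pfst (prefix_code (Suc j))) j"

lemma prefix_solution: "i < j \<Longrightarrow> look (pfst (prefix_code j)) i = solution i"
proof (induction j)
  case (Suc j)
  then show ?case
    using prefix_code_Suc[of j] certified_prefix[of j] by (cases "i = j") (auto simp: solution_def)
qed simp

lemma certified_solution: "\<exists>k. certified j solution k"
proof -
  have "agree {..<j} (look (pfst (prefix_code j))) = agree {..<j} solution"
    using prefix_solution by (auto simp: agree_def fun_eq_iff)
  then have "certified j solution (psnd (prefix_code j))"
    using certified_prefix[of j] by (simp add: certified_code certified_def)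
  then show ?thesis by blast
qed

lemma computable_solution: "computable solution"
  unfolding solution_def
  by (intro computable_intros computable_look computable.comp[OF computable_prefix_code])

theorem solution_valid: "solution i \<in> Rp i" "\<not> bad a solution"
proof -
  obtain k where "certified (Suc i) solution k" using certified_solution by blast
  then show "solution i \<in> Rp i" using certified_sound(1) by blast
  obtain j where "vbl a \<subseteq> {..<j}" using finite_vbl[of a] finite_nat_iff_bounded by blast
  moreover obtain k' where "certified j solution k'" using certified_solution by blast
  ultimately show "\<not> bad a solution" using certified_sound(2) by blast
qed

end

section \<open>Computable initial segments of the events\<close>

text \<open>
  The rank of an event in a decidable order of type \<open>\<omega>\<close> need not be computable, and so finite initial
  segments cannot simply be listed. They are obtained from the compatibility of the order with the
  neighbour relation.
\<close>

locale coded_order = left_order +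
  fixes vc rc oc :: "nat \<Rightarrow> nat"
  assumes vc: "vbl a = set_decode (vc a)" "computable vc"
    and rc: "rsp a = set_decode (rc a)" "computable rc"
    and oc: "{a. i \<in> rsp a} = set_decode (oc i)" "computable oc"
    and lt_decidable: "decidable (\<lambda>n. lt (pfst n) (psnd n))"
    and finite_below: "finite {a. lt a b}"
begin

definition exhausts :: "(nat \<Rightarrow> nat) \<Rightarrow> bool" where
  "exhausts e \<longleftrightarrow> computable e
    \<and> (\<forall>k. (\<Union>a\<in>set_decode (e k). nb a) \<subseteq> set_decode (e (Suc k)))
    \<and> (\<forall>k. k \<in> set_decode (e (Suc k)))
    \<and> (\<forall>i k a. i < k \<longrightarrow> i \<in> rsp a \<longrightarrow> a \<in> set_decode (e (Suc k)))"

lemma nb_codes: "nb b = insert b (\<Union>i\<in>set_decode (rc b). set_decode (oc i))"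
  unfolding rc(1)[symmetric] oc(1)[symmetric] by (auto simp: Gam_plus_def Gam_def)

lemma decidable_all_nb:
  assumes "decidable (\<lambda>m. P (pfst m) (psnd m))" "computable h"
  shows "decidable (\<lambda>n. \<forall>a\<in>nb (h n). P n a)"
proof -
  have "(\<forall>a\<in>nb (h n). P n a) \<longleftrightarrow>
      P n (h n) \<and> (\<forall>i\<in>set_decode (rc (h n)). \<forall>a\<in>set_decode (oc i). P n a)" for n
    by (auto simp: nb_codes)
  then show ?thesis
    by (simp only:) (intro computable_intros decidable_comp2[OF assms(1)] computable.comp[OF rc(2)]
        computable.comp[OF oc(2)] computable.comp[OF assms(2)] assms(2))
qed

text \<open>
  A decidable property of finite sets that can be attained above every finite set is attained along a
  computable exhausting sequence, by unbounded search.
\<close>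

lemma ex_exhausting:
  assumes Q: "decidable (\<lambda>n. Q (set_decode n))" "\<And>S. finite S \<Longrightarrow> \<exists>F. finite F \<and> S \<subseteq> F \<and> Q F"
  shows "\<exists>e. exhausts e \<and> (\<forall>k. Q (set_decode (e k)))"
proof -
  have Qc: "\<exists>c. S \<subseteq> set_decode c \<and> Q (set_decode c)" if "finite S" for S
    using Q(2)[OF that] by (metis set_encode_inverse)
  obtain c0 where c0: "Q (set_decode c0)" using Qc[of "{}"] by auto
  define ok where "ok k s c \<longleftrightarrow> Q (set_decode c) \<and>
    (\<forall>b\<in>set_decode s. \<forall>a\<in>nb b. a \<in> set_decode c) \<and> k \<in> set_decode c \<and>
    (\<forall>i<k. \<forall>a\<in>set_decode (oc i). a \<in> set_decode c)" for k s c
  have ex: "\<exists>c. ok k s c" for k s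
  proof -
    have "finite ((\<Union>b\<in>set_decode s. nb b) \<union> {k} \<union> (\<Union>i<k. set_decode (oc i)))"
      using finite_Gam by simp
    from Qc[OF this] show ?thesis unfolding ok_def by blast
  qed
  define e where "e = rec_nat c0 (\<lambda>k s. LEAST c. ok k s c)"
  have e: "ok k (e k) (e (Suc k))" for k
    using LeastI_ex[OF ex[of k "e k"]] by (simp add: e_def)
  have dec: "decidable (\<lambda>m. ok (pfst (pfst m)) (psnd (pfst m)) (psnd m))"
    unfolding ok_def
    by (intro computable_intros decidable_all_nb computable.comp[OF oc(2)]
        computable.comp[OF Q(1)[unfolded decidable_def], folded decidable_def])
  have "computable (\<lambda>m. LEAST c. ok (pfst m) (psnd m) c)"
    by (rule computable_Least[OF dec ex])
  then have "computable (\<lambda>m. LEAST c. ok (pfst (psnd m)) (psnd (psnd m)) c)"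
    by (rule computable_comp2) (intro computable_intros)+
  then have "computable e"
    using computable_rec[OF computable_const _ computable_id, of "\<lambda>n k s. LEAST c. ok k s c" c0]
    by (simp add: e_def)
  moreover have "Q (set_decode (e k))" for k
    using e[of "k - 1"] c0 by (cases k) (auto simp: ok_def e_def)
  moreover have "exhausts e"
  proof -
    have "i \<in> rsp a \<longleftrightarrow> a \<in> set_decode (oc i)" for i a by (simp flip: oc(1))
    then show ?thesis
      unfolding exhausts_def using \<open>computable e\<close> e[unfolded ok_def] by blast
  qed
  ultimately show ?thesis by blast
qed

definition component :: "nat \<Rightarrow> nat set" where
  "component a = {b. (a, b) \<in> {(a, b). b \<in> nb a}\<^sup>*}"

lemma component_step: "b \<in> component a \<Longrightarrow> d \<in> nb b \<Longrightarrow> d \<in> component a"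
  unfolding component_def by (auto intro: rtrancl_into_rtrancl)

lemma component_self: "a \<in> component a"
  by (simp add: component_def)

lemma component_sym: "b \<in> component a \<Longrightarrow> a \<in> component b"
proof -
  have "sym {(a, b). b \<in> nb a}" by (auto simp: sym_def nb_sym)
  then show "b \<in> component a \<Longrightarrow> a \<in> component b"
    unfolding component_def by (auto dest: symD[OF sym_rtrancl])
qed

lemma component_trans: "b \<in> component a \<Longrightarrow> d \<in> component b \<Longrightarrow> d \<in> component a"
  unfolding component_def by auto

text \<open>
  Compatibility of the order passes along neighbours: an event lies entirely above or entirely below
  a component to which it does not belong.
\<close>

lemma component_below:
  assumes "d \<notin> component b"
  shows "e \<in> component b \<Longrightarrow> lt b d \<Longrightarrow> lt e d"
    and "e \<in> component b \<Longrightarrow> lt d b \<Longrightarrow> lt d e"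
proof -
  have 1: "(b, e) \<in> {(a, b). b \<in> nb a}\<^sup>* \<Longrightarrow> lt b d \<longleftrightarrow> lt e d" for e
  proof (induction rule: rtrancl_induct)
    case (step y z)
    have "y \<in> component b" "z \<in> component b"
      using step.hyps by (auto simp: component_def intro: rtrancl_into_rtrancl)
    then have "y \<notin> nb d" "z \<notin> nb d" using assms component_step nb_sym by blast+
    then have "lt y d \<longleftrightarrow> lt z d" using step.hyps(2) lt_Gam[of y z d] lt_Gam[of z y d] nb_sym[of z y] by auto
    then show ?case using step.IH by simp
  qed simp
  assume e: "e \<in> component b"
  then have iff: "lt b d \<longleftrightarrow> lt e d" using 1 by (simp add: component_def)
  then show "lt b d \<Longrightarrow> lt e d" by simp
  have "e \<noteq> d" "b \<noteq> d" using e assms component_self by auto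
  then show "lt d b \<Longrightarrow> lt d e" using iff lt_total[of e d] lt_asym[of d b] by blast
qed

text \<open>
  Since only finitely many events precede a given one, all events outside an infinite component lie
  below it, and there are finitely many of them. Inside the component, an event \<open>a\<close> below \<open>b\<close> is
  connected with \<open>b\<close> by a path that stays below \<open>b\<close> until it reaches a neighbour of \<open>b\<close>. So closure
  under the local conditions in \<open>Q\<close> suffices for being an initial segment, and these are decidable.
\<close>

lemma ex_staging_infinite_component:
  assumes inf: "infinite (component a0)"
  shows "\<exists>e. exhausts e \<and> (\<forall>k b a. b \<in> set_decode (e k) \<longrightarrow> lt a b \<longrightarrow> a \<in> set_decode (e k))"
proof -
  define B where "B = insert a0 {b. lt b a0}"
  have fB: "finite B" by (simp add: B_def finite_below)
  define Q where "Q F \<longleftrightarrow> B \<subseteq> F \<and> (\<forall>b\<in>F. (\<forall>a'\<in>nb b. \<forall>a\<in>nb a'. lt a b \<longrightarrow> a \<in> F) \<and>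
    (\<forall>a'\<in>F. \<forall>a\<in>nb a'. lt a b \<longrightarrow> a \<in> F))" for F
  have outside: "lt b a0" if "b \<notin> component a0" for b
  proof (rule ccontr)
    assume "\<not> lt b a0"
    then have "lt a0 b" using lt_total[of a0 b] that component_self by auto
    then have "component a0 \<subseteq> {a. lt a b}" using component_below(1)[OF that] by blast
    then show False using inf finite_below finite_subset by blast
  qed
  have initial: "a \<in> F" if QF: "Q F" and b: "b \<in> F" and ab: "lt a b" for F a b
  proof (cases "a \<in> component a0 \<and> b \<in> component a0")
    case False
    then have "lt a a0" using outside lt_trans[OF ab] by blast
    then have "a \<in> B" by (simp add: B_def)
    then show ?thesis using QF[unfolded Q_def, THEN conjunct1] by blast
  next
    case True
    then have "b \<in> component a" using component_sym component_trans by blast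
    then have "(a, b) \<in> {(a, b). b \<in> nb a}\<^sup>*" by (simp add: component_def)
    then have "lt a b \<longrightarrow> a \<in> F"
    proof (induction rule: converse_rtrancl_induct)
      case (step a a')
      show ?case
      proof
        assume "lt a b"
        have a': "a' \<in> nb a" "a \<in> nb a'" using step.hyps(1) nb_sym by auto
        show "a \<in> F"
        proof (cases "a' \<in> nb b")
          case True
          then show ?thesis using QF b a'(2) \<open>lt a b\<close> unfolding Q_def by blast
        next
          case False
          then have "lt a' b" using lt_Gam[OF a'(1) _ \<open>lt a b\<close>] by blast
          then show ?thesis using QF b a'(2) \<open>lt a b\<close> step.IH unfolding Q_def by blast
        qed
      qed
    qed (simp add: b)
    then show ?thesis using ab by blast
  qed
  have "\<exists>e. exhausts e \<and> (\<forall>k. Q (set_decode (e k)))"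
  proof (rule ex_exhausting)
    have "B = set_decode (set_encode B)" using fB by simp
    then have "Q F \<longleftrightarrow> (\<forall>b\<in>set_decode (set_encode B). b \<in> F) \<and> (\<forall>b\<in>F. (\<forall>a'\<in>nb b. \<forall>a\<in>nb a'. lt a b \<longrightarrow> a \<in> F) \<and>
      (\<forall>a'\<in>F. \<forall>a\<in>nb a'. lt a b \<longrightarrow> a \<in> F))" for F unfolding Q_def by blast
    then show "decidable (\<lambda>n. Q (set_decode n))"
      by (simp only:) (intro computable_intros decidable_all_nb decidable_comp2[OF lt_decidable])
    fix S :: "nat set" assume S: "finite S"
    define F where "F = (\<Union>s\<in>insert a0 S. insert s {a. lt a s})"
    have "finite F" using S finite_below by (auto simp: F_def)
    moreover have "a \<in> F" if "b \<in> F" "lt a b" for a b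
      using that lt_trans unfolding F_def by blast
    then have "Q F" unfolding Q_def by (auto simp: B_def F_def)
    ultimately show "\<exists>F. finite F \<and> S \<subseteq> F \<and> Q F" by (intro exI[of _ F]) (auto simp: F_def)
  qed
  then show ?thesis using initial by blast
qed

text \<open>
  If all components are finite, the stages can be unions of components, and the order can be changed
  to compare stages first. Neighbours then have the same stage, which preserves the compatibility
  with the neighbour relation. The other requirement survives because a stage contains, with an event
  \<open>b\<close>, each smaller event that resamples a variable of \<open>b\<close>.
\<close>

lemma ex_staging_finite_components:
  assumes fin: "\<And>a. finite (component a)"
  shows "\<exists>lt' e. left_order vbl rsp lt' \<and> decidable (\<lambda>n. lt' (pfst n) (psnd n)) \<and> exhausts e \<and>
    (\<forall>k b a. b \<in> set_decode (e k) \<longrightarrow> lt' a b \<longrightarrow> a \<in> set_decode (e k))"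
proof -
  define Q where "Q F \<longleftrightarrow> (\<forall>b\<in>F. (\<forall>a\<in>nb b. a \<in> F) \<and>
    (\<forall>i\<in>set_decode (vc b). \<forall>d\<in>set_decode (oc i). lt d b \<longrightarrow> d \<in> F))" for F
  have "\<exists>e. exhausts e \<and> (\<forall>k. Q (set_decode (e k)))"
  proof (rule ex_exhausting)
    show "decidable (\<lambda>n. Q (set_decode n))"
      unfolding Q_def
      by (intro computable_intros decidable_all_nb decidable_comp2[OF lt_decidable]
          computable.comp[OF vc(2)] computable.comp[OF oc(2)])
    fix S :: "nat set" assume S: "finite S"
    define D where "D = (\<Union>s\<in>S. insert s {a. lt a s})"
    define F where "F = (\<Union>d\<in>D. component d)"
    have D: "finite D" "\<And>a b. b \<in> D \<Longrightarrow> lt a b \<Longrightarrow> a \<in> D"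
      using S finite_below lt_trans unfolding D_def by (simp, blast)
    have "d \<in> F" if bF: "b \<in> F" and db: "lt d b" for b d
    proof -
      obtain b0 where b0: "b0 \<in> D" "b \<in> component b0" using bF by (auto simp: F_def)
      show ?thesis
      proof (cases "d \<in> component b")
        case True
        then show ?thesis using b0 component_trans by (auto simp: F_def)
      next
        case False
        have "lt d b0" using component_below(2)[OF False component_sym[OF b0(2)] db] .
        then have "d \<in> D" using D(2) b0(1) by blast
        then show ?thesis using component_self by (auto simp: F_def)
      qed
    qed
    then have "Q F" using component_step unfolding Q_def F_def by blast
    moreover have "S \<subseteq> F" using component_self by (auto simp: F_def D_def)
    moreover have "finite F" using D(1) fin by (simp add: F_def)
    ultimately show "\<exists>F. finite F \<and> S \<subseteq> F \<and> Q F" by blast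
  qed
  then obtain e where e: "exhausts e" "\<And>k. Q (set_decode (e k))" by blast
  have ce: "computable e" using e(1) by (simp add: exhausts_def)
  have mono: "set_decode (e i) \<subseteq> set_decode (e k)" if "i \<le> k" for i k
    by (rule lift_Suc_mono_le[of "\<lambda>k. set_decode (e k)", OF _ that])
      (use e(1) nb_self in \<open>auto simp: exhausts_def\<close>)
  have all: "\<exists>k. a \<in> set_decode (e k)" for a using e(1) by (auto simp: exhausts_def)
  define stage where "stage a = (LEAST k. a \<in> set_decode (e k))" for a
  have stage: "a \<in> set_decode (e k) \<longleftrightarrow> stage a \<le> k" for a k
    using LeastI_ex[OF all[of a]] Least_le[of "\<lambda>k. a \<in> set_decode (e k)" k] mono
    unfolding stage_def by blast
  have cs: "computable stage"
    unfolding stage_def by (rule computable_Least[OF _ all]) (intro computable_intros computable.comp[OF ce])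
  (* Within one stage the given order is kept. *)
  define lt' where "lt' a b \<longleftrightarrow> stage a < stage b \<or> stage a = stage b \<and> lt a b" for a b
  have stage_nb: "stage a = stage b" if "a \<in> nb b" for a b
  proof -
    have "stage a \<le> k \<longleftrightarrow> stage b \<le> k" for k
      using e(2)[of k] that nb_sym[of a b] unfolding stage[symmetric] Q_def by blast
    then show ?thesis by (meson antisym order_refl)
  qed
  have "left_order vbl rsp lt'"
  proof unfold_locales
    fix a b c
    show "lt' a b \<Longrightarrow> lt' b c \<Longrightarrow> lt' a c" using lt_trans by (auto simp: lt'_def)
    show "a \<noteq> b \<Longrightarrow> lt' a b \<or> lt' b a" using lt_total[of a b] by (auto simp: lt'_def)
    show "a \<in> nb b \<Longrightarrow> a \<notin> nb c \<Longrightarrow> lt' b c \<Longrightarrow> lt' a c"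
      using stage_nb[of a b] lt_Gam[of a b c] by (auto simp: lt'_def)
    show "rsp a \<inter> vbl b = {}" if "much_less rsp lt' b a"
    proof (cases "lt b a")
      case True
      then show ?thesis using that by (intro lt_vbl) (simp add: much_less_def)
    next
      case False
      then have ba: "stage b < stage a" using that by (auto simp: much_less_def lt'_def)
      then have "lt a b" using False lt_total[of a b] by auto
      have "b \<in> set_decode (e (stage b))" "a \<notin> set_decode (e (stage b))" using ba by (auto simp: stage)
      then have "a \<notin> set_decode (oc i)" if "i \<in> set_decode (vc b)" for i
        using e(2)[of "stage b"] \<open>lt a b\<close> that unfolding Q_def by blast
      then show ?thesis using vc(1)[of b] oc(1) by blast
    qed
  qed (auto simp: lt'_def lt_irrefl finite_vbl rsp_vbl finite_Gam)
  moreover have "decidable (\<lambda>n. lt' (pfst n) (psnd n))"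
    unfolding lt'_def by (intro computable_intros lt_decidable computable.comp[OF cs])
  moreover have "a \<in> set_decode (e k)" if "b \<in> set_decode (e k)" "lt' a b" for a b k
    using that unfolding stage lt'_def by auto
  ultimately show ?thesis using e(1) by blast
qed

theorem ex_staging:
  "\<exists>lt' e. left_order vbl rsp lt' \<and> decidable (\<lambda>n. lt' (pfst n) (psnd n)) \<and> exhausts e \<and>
    (\<forall>k b a. b \<in> set_decode (e k) \<longrightarrow> lt' a b \<longrightarrow> a \<in> set_decode (e k))"
proof (cases "\<forall>a. finite (component a)")
  case True
  then show ?thesis using ex_staging_finite_components by blast
next
  case False
  then obtain a0 where "infinite (component a0)" by blast
  then show ?thesis
    using ex_staging_infinite_component lt_decidable left_order_axioms by blast
qed

end

section \<open>The computable left-handed local lemma\<close>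

lemma order_type_omega_props:
  assumes "order_type_omega lt"
  shows "\<not> lt a a" and "lt a b \<Longrightarrow> lt b c \<Longrightarrow> lt a c" and "a \<noteq> b \<Longrightarrow> lt a b \<or> lt b a"
    and "finite {a. lt a b}"
proof -
  obtain f :: "nat \<Rightarrow> nat" where f: "bij f" "\<And>a b. lt a b \<longleftrightarrow> f a < f b"
    using assms unfolding order_type_omega_def by blast
  have inj: "inj f" using f(1) by (rule bij_is_inj)
  show "\<not> lt a a" "lt a b \<Longrightarrow> lt b c \<Longrightarrow> lt a c" by (auto simp: f(2))
  show "a \<noteq> b \<Longrightarrow> lt a b \<or> lt b a" unfolding f(2) using inj_eq[OF inj, of a b] by linarith
  have "{a. lt a b} = f -` {..<f b}" by (auto simp: f(2))
  then show "finite {a. lt a b}" using finite_vimageI[OF _ inj] by simp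
qed

lemma assignment_code_eqD:
  assumes "finite S" "assignment_code S u = assignment_code S v" "i \<in> S"
  shows "u i = v i"
proof -
  have "(\<lambda>i. prod_encode (i, u i)) ` S = (\<lambda>i. prod_encode (i, v i)) ` S"
    using assms(1,2) inj_on_set_encode by (auto simp: assignment_code_def dest: inj_onD)
  then have "prod_encode (i, u i) \<in> (\<lambda>i. prod_encode (i, v i)) ` S" using assms(3) by blast
  then show ?thesis by auto
qed

text \<open>
  Codes of assignments determine the values on \<open>S\<close>, and members of \<open>PiE S R\<close> are determined by these
  values.
\<close>

lemma assignment_code_mem:
  assumes "finite S" "T \<subseteq> PiE S R"
  shows "assignment_code S v \<in> assignment_code S ` T \<longleftrightarrow> restrict v S \<in> T"
proof
  assume "restrict v S \<in> T"
  moreover have "assignment_code S (restrict v S) = assignment_code S v"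
    unfolding assignment_code_def by (intro arg_cong[where f = set_encode] image_cong) auto
  ultimately show "assignment_code S v \<in> assignment_code S ` T" by (metis imageI)
next
  assume "assignment_code S v \<in> assignment_code S ` T"
  then obtain t where t: "t \<in> T" "assignment_code S v = assignment_code S t" by blast
  have "restrict v S = t"
  proof
    fix i
    show "restrict v S i = t i"
      using assignment_code_eqD[OF assms(1) t(2)] PiE_arb[of t S R i] t(1) assms(2) by auto
  qed
  then show "restrict v S \<in> T" using t(1) by simp
qed

lemma rat_code_fraction:
  assumes "0 \<le> q"
  shows "real_of_rat q = real (pfst (rat_code q) div 2) / real (psnd (rat_code q) div 2)"
    and "0 < psnd (rat_code q) div 2"
proof -
  obtain a b where ab: "quotient_of q = (a, b)" by (cases "quotient_of q")
  have b: "0 < b" using quotient_of_denom_pos[OF ab] .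
  have q: "q = of_int a / of_int b" using quotient_of_div[OF ab] .
  have a: "0 \<le> a" using assms b unfolding q by (simp add: zero_le_divide_iff)
  have "int_encode i = 2 * nat i" if "0 \<le> i" for i
    using that by (simp add: int_encode_def sum_encode_def)
  then have 1: "pfst (rat_code q) div 2 = nat a" "psnd (rat_code q) div 2 = nat b"
    using a b by (auto simp: rat_code_def ab)
  then show "0 < psnd (rat_code q) div 2" using b by simp
  show "real_of_rat q = real (pfst (rat_code q) div 2) / real (psnd (rat_code q) div 2)"
    unfolding 1 using a b by (simp add: q of_rat_divide)
qed

text \<open>
  The link between averages and the given random variables: if the variables in \<open>T\<close> have the values
  \<open>v\<close>, those in \<open>S\<close> still have their original distribution. The induction moves one variable from
  \<open>S\<close> to \<open>T\<close> by splitting according to its value. With \<open>S\<close> the resample variables and \<open>T\<close> the other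
  variables of an event, the average is its conditional probability.
\<close>

lemma (in product_weights) measure_override:
  fixes M :: "'w measure" and X :: "nat \<Rightarrow> 'w \<Rightarrow> nat" and R :: "nat \<Rightarrow> nat set"
  assumes M: "prob_space M" and indep: "prob_space.indep_vars M (\<lambda>i. count_space (R i)) X UNIV"
    and finite_R: "\<And>i. finite (R i)" and Rp: "\<And>i. Rp i \<subseteq> R i"
    and w: "\<And>i y. measure M {\<omega> \<in> space M. X i \<omega> = y} = w i y"
    and w_outside: "\<And>i y. y \<notin> Rp i \<Longrightarrow> w i y = 0"
    and "finite S" "finite T" "S \<inter> T = {}"
  shows "{\<omega> \<in> space M. (\<forall>i\<in>T. X i \<omega> = v i) \<and> \<phi> (override_on v (\<lambda>i. X i \<omega>) S)} \<in> sets M \<and>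
    measure M {\<omega> \<in> space M. (\<forall>i\<in>T. X i \<omega> = v i) \<and> \<phi> (override_on v (\<lambda>i. X i \<omega>) S)} =
      (\<Prod>i\<in>T. w i (v i)) * avg S (\<lambda>v. of_bool (\<phi> v)) v"
  using assms(7-9)
proof (induction S arbitrary: T v rule: finite_induct)
  case empty
  interpret prob_space M by fact
  have X: "X i \<in> measurable M (count_space (R i))" for i
    using indep unfolding indep_vars_def2 by simp
  have XR: "X i \<omega> \<in> R i" if "\<omega> \<in> space M" for i \<omega>
    using measurable_space[OF X that] by simp
  define B where "B i = {\<omega> \<in> space M. X i \<omega> = v i}" for i
  have B: "B i = X i -` ({v i} \<inter> R i) \<inter> space M" for i using XR by (auto simp: B_def)
  have Bm: "B i \<in> sets M" for i unfolding B by (rule measurable_sets[OF X]) simp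
  have eq: "{\<omega> \<in> space M. \<forall>i\<in>T. X i \<omega> = v i} = (if T = {} then space M else (\<Inter>i\<in>T. B i))"
    by (auto simp: B_def)
  have 1: "{\<omega> \<in> space M. \<forall>i\<in>T. X i \<omega> = v i} \<in> sets M"
    unfolding eq using empty(1) Bm by (auto intro: sets.finite_INT)
  have 2: "measure M {\<omega> \<in> space M. \<forall>i\<in>T. X i \<omega> = v i} = (\<Prod>i\<in>T. w i (v i))"
  proof (cases "T = {}")
    case False
    have "prob (\<Inter>i\<in>T. B i) = (\<Prod>i\<in>T. prob (B i))"
      unfolding B by (rule indep_varsD[OF indep]) (use False empty(1) in auto)
    then show ?thesis unfolding eq using False w by (simp add: B_def)
  qed (simp add: prob_space)
  show ?case using 1 2 by (cases "\<phi> v") auto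
next
  case (insert x S)
  interpret prob_space M by fact
  have X: "X i \<in> measurable M (count_space (R i))" for i
    using indep unfolding indep_vars_def2 by simp
  have XR: "X i \<omega> \<in> R i" if "\<omega> \<in> space M" for i \<omega>
    using measurable_space[OF X that] by simp
  define A where "A y = {\<omega> \<in> space M. (\<forall>i\<in>insert x T. X i \<omega> = (v(x := y)) i) \<and>
    \<phi> (override_on (v(x := y)) (\<lambda>i. X i \<omega>) S)}" for y
  have xT: "x \<notin> T" using insert.prems by auto
  have A: "A y \<in> sets M" "prob (A y) = w x y * (\<Prod>i\<in>T. w i (v i)) * avg S (\<lambda>v. of_bool (\<phi> v)) (v(x := y))" for y
  proof -
    have "(\<Prod>i\<in>insert x T. w i ((v(x := y)) i)) = w x y * (\<Prod>i\<in>T. w i ((v(x := y)) i))"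
      using xT insert.prems by simp
    also have "(\<Prod>i\<in>T. w i ((v(x := y)) i)) = (\<Prod>i\<in>T. w i (v i))"
      by (rule prod.cong) (use xT in auto)
    finally have pr: "(\<Prod>i\<in>insert x T. w i ((v(x := y)) i)) = w x y * (\<Prod>i\<in>T. w i (v i))" .
    have "A y \<in> sets M \<and> prob (A y) = (\<Prod>i\<in>insert x T. w i ((v(x := y)) i)) * avg S (\<lambda>v. of_bool (\<phi> v)) (v(x := y))"
      unfolding A_def by (rule insert.IH) (use insert in auto)
    then show "A y \<in> sets M" "prob (A y) = w x y * (\<Prod>i\<in>T. w i (v i)) * avg S (\<lambda>v. of_bool (\<phi> v)) (v(x := y))"
      unfolding pr by auto
  qed
  have ov: "override_on (v(x := X x \<omega>)) (\<lambda>i. X i \<omega>) S = override_on v (\<lambda>i. X i \<omega>) (insert x S)" for \<omega>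
    using insert.hyps by (auto simp: override_on_def fun_eq_iff)
  have eq: "{\<omega> \<in> space M. (\<forall>i\<in>T. X i \<omega> = v i) \<and> \<phi> (override_on v (\<lambda>i. X i \<omega>) (insert x S))} = (\<Union>y\<in>R x. A y)"
    (is "?L = _")
  proof (intro equalityI subsetI)
    fix \<omega> assume "\<omega> \<in> ?L"
    then have "\<omega> \<in> A (X x \<omega>)" "X x \<omega> \<in> R x" using ov[of \<omega>] XR xT by (auto simp: A_def)
    then show "\<omega> \<in> (\<Union>y\<in>R x. A y)" by blast
  next
    fix \<omega> assume "\<omega> \<in> (\<Union>y\<in>R x. A y)"
    then obtain y where y: "\<omega> \<in> A y" by blast
    then have 1: "\<omega> \<in> space M" "\<forall>i\<in>insert x T. X i \<omega> = (v(x := y)) i"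
      "\<phi> (override_on (v(x := y)) (\<lambda>i. X i \<omega>) S)" by (simp_all add: A_def)
    then have "y = X x \<omega>" by simp
    then have "\<phi> (override_on v (\<lambda>i. X i \<omega>) (insert x S))" using 1(3) ov[of \<omega>] by simp
    moreover have "X i \<omega> = v i" if "i \<in> T" for i
      using 1(2) that xT by (metis fun_upd_other insertCI)
    ultimately show "\<omega> \<in> ?L" using 1(1) by simp
  qed
  have "prob (\<Union>y\<in>R x. A y) = (\<Sum>y\<in>R x. prob (A y))"
  proof (rule finite_measure_finite_Union)
    show "A ` R x \<subseteq> sets M" using A(1) by blast
    show "disjoint_family_on A (R x)" by (auto simp: disjoint_family_on_def A_def)
  qed (rule finite_R)
  also have "\<dots> = (\<Sum>y\<in>R x. (\<Prod>i\<in>T. w i (v i)) * (w x y * avg S (\<lambda>v. of_bool (\<phi> v)) (v(x := y))))"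
    by (simp add: A(2) mult_ac)
  also have "\<dots> = (\<Sum>y\<in>Rp x. (\<Prod>i\<in>T. w i (v i)) * (w x y * avg S (\<lambda>v. of_bool (\<phi> v)) (v(x := y))))"
    by (rule sum.mono_neutral_right) (use finite_R Rp w_outside in auto)
  also have "\<dots> = (\<Prod>i\<in>T. w i (v i)) * avg (insert x S) (\<lambda>v. of_bool (\<phi> v)) v"
    by (simp add: avg_insert[OF insert.hyps(1)] avg1_def sum_distrib_left)
  finally show ?case unfolding eq using A(1) finite_R by auto
qed

text \<open>
  Replacing \<open>z\<close> by \<open>s * z\<close> uses up one of the two factors \<open>s\<close> and bounds the new \<open>z\<close> by \<open>s\<close>. The
  other factor remains for the decay along cones.
\<close>

lemma shrink_weights:
  fixes z :: "nat \<Rightarrow> real" and a :: nat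
  assumes z: "\<And>b. 0 < z b \<and> z b < 1" and s: "0 < s" "s < 1" and G: "finite G" "a \<notin> G"
    and P: "P \<le> s * s * z a * (\<Prod>b\<in>G. 1 - z b)"
  shows "P * (\<Prod>b\<in>insert a G. 1 + s * z b / (1 - s * z b)) \<le> s * (s * z a / (1 - s * z a))"
proof -
  have y: "0 < s * z b" "s * z b < z b" "s * z b < 1" for b
  proof -
    show "0 < s * z b" using z[of b] s by simp
    show "s * z b < z b" using z[of b] s mult_strict_right_mono[of s 1 "z b"] by simp
    then show "s * z b < 1" using z[of b] by linarith
  qed
  have inv: "1 + s * z b / (1 - s * z b) = 1 / (1 - s * z b)" for b
    using y(3)[of b] by (simp add: field_simps)
  have pos: "0 < (\<Prod>b\<in>G. 1 - s * z b)" using y by (intro prod_pos) auto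
  have "P \<le> s * s * z a * (\<Prod>b\<in>G. 1 - s * z b)"
  proof -
    have "(\<Prod>b\<in>G. 1 - z b) \<le> (\<Prod>b\<in>G. 1 - s * z b)"
      using y z by (intro prod_mono) (auto intro: less_imp_le)
    then have "s * s * z a * (\<Prod>b\<in>G. 1 - z b) \<le> s * s * z a * (\<Prod>b\<in>G. 1 - s * z b)"
      using s z[of a] by (intro mult_left_mono) auto
    then show ?thesis using P by linarith
  qed
  moreover have "(\<Prod>b\<in>insert a G. 1 + s * z b / (1 - s * z b)) = 1 / (1 - s * z a) * (1 / (\<Prod>b\<in>G. 1 - s * z b))"
    using G by (simp add: inv prod_dividef)
  ultimately have "P * (\<Prod>b\<in>insert a G. 1 + s * z b / (1 - s * z b)) \<le>
      s * s * z a * (\<Prod>b\<in>G. 1 - s * z b) * (1 / (1 - s * z a) * (1 / (\<Prod>b\<in>G. 1 - s * z b)))"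
    using pos y[of a] by (simp only:) (intro mult_right_mono, auto)
  also have "\<dots> = s * (s * z a / (1 - s * z a))" using pos by simp
  finally show ?thesis .
qed

theorem theorem2p4:
  fixes M :: "'w measure"
    and X :: "nat \<Rightarrow> 'w \<Rightarrow> nat"
    and R :: "nat \<Rightarrow> nat set"
    and A :: "nat \<Rightarrow> 'w set"
    and vbl rsp :: "nat \<Rightarrow> nat set"
    and tru :: "nat \<Rightarrow> (nat \<Rightarrow> nat) set"
    and prc :: "nat \<Rightarrow> nat \<Rightarrow> bool"
    and p :: "nat \<Rightarrow> nat \<Rightarrow> rat"
    and Pstar z :: "nat \<Rightarrow> real"
    and \<alpha> :: rat
  assumes setting: "resample_setting M X R A vbl rsp tru prc"
    and rsp_presented: "computably_presented rsp"
    and vbl_presented: "computably_presented vbl"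
    and tru_presented: "computably_presented (\<lambda>a. assignment_code (vbl a) ` tru a)"
    and distr: "\<And>x v. measure M {\<omega> \<in> space M. X x \<omega> = v} = of_rat (p x v)"
    and distr_computable: "computable (\<lambda>n. case prod_decode n of (x, v) \<Rightarrow> rat_code (p x v))"
    and occ_presented: "computably_presented (\<lambda>x. {a. x \<in> rsp a})"
    and order_computable: "computable_rel prc"
    and Pstar_range: "\<And>a. 0 < Pstar a \<and> Pstar a < 1"
    and z_range: "\<And>a. 0 < z a \<and> z a < 1"
    and alpha_range: "0 < \<alpha>" "\<alpha> < 1"
    and Pstar_lower: "\<And>a. Pstar a \<ge>
      (SUP \<mu> \<in> {\<mu> \<in> PiE (stc vbl rsp a) R. measure M (val_event M X (stc vbl rsp a) \<mu>) > 0}.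
         \<P>(\<omega> in M. \<omega> \<in> A a \<bar> \<omega> \<in> val_event M X (stc vbl rsp a) \<mu>))"
    and Pstar_upper: "\<And>a. Pstar a \<le> of_rat \<alpha> * z a * (\<Prod>b\<in>Gam rsp a. (1 - z b))"
  shows "\<exists>v. computable v \<and> (\<forall>x. v x \<in> R x) \<and> (\<forall>a. restrict v (vbl a) \<notin> tru a)"
proof -
  interpret resample_setting M X R A vbl rsp tru prc by (rule setting)
  define w where "w i y = real_of_rat (p i y)" for i y
  (* Values of probability 0 are excluded: with them an event may be true although its
     conditional probability is never considered. *)
  define Rp where "Rp i = {y \<in> R i. 0 < w i y}" for i
  define bad where "bad a v \<longleftrightarrow> restrict v (vbl a) \<in> tru a" for a v
  have X: "X i \<in> measurable M (count_space (R i))" for i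
    using indep unfolding indep_vars_def2 by simp
  have XR: "X i \<omega> \<in> R i" if "\<omega> \<in> space M" for i \<omega>
    using measurable_space[OF X that] by simp
  have w: "measure M {\<omega> \<in> space M. X i \<omega> = y} = w i y" for i y
    using distr by (simp add: w_def)
  have w0: "0 \<le> w i y" for i y using w[of i y] measure_nonneg by metis
  have w_out: "w i y = 0" if "y \<notin> Rp i" for i y
  proof (cases "y \<in> R i")
    case True
    then show ?thesis using that w0[of i y] by (simp add: Rp_def)
  next
    case False
    then have "{\<omega> \<in> space M. X i \<omega> = y} = {}" using XR by auto
    then show ?thesis using w[of i y] by (simp only: measure_empty)
  qed
  have w_sum: "(\<Sum>y\<in>Rp i. w i y) = 1" for i
  proof -
    have m: "{\<omega> \<in> space M. X i \<omega> = y} \<in> sets M" if "y \<in> R i" for y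
    proof -
      have "{\<omega> \<in> space M. X i \<omega> = y} = X i -` {y} \<inter> space M" by auto
      then show ?thesis using measurable_sets[OF X, of "{y}" i] that by simp
    qed
    have "(\<Sum>y\<in>Rp i. w i y) = (\<Sum>y\<in>R i. w i y)"
      by (rule sum.mono_neutral_left) (use finite_R w_out in \<open>auto simp: Rp_def\<close>)
    also have "\<dots> = prob (\<Union>y\<in>R i. {\<omega> \<in> space M. X i \<omega> = y})"
      unfolding w[symmetric]
      by (rule finite_measure_finite_Union[symmetric]) (use finite_R m in \<open>auto simp: disjoint_family_on_def\<close>)
    also have "(\<Union>y\<in>R i. {\<omega> \<in> space M. X i \<omega> = y}) = space M" using XR by auto
    finally show ?thesis by (simp add: prob_space)
  qed
  interpret product_weights Rp w
    by unfold_locales (use w0 w_sum finite_R in \<open>auto simp: Rp_def\<close>)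
  have P_bound: "avg (rsp a) (\<lambda>u. of_bool (bad a u)) v \<le> Pstar a" if v: "good v" for a v
  proof -
    define S where "S = stc vbl rsp a"
    define E where "E = val_event M X S v"
    have fin: "finite (rsp a)" "finite S" "rsp a \<inter> S = {}" "vbl a = rsp a \<union> S"
      using finite_vbl[of a] rsp_subset[of a] finite_subset by (auto simp: S_def stc_def)
    note ov = measure_override[OF prob_space_axioms indep finite_R _ w w_out]
    have Rp: "Rp i \<subseteq> R i" for i by (auto simp: Rp_def)
    have E: "prob E = (\<Prod>i\<in>S. w i (v i))"
      using ov[OF Rp, of "{}" S v "\<lambda>_. True"] fin by (simp add: E_def val_event_def)
    have pos: "0 < prob E" unfolding E using v by (intro prod_pos) (auto simp: good_def Rp_def)
    have "bad a (override_on v (\<lambda>i. X i \<omega>) (rsp a)) \<longleftrightarrow> \<omega> \<in> A a" if "\<omega> \<in> E" for \<omega>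
    proof -
      have "restrict (override_on v (\<lambda>i. X i \<omega>) (rsp a)) (vbl a) = restrict (\<lambda>i. X i \<omega>) (vbl a)"
        using that fin by (auto simp: restrict_def override_on_def fun_eq_iff E_def val_event_def)
      then show ?thesis using that by (simp add: bad_def event_tru E_def val_event_def)
    qed
    then have "{\<omega> \<in> space M. \<omega> \<in> A a \<and> \<omega> \<in> E} =
        {\<omega> \<in> space M. (\<forall>i\<in>S. X i \<omega> = v i) \<and> bad a (override_on v (\<lambda>i. X i \<omega>) (rsp a))}"
      by (auto simp: E_def val_event_def)
    then have "prob {\<omega> \<in> space M. \<omega> \<in> A a \<and> \<omega> \<in> E} = prob E * avg (rsp a) (\<lambda>u. of_bool (bad a u)) v"
      using ov[OF Rp, of "rsp a" S v "bad a"] fin E by simp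
    moreover have "{\<omega> \<in> space M. \<omega> \<in> E} = E" by (auto simp: E_def val_event_def)
    ultimately have cp: "\<P>(\<omega> in M. \<omega> \<in> A a \<bar> \<omega> \<in> E) = avg (rsp a) (\<lambda>u. of_bool (bad a u)) v"
      using pos by (simp add: cond_prob_def)
    define I where "I = {\<mu> \<in> PiE S R. measure M (val_event M X S \<mu>) > 0}"
    have vE: "val_event M X S (restrict v S) = E" by (auto simp: val_event_def E_def)
    have "restrict v S \<in> I" using v Rp pos vE by (auto simp: I_def good_def)
    moreover have "finite I" using finite_PiE[OF fin(2), of R] finite_R by (simp add: I_def)
    ultimately have "\<P>(\<omega> in M. \<omega> \<in> A a \<bar> \<omega> \<in> E) \<le>
        (SUP \<mu>\<in>I. \<P>(\<omega> in M. \<omega> \<in> A a \<bar> \<omega> \<in> val_event M X S \<mu>))"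
      unfolding vE[symmetric] by (intro cSUP_upper bdd_above_finite finite_imageI)
    then show ?thesis using Pstar_lower[of a] cp by (simp add: I_def S_def)
  qed
  define vc where "vc a = set_encode (vbl a)" for a
  define rc where "rc a = set_encode (rsp a)" for a
  define oc where "oc i = set_encode {a. i \<in> rsp a}" for i
  define tc where "tc a = set_encode (assignment_code (vbl a) ` tru a)" for a
  have vc: "vbl a = set_decode (vc a)" "computable vc" for a
    using vbl_presented by (auto simp: computably_presented_def vc_def[abs_def])
  have rc: "rsp a = set_decode (rc a)" "computable rc" for a
    using rsp_presented by (auto simp: computably_presented_def rc_def[abs_def])
  have oc: "{a. i \<in> rsp a} = set_decode (oc i)" "computable oc" for i
    using occ_presented by (auto simp: computably_presented_def oc_def[abs_def])
  have tc: "bad a v \<longleftrightarrow> assignment_code (vbl a) v \<in> set_decode (tc a)" "computable tc" for a v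
    using tru_presented assignment_code_mem[OF finite_vbl tru_subset, of a v]
    by (auto simp: computably_presented_def tc_def[abs_def] bad_def)
  have finite_rsp: "finite (rsp a)" for a using rsp_subset finite_vbl finite_subset by blast
  have "Gam_plus rsp a \<subseteq> insert a (\<Union>i\<in>rsp a. {b. i \<in> rsp b})" for a
    by (auto simp: Gam_plus_def Gam_def)
  moreover have "finite {b. i \<in> rsp b}" for i
    using occ_presented by (simp add: computably_presented_def)
  ultimately have finite_nb: "finite (Gam_plus rsp a)" for a
    using finite_rsp[of a] by (meson finite_UN_I finite_insert finite_subset)
  interpret O: coded_order vbl rsp prc vc rc oc
  proof unfold_locales
    show "decidable (\<lambda>n. prc (pfst n) (psnd n))"
      using order_computable by (simp add: computable_rel_def decidable_def case_prod_beta)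
    fix a b c
    show "a \<in> Gam_plus rsp b \<Longrightarrow> a \<notin> Gam_plus rsp c \<Longrightarrow> prc b c \<Longrightarrow> prc a c" by (rule order_Gam)
    show "much_less rsp prc b a \<Longrightarrow> rsp a \<inter> vbl b = {}" by (rule order_vbl)
    show "prc a b \<Longrightarrow> prc b c \<Longrightarrow> prc a c" "\<not> prc a a" "a \<noteq> b \<Longrightarrow> prc a b \<or> prc b a" "finite {a. prc a b}"
      using order_type_omega_props[OF omega] by blast+
  qed (fact vc rc oc finite_vbl rsp_subset finite_nb)+
  obtain lt e where lt: "left_order vbl rsp lt" "decidable (\<lambda>n. lt (pfst n) (psnd n))"
    and e: "O.exhausts e" "\<And>k b a. b \<in> set_decode (e k) \<Longrightarrow> lt a b \<Longrightarrow> a \<in> set_decode (e k)"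
    using O.ex_staging by blast
  (* The slack is divided evenly: one factor s bounds x uniformly, without any knowledge of how z
     depends on the event, and one factor s is left as the rate of decay. *)
  define s where "s = sqrt (real_of_rat \<alpha>)"
  have s: "0 < s" "s < 1" "s * s = real_of_rat \<alpha>"
    using alpha_range by (auto simp: s_def)
  define x where "x a = s * z a / (1 - s * z a)" for a
  have sz: "0 < s * z a" "s * z a \<le> s" "s * z a < 1" for a
  proof -
    show "0 < s * z a" using s z_range[of a] by simp
    show "s * z a \<le> s" using s z_range[of a] mult_left_mono[of "z a" 1 s] by simp
    then show "s * z a < 1" using s(2) by linarith
  qed
  have x: "0 \<le> x a" "x a \<le> s / (1 - s)" for a
    using sz[of a] s by (auto simp: x_def intro!: frac_le)
  have P_x: "Pstar a * (\<Prod>b\<in>Gam_plus rsp a. 1 + x b) \<le> s * x a" for a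
    unfolding x_def Gam_plus_def
  proof (rule shrink_weights[OF z_range s(1,2)])
    show "finite (Gam rsp a)" using finite_nb[of a] by (simp add: Gam_plus_def)
    show "a \<notin> Gam rsp a" by (simp add: Gam_def)
    show "Pstar a \<le> s * s * z a * (\<Prod>b\<in>Gam rsp a. 1 - z b)" using Pstar_upper[of a] s(3) by simp
  qed
  obtain m where m: "s ^ m < 1 / 2" using real_arch_pow_inv[of "1 / 2" s] s by auto
  obtain C0 where C0: "s / (1 - s) \<le> real C0" using real_arch_simple by blast
  define pn where "pn i y = pfst (rat_code (p i y)) div 2" for i y
  define pd where "pd i y = psnd (rat_code (p i y)) div 2" for i y
  have "0 \<le> p i y" for i y using w0[of i y] by (simp add: w_def)
  note frac = rat_code_fraction[OF this]
  have pc: "computable (\<lambda>n. rat_code (p (pfst n) (psnd n)))"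
    using distr_computable by (simp add: case_prod_beta)
  have pnd: "computable (\<lambda>n. pn (pfst n) (psnd n))" "computable (\<lambda>n. pd (pfst n) (psnd n))"
    unfolding pn_def pd_def by (intro computable_intros pc)+
  interpret L: left_order vbl rsp lt by (rule lt(1))
  interpret coded_resampling Rp w vbl rsp lt bad Pstar x s "s / (1 - s)" "\<lambda>k. set_decode (e k)" m "Suc C0"
    vc rc tc e pn pd
  proof unfold_locales
    fix a b k i y v
    show "depends_on (vbl a) (bad a)"
      unfolding depends_on_def bad_def agree_def by (metis restrict_ext)
    show "0 \<le> Pstar a" using Pstar_range[of a] by simp
    show "(\<Union>a\<in>set_decode (e k). Gam_plus rsp a) \<subseteq> set_decode (e (Suc k))"
      "k \<in> set_decode (e (Suc k))" "computable e"
      using e(1) by (simp_all add: O.exhausts_def)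
    then show "set_decode (e k) \<subseteq> set_decode (e (Suc k))" using L.nb_self by blast
    show "a \<in> set_decode (e (Suc k))" if "y < k" "y \<in> rsp a" using e(1) that by (simp add: O.exhausts_def)
    show "w i y = real (pn i y) / real (pd i y)" "0 < pd i y"
      using frac[of i y] by (simp_all add: pn_def pd_def w_def)
    show "y \<in> Rp i \<longleftrightarrow> 0 < w i y"
    proof (cases "y \<in> Rp i")
      case False
      then show ?thesis using w_out[OF False] by simp
    qed (simp add: Rp_def)
  qed (use P_bound x s P_x e(2) m C0 vc rc tc lt(2) pnd in auto)
  show ?thesis
  proof (intro exI[of _ solution] conjI allI)
    show "computable solution" by (rule computable_solution)
    show "solution i \<in> R i" for i using solution_valid(1)[of i] by (simp add: Rp_def)
    show "restrict solution (vbl a) \<notin> tru a" for a using solution_valid(2)[of a] by (simp add: bad_def)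
  qed
qed

end
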